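(* For each $(a,b)\in\mathbf B$ there are unique $(a_+,b_+)\in\mathbf H$ and $(a_-,b_-)\in\mathbf H_0^*$ such that $(a_-,b_-)(a_+,b_+)=(a,b)$ almost everywhere on $\mathbb T$. Moreover, there is a unique $F\in\ell^2(\mathbb Z)$ whose nonlinear Fourier series is $(a,b)$.
   Context: $\mathbb T$ unit circle, $\mathbb D$ open unit disc, $\mathbb D^*=\{\overline z^{-1}:z\in\mathbb D\}\cup\{\infty\}$, $a^*(z)=\overline{a(\overline z^{-1})}$. $H^2(\mathbb D)$: functions in $L^2(\mathbb T)$ with vanishing negative Fourier coefficients (identified with analytic extensions to $\mathbb D$); $H^2(\mathbb D^* )$: $f$ with $f^*\in H^2(\mathbb D)$, extended analytically to $\mathbb D^*$ with $f(\infty)=\overline{f^*(0)}$. Inner function: bounded analytic $g$ on $\mathbb D$ with $|g|=1$ a.e. on $\mathbb T$. Pairs multiply as $(a,b)(c,d)=(ac-bd^*,ad+bc^* )$, with $y^*=\overline y$ for constants and $(z^k)^*=z^{-k}$. $\mathbf L$: pairs $(a,b)$ of measurable functions on $\mathbb T$ with $aa^*+bb^*=1$ a.e., $a\in H^2(\mathbb D^* )$, $a(\infty)>0$; metric $\rho((a,b),(c,d))=\|a-c\|_{L^2}+\|b-d\|_{L^2}+|\log a(\infty)-\log c(\infty)|$. $\overline{\mathbf H}$: $(a,b)\in\mathbf L$ with $b\in H^2(\mathbb D)$. $\mathbf H$: $(a,b)\in\overline{\mathbf H}$ such that any inner $g$ with $a^*g^{-1},bg^{-1}\in H^2(\mathbb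 D)$ is constant. $\mathbf H_0^*$: $(a,b)\in\mathbf L$ with $(a,b^* )\in\mathbf H$ and $b^*(0)=0$. $\mathbf B$: $(a,b)\in\mathbf L$ with $\inf_{z\in\mathbb D^*}|a(z)|^2>\frac12$. Nonlinear Fourier series: for finitely supported $G:\mathbb Z\to\mathbb C$ it is the first row $(a,b)$ of the ordered product $\prod_k(1+|G_k|^2)^{-1/2}\begin{pmatrix}1&G_kz^k\\-\overline{G_k}z^{-k}&1\end{pmatrix}$ ($k$ increasing left to right). For $F\in\ell^2(\mathbb Z)$ write $F=F_-+F_+$ with $F_-$ supported in $(-\infty,-1]$ and $F_+$ in $[0,\infty)$; the nonlinear Fourier series $(a_+,b_+)$ of $F_+$ is the $\rho$-limit as $k\to\infty$ of those of $F_+\mathbf 1_{[0,k]}$, the nonlinear Fourier series $(a_-,b_-)$ of $F_-$ is the $\rho$-limit of those of $F_-\mathbf 1_{[-k,-1]}$ (both limits exist and lie in $\mathbf H$, resp. $\mathbf H_0^*$), and the nonlinear Fourier series of $F$ is $(a_-,b_-)(a_+,b_+)$, which is also the $\rho$-limit of the nonlinear Fourier series of $F\mathbf 1_{[-k,k]}$. *)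

theory Defs
  imports "HOL-Analysis.Analysis"
begin

text \<open>Functions on the unit circle T are represented as complex \<Rightarrow> complex; only the
values at points cis t, t in [0, 2 pi], matter. Measure on T: Lebesgue measure in the
angle t on [0, 2 pi]. On T the star operation is pointwise conjugation.\<close>

definition onT_AE :: "(complex \<Rightarrow> bool) \<Rightarrow> bool" where
  "onT_AE P \<longleftrightarrow> (AE t in lebesgue. t \<in> {0..2*pi} \<longrightarrow> P (cis t))"

definition measT :: "(complex \<Rightarrow> complex) \<Rightarrow> bool" where
  "measT f \<longleftrightarrow> set_borel_measurable lebesgue {0..2*pi} (\<lambda>t. f (cis t))"

definition L2T :: "(complex \<Rightarrow> complex) \<Rightarrow> bool" where
  "L2T f \<longleftrightarrow> measT f \<and> set_integrable lebesgue {0..2*pi} (\<lambda>t. (cmod (f (cis t)))\<^sup>2)"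

definition normL2 :: "(complex \<Rightarrow> complex) \<Rightarrow> real" where
  "normL2 f = sqrt ((1 / (2*pi)) * (LINT t:{0..2*pi}|lebesgue. (cmod (f (cis t)))\<^sup>2))"

definition fcoeff :: "(complex \<Rightarrow> complex) \<Rightarrow> int \<Rightarrow> complex" where
  "fcoeff f n = (1 / (2 * of_real pi)) *
      (LINT t:{0..2*pi}|lebesgue. f (cis t) * cis (- (of_int n) * t))"

definition H2 :: "(complex \<Rightarrow> complex) \<Rightarrow> bool" where
  "H2 f \<longleftrightarrow> L2T f \<and> (\<forall>n<0. fcoeff f n = 0)"

definition H2ext :: "(complex \<Rightarrow> complex) \<Rightarrow> complex \<Rightarrow> complex" where
  "H2ext f z = (\<Sum>n. fcoeff f (int n) * z ^ n)"

definition starT :: "(complex \<Rightarrow> complex) \<Rightarrow> complex \<Rightarrow> complex" where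
  "starT f = (\<lambda>z. cnj (f z))"

definition H2s :: "(complex \<Rightarrow> complex) \<Rightarrow> bool" where
  "H2s f \<longleftrightarrow> H2 (starT f)"

definition H2s_ext :: "(complex \<Rightarrow> complex) \<Rightarrow> complex \<Rightarrow> complex" where
  "H2s_ext f z = cnj (H2ext (starT f) (1 / cnj z))"

definition at_inf :: "(complex \<Rightarrow> complex) \<Rightarrow> complex" where
  "at_inf f = cnj (H2ext (starT f) 0)"

definition pmul :: "(complex \<Rightarrow> complex) \<times> (complex \<Rightarrow> complex) \<Rightarrow>
    (complex \<Rightarrow> complex) \<times> (complex \<Rightarrow> complex) \<Rightarrow> (complex \<Rightarrow> complex) \<times> (complex \<Rightarrow> complex)" where
  "pmul p q = (case p of (a, b) \<Rightarrow> case q of (c, d) \<Rightarrow>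
      (\<lambda>z. a z * c z - b z * starT d z, \<lambda>z. a z * d z + b z * starT c z))"

definition ae_pair :: "(complex \<Rightarrow> complex) \<times> (complex \<Rightarrow> complex) \<Rightarrow>
    (complex \<Rightarrow> complex) \<times> (complex \<Rightarrow> complex) \<Rightarrow> bool" where
  "ae_pair p q \<longleftrightarrow> onT_AE (\<lambda>z. fst p z = fst q z \<and> snd p z = snd q z)"

definition inL :: "(complex \<Rightarrow> complex) \<times> (complex \<Rightarrow> complex) \<Rightarrow> bool" where
  "inL p \<longleftrightarrow> (case p of (a, b) \<Rightarrow>
      measT a \<and> measT b \<and>
      onT_AE (\<lambda>z. a z * starT a z + b z * starT b z = 1) \<and>
      H2s a \<and> at_inf a \<in> \<real> \<and> Re (at_inf a) > 0)"

definition rho :: "(complex \<Rightarrow> complex) \<times> (complex \<Rightarrow> complex) \<Rightarrow>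
    (complex \<Rightarrow> complex) \<times> (complex \<Rightarrow> complex) \<Rightarrow> real" where
  "rho p q = normL2 (\<lambda>z. fst p z - fst q z) + normL2 (\<lambda>z. snd p z - snd q z)
      + \<bar>ln (Re (at_inf (fst p))) - ln (Re (at_inf (fst q)))\<bar>"

definition inHbar :: "(complex \<Rightarrow> complex) \<times> (complex \<Rightarrow> complex) \<Rightarrow> bool" where
  "inHbar p \<longleftrightarrow> inL p \<and> H2 (snd p)"

definition bdry :: "(complex \<Rightarrow> complex) \<Rightarrow> complex \<Rightarrow> complex" where
  "bdry g \<zeta> = Lim (at_left 1) (\<lambda>r::real. g (of_real r * \<zeta>))"

definition inner :: "(complex \<Rightarrow> complex) \<Rightarrow> bool" where
  "inner g \<longleftrightarrow> g holomorphic_on ball 0 1 \<and> bounded (g ` ball 0 1) \<and>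
     onT_AE (\<lambda>\<zeta>. ((\<lambda>r::real. g (of_real r * \<zeta>)) \<longlongrightarrow> bdry g \<zeta>) (at_left 1)
                  \<and> cmod (bdry g \<zeta>) = 1)"

definition inH :: "(complex \<Rightarrow> complex) \<times> (complex \<Rightarrow> complex) \<Rightarrow> bool" where
  "inH p \<longleftrightarrow> inHbar p \<and>
     (\<forall>g. inner g \<and> H2 (\<lambda>z. starT (fst p) z / bdry g z) \<and> H2 (\<lambda>z. snd p z / bdry g z)
          \<longrightarrow> (\<exists>c. \<forall>z\<in>ball 0 1. g z = c))"

definition inH0s :: "(complex \<Rightarrow> complex) \<times> (complex \<Rightarrow> complex) \<Rightarrow> bool" where
  "inH0s p \<longleftrightarrow> inL p \<and> inH (fst p, starT (snd p)) \<and> H2ext (starT (snd p)) 0 = 0"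

definition inB :: "(complex \<Rightarrow> complex) \<times> (complex \<Rightarrow> complex) \<Rightarrow> bool" where
  "inB p \<longleftrightarrow> inL p \<and>
     Inf (insert ((cmod (at_inf (fst p)))\<^sup>2) ((\<lambda>z. (cmod (H2s_ext (fst p) z))\<^sup>2) ` {z. 1 < cmod z}))
       > 1/2"

text \<open>Nonlinear Fourier series of G restricted to [m, n]: first row of the ordered product
  (k increasing, left to right) of the matrices
  (1+|G k|^2)^(-1/2) [[1, G k z^k], [-conj(G k) z^(-k), 1]], as functions on T.\<close>
definition nlfs_step :: "(int \<Rightarrow> complex) \<Rightarrow> (complex \<Rightarrow> complex) \<times> (complex \<Rightarrow> complex) \<Rightarrow> int \<Rightarrow>
    (complex \<Rightarrow> complex) \<times> (complex \<Rightarrow> complex)" where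
  "nlfs_step G p k = (case p of (a, b) \<Rightarrow>
     (\<lambda>z. of_real (1 / sqrt (1 + (cmod (G k))\<^sup>2)) * (a z - b z * cnj (G k) * z powi (- k)),
      \<lambda>z. of_real (1 / sqrt (1 + (cmod (G k))\<^sup>2)) * (a z * G k * z powi k + b z)))"

definition nlfs_fin :: "(int \<Rightarrow> complex) \<Rightarrow> int \<Rightarrow> int \<Rightarrow> (complex \<Rightarrow> complex) \<times> (complex \<Rightarrow> complex)" where
  "nlfs_fin G m n = foldl (nlfs_step G) (\<lambda>_. 1, \<lambda>_. 0) [m..n]"

definition rho_lim :: "(nat \<Rightarrow> (complex \<Rightarrow> complex) \<times> (complex \<Rightarrow> complex)) \<Rightarrow>
    (complex \<Rightarrow> complex) \<times> (complex \<Rightarrow> complex) \<Rightarrow> bool" where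
  "rho_lim S p \<longleftrightarrow> inL p \<and> (\<lambda>k. rho (S k) p) \<longlonglongrightarrow> 0"

definition ell2 :: "(int \<Rightarrow> complex) \<Rightarrow> bool" where
  "ell2 F \<longleftrightarrow> (\<lambda>n. (cmod (F n))\<^sup>2) summable_on UNIV"

definition is_nlfs :: "(int \<Rightarrow> complex) \<Rightarrow> (complex \<Rightarrow> complex) \<times> (complex \<Rightarrow> complex) \<Rightarrow> bool" where
  "is_nlfs F p \<longleftrightarrow> (\<exists>pp pm.
      rho_lim (\<lambda>k. nlfs_fin F 0 (int k)) pp \<and>
      rho_lim (\<lambda>k. nlfs_fin F (- int k) (-1)) pm \<and>
      ae_pair (pmul pm pp) p)"

end

theory Submission
  imports Defs "HOL-Complex_Analysis.Complex_Analysis"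
begin

text \<open>
  Put \<open>A = a\<^sub>+\<^sup>*\<close>, \<open>B = b\<^sub>+\<close> and \<open>w = b / a\<close>. Since \<open>a\<^sup>*\<close> is invertible in \<open>H\<^sup>\<infinity>\<close>, the factorization
  \<open>(a\<^sub>-, b\<^sub>-)(a\<^sub>+, b\<^sub>+) = (a, b)\<close> is equivalent to \<open>P\<^sub>+(w A\<^sup>*) = B\<close>, \<open>A + P\<^sub>+(w B\<^sup>*) = const\<close>, and
  \<open>|w| \<le> q < 1\<close> makes this antilinear system uniquely solvable up to scale. The function
  \<open>|A|\<^sup>2 + |B|\<^sup>2\<close> of a solution is real and has no negative frequencies, so it is constant and can be
  normalised to 1. The identity \<open>a\<^sup>* = A a\<^sub>-\<^sup>* - b\<^sub>-\<^sup>* B\<close> is a Bezout identity with bounded \<open>H\<^sup>2\<close> coefficients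
  for both factors: it excludes common inner divisors, and it forces the remainders of layer stripping
  to tend to \<open>(1, 0)\<close>, so the stripped coefficients have the given factor as their nonlinear Fourier
  series. Uniqueness of the coefficients needs no inner-divisor condition, because the linear system
  already has unique normalised solutions in \<open>H\<^sup>2\<close>. The star of the second component is an
  anti-automorphism of the pair product and reduces the negative half-line to the positive one.
\<close>

section \<open>Normalised Lebesgue measure on the circle\<close>

text \<open>The threshold 1/2 is exactly what makes the symbol contractive: on the circle |b/a|^2 =
  1/|a|^2 - 1, which is below 1 iff |a|^2 > 1/2. The linear system arises by solving for the left
  factor: (a_-, b_-) is (a, b) times the inverse of (a_+, b_+), and division by a gives a_-/a = A +
  w B^* and b_-/a = w A^* - B. Both quotients have only nonpositive frequencies, and the second has
  no constant term, so projection leaves a constant and 0. Layer stripping by itself yields square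
  summable coefficients and remainders whose values at infinity increase to some l <= 1; the
  obstacle is to exclude l < 1, where the partial products would not converge to the given pair. The
  vanishing order of the remainders makes their second components tend to 0 whatever l is; only then
  does the Bezout identity give l = 1. Hardy space functions are handled through Fourier
  coefficients; the disc enters through L^2 convergence of dilates, which transfers the lower bound
  on a to the circle and puts 1/a^* in H^2.\<close>

text \<open>The \<open>\<sigma>\<close>-algebra of \<open>circ\<close> is the largest one for which \<open>cis\<close> is measurable; then the measurable
  functions are those whose pullback along \<open>cis\<close> is Lebesgue (not just Borel) measurable.\<close>

definition circ_events :: "complex set set" where
  "circ_events = {A. cis -` A \<inter> {0..2*pi} \<in> sets lebesgue}"

definition circ :: "complex measure" where
  "circ = distr (density (restrict_space lebesgue {0..2*pi}) (\<lambda>_. ennreal (1 / (2*pi))))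
                (sigma UNIV circ_events) cis"

lemma sigma_algebra_circ_events: "sigma_algebra UNIV circ_events"
proof (unfold sigma_algebra_iff2, intro conjI ballI allI impI)
  fix A assume "A \<in> circ_events"
  then have "{0..2*pi} - cis -` A \<inter> {0..2*pi} \<in> sets lebesgue"
    unfolding circ_events_def by (intro sets.Diff) auto
  also have "{0..2*pi} - cis -` A \<inter> {0..2*pi} = cis -` (UNIV - A) \<inter> {0..2*pi}" by auto
  finally show "UNIV - A \<in> circ_events" by (simp add: circ_events_def)
next
  fix A :: "nat \<Rightarrow> complex set" assume "range A \<subseteq> circ_events"
  then have "(\<Union>i. cis -` A i \<inter> {0..2*pi}) \<in> sets lebesgue"
    unfolding circ_events_def by (intro sets.countable_UN) auto
  also have "(\<Union>i. cis -` A i \<inter> {0..2*pi}) = cis -` (\<Union>i. A i) \<inter> {0..2*pi}" by auto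
  finally show "\<Union> (range A) \<in> circ_events" by (simp add: circ_events_def)
qed (auto simp: circ_events_def)

lemma space_circ [simp]: "space circ = UNIV"
  by (simp add: circ_def)

lemma sets_circ: "sets circ = circ_events"
  by (simp add: circ_def sigma_algebra.sets_measure_of_eq[OF sigma_algebra_circ_events])

lemma cis_measurable_circ_events:
  "cis \<in> measurable (density (restrict_space lebesgue {0..2*pi}) c) (sigma UNIV circ_events)"
proof (rule measurable_measure_of)
  show "circ_events \<subseteq> Pow UNIV" by simp
  show "\<And>A. A \<in> circ_events \<Longrightarrow> cis -` A \<inter> space (density (restrict_space lebesgue {0..2*pi}) c)
          \<in> sets (density (restrict_space lebesgue {0..2*pi}) c)"
    by (auto simp: circ_events_def sets_restrict_space_iff space_restrict_space)
qed auto

lemma borel_measurable_circ_iff: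
  fixes f :: "complex \<Rightarrow> 'b::real_normed_vector"
  shows "f \<in> borel_measurable circ \<longleftrightarrow> set_borel_measurable lebesgue {0..2*pi} (\<lambda>t. f (cis t))"
proof -
  have "f \<in> borel_measurable circ \<longleftrightarrow> (\<lambda>t. f (cis t)) \<in> borel_measurable (restrict_space lebesgue {0..2*pi})"
    by (auto simp: measurable_def sets_circ circ_events_def space_restrict_space sets_restrict_space_iff
          Pi_iff vimage_def Int_def conj_commute)
  also have "\<dots> \<longleftrightarrow> set_borel_measurable lebesgue {0..2*pi} (\<lambda>t. f (cis t))"
    unfolding set_borel_measurable_def by (subst borel_measurable_restrict_space_iff) auto
  finally show ?thesis .
qed

lemma measT_iff: "measT f \<longleftrightarrow> f \<in> borel_measurable circ"
  by (simp add: measT_def borel_measurable_circ_iff)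

lemma integrable_circ_iff:
  fixes f :: "complex \<Rightarrow> 'b::{banach, second_countable_topology}"
  assumes "f \<in> borel_measurable circ"
  shows "integrable circ f \<longleftrightarrow> set_integrable lebesgue {0..2*pi} (\<lambda>t. f (cis t))"
proof -
  have m: "f \<in> borel_measurable (sigma UNIV circ_events)"
    using assms by (simp add: circ_def)
  have m2: "(\<lambda>t. f (cis t)) \<in> borel_measurable (restrict_space lebesgue {0..2*pi})"
    using assms unfolding borel_measurable_circ_iff set_borel_measurable_def
    by (subst borel_measurable_restrict_space_iff) auto
  have "integrable circ f \<longleftrightarrow> integrable (restrict_space lebesgue {0..2*pi}) (\<lambda>t. (1 / (2*pi)) *\<^sub>R f (cis t))"
    unfolding circ_def
    by (subst integrable_distr_eq[OF cis_measurable_circ_events m], subst integrable_density) (use m2 in auto)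
  also have "\<dots> \<longleftrightarrow> integrable (restrict_space lebesgue {0..2*pi}) (\<lambda>t. f (cis t))"
  proof
    assume "integrable (restrict_space lebesgue {0..2*pi}) (\<lambda>t. (1 / (2*pi)) *\<^sub>R f (cis t))"
    then have "integrable (restrict_space lebesgue {0..2*pi}) (\<lambda>t. (2*pi) *\<^sub>R (1 / (2*pi)) *\<^sub>R f (cis t))"
      by (rule integrable_scaleR_right)
    then show "integrable (restrict_space lebesgue {0..2*pi}) (\<lambda>t. f (cis t))" by simp
  qed simp
  finally have "integrable circ f \<longleftrightarrow> integrable (restrict_space lebesgue {0..2*pi}) (\<lambda>t. f (cis t))" .
  then show ?thesis
    by (simp add: set_integrable_def integrable_restrict_space)
qed

lemma integral_circ:
  fixes f :: "complex \<Rightarrow> 'b::{banach, second_countable_topology}"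
  assumes "f \<in> borel_measurable circ"
  shows "integral\<^sup>L circ f = (1 / (2*pi)) *\<^sub>R (LINT t:{0..2*pi}|lebesgue. f (cis t))"
proof -
  have m: "f \<in> borel_measurable (sigma UNIV circ_events)"
    using assms by (simp add: circ_def)
  have m2: "(\<lambda>t. f (cis t)) \<in> borel_measurable (restrict_space lebesgue {0..2*pi})"
    using assms unfolding borel_measurable_circ_iff set_borel_measurable_def
    by (subst borel_measurable_restrict_space_iff) auto
  have "integral\<^sup>L circ f = integral\<^sup>L (restrict_space lebesgue {0..2*pi}) (\<lambda>t. (1 / (2*pi)) *\<^sub>R f (cis t))"
    unfolding circ_def
    by (subst integral_distr[OF cis_measurable_circ_events m], subst integral_density)
       (use m2 in auto)
  also have "\<dots> = (1 / (2*pi)) *\<^sub>R integral\<^sup>L (restrict_space lebesgue {0..2*pi}) (\<lambda>t. f (cis t))"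
    by simp
  finally show ?thesis
    by (simp add: set_lebesgue_integral_def integral_restrict_space)
qed

lemma AE_circ_iff: "(AE z in circ. P z) \<longleftrightarrow> (AE t in lebesgue. t \<in> {0..2*pi} \<longrightarrow> P (cis t))"
proof
  assume "AE z in circ. P z"
  then have "AE t in density (restrict_space lebesgue {0..2*pi}) (\<lambda>_. ennreal (1 / (2*pi))). P (cis t)"
    unfolding circ_def by (rule AE_distrD[OF cis_measurable_circ_events])
  then have "AE t in restrict_space lebesgue {0..2*pi}. P (cis t)"
    by (subst (asm) AE_density) auto
  then show "AE t in lebesgue. t \<in> {0..2*pi} \<longrightarrow> P (cis t)"
    by (subst (asm) AE_restrict_space_iff) auto
next
  assume *: "AE t in lebesgue. t \<in> {0..2*pi} \<longrightarrow> P (cis t)"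
  \<comment> \<open>The converse needs the exceptional set to be an event of \<open>circ\<close>.
    Its pullback lies in a null set, and completeness of \<open>lebesgue\<close> makes it
    measurable.\<close>
  have "{t. \<not> (t \<in> {0..2*pi} \<longrightarrow> P (cis t))} \<in> null_sets lebesgue"
    using * unfolding eventually_ae_filter by (auto intro: null_sets_completion_subset)
  then have s: "cis -` {z. \<not> P z} \<inter> {0..2*pi} \<in> null_sets lebesgue"
    by (rule back_subst[where P="\<lambda>A. A \<in> null_sets lebesgue"]) auto
  then have m: "{z \<in> space (sigma UNIV circ_events). P z} \<in> sets (sigma UNIV circ_events)"
  proof -
    have "{z. \<not> P z} \<in> sets circ" using s by (auto simp: sets_circ circ_events_def)
    then have "space circ - {z. \<not> P z} \<in> sets circ" by blast
    moreover have "space circ - {z. \<not> P z} = {z. P z}" by auto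
    ultimately show ?thesis by (simp add: circ_def)
  qed
  show "AE z in circ. P z"
    unfolding circ_def
    by (subst AE_distr_iff[OF cis_measurable_circ_events m], subst AE_density)
       (use * in \<open>auto simp: AE_restrict_space_iff\<close>)
qed

lemma onT_AE_iff: "onT_AE P \<longleftrightarrow> (AE z in circ. P z)"
  by (simp add: onT_AE_def AE_circ_iff)

lemma emeasure_circ: "emeasure circ UNIV = 1"
proof -
  have "emeasure circ UNIV = emeasure (density (restrict_space lebesgue {0..2*pi}) (\<lambda>_. ennreal (1 / (2*pi)))) {0..2*pi}"
    unfolding circ_def by (subst emeasure_distr[OF cis_measurable_circ_events]) (auto simp: space_restrict_space sigma_sets_top)
  also have "\<dots> = ennreal (1/(2*pi)) * emeasure lebesgue {0..2*pi}"
    by (subst emeasure_density_const) (auto simp: sets_restrict_space_iff emeasure_restrict_space)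
  also have "\<dots> = 1" by (simp add: ennreal_mult[symmetric])
  finally show ?thesis .
qed

interpretation circ: finite_measure circ
  by standard (simp add: emeasure_circ)

lemma measure_circ [simp]: "measure circ UNIV = 1"
  by (simp add: measure_def emeasure_circ)

lemma AE_circ_cmod: "AE z in circ. cmod z = 1"
  by (simp add: AE_circ_iff)

lemma borel_measurable_circ_continuous:
  fixes f :: "complex \<Rightarrow> 'b::euclidean_space"
  assumes "continuous_on (sphere 0 1) f"
  shows "f \<in> borel_measurable circ"
proof -
  have "continuous_on {0..2*pi} (\<lambda>t. f (cis t))"
    by (intro continuous_on_compose2[OF assms] continuous_intros) auto
  then have "set_borel_measurable borel {0..2*pi} (\<lambda>t. f (cis t))"
    by (rule borel_measurable_continuous_on_indicator[rotated, folded set_borel_measurable_def]) auto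
  then show ?thesis
    unfolding borel_measurable_circ_iff set_borel_measurable_def
    by (simp add: measurable_completion)
qed

section \<open>Square integrable functions\<close>

definition sq_integrable :: "'a measure \<Rightarrow> ('a \<Rightarrow> complex) \<Rightarrow> bool" where
  "sq_integrable M f \<longleftrightarrow> f \<in> borel_measurable M \<and> integrable M (\<lambda>x. (cmod (f x))\<^sup>2)"

text \<open>A seminorm on functions rather than on classes. The Bochner integral is 0 when the
  square is not integrable, hence the hypotheses \<open>sq_integrable\<close> throughout.\<close>

definition l2norm :: "'a measure \<Rightarrow> ('a \<Rightarrow> complex) \<Rightarrow> real" where
  "l2norm M f = sqrt (\<integral>x. (cmod (f x))\<^sup>2 \<partial>M)"

lemma sq_integrable_measurable [measurable_dest]:
  "sq_integrable M f \<Longrightarrow> f \<in> borel_measurable M"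
  by (simp add: sq_integrable_def)

lemma l2norm_nonneg [simp]: "0 \<le> l2norm M f"
  by (simp add: l2norm_def)

lemma l2norm_power2: "(l2norm M f)\<^sup>2 = (\<integral>x. (cmod (f x))\<^sup>2 \<partial>M)"
  by (simp add: l2norm_def)

lemma sq_integrable_cmult:
  assumes "sq_integrable M f" shows "sq_integrable M (\<lambda>x. c * f x)"
  using assms by (auto simp: sq_integrable_def norm_mult power_mult_distrib)

lemma sq_integrable_cnj:
  assumes "sq_integrable M f" shows "sq_integrable M (\<lambda>x. cnj (f x))"
  using assms unfolding sq_integrable_def
  by (auto intro: borel_measurable_continuous_on[OF continuous_on_cnj[OF continuous_on_id]])

lemma sq_integrable_mult:
  assumes "sq_integrable M f" "sq_integrable M g" shows "integrable M (\<lambda>x. f x * g x)"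
proof (rule Bochner_Integration.integrable_bound)
  show "integrable M (\<lambda>x. (cmod (f x))\<^sup>2 + (cmod (g x))\<^sup>2)"
    using assms by (auto simp: sq_integrable_def)
  show "(\<lambda>x. f x * g x) \<in> borel_measurable M" using assms by measurable
  have "cmod (f x * g x) \<le> norm ((cmod (f x))\<^sup>2 + (cmod (g x))\<^sup>2)" for x
  proof -
    have "0 \<le> cmod (f x) * cmod (g x)" by simp
    then have "cmod (f x) * cmod (g x) \<le> (cmod (f x))\<^sup>2 + (cmod (g x))\<^sup>2"
      using sum_squares_bound[of "cmod (f x)" "cmod (g x)"] by linarith
    then show ?thesis by (simp add: norm_mult)
  qed
  then show "AE x in M. cmod (f x * g x) \<le> norm ((cmod (f x))\<^sup>2 + (cmod (g x))\<^sup>2)" by simp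
qed

lemma sq_integrable_add:
  assumes "sq_integrable M f" "sq_integrable M g" shows "sq_integrable M (\<lambda>x. f x + g x)"
proof -
  have [measurable]: "f \<in> borel_measurable M" "g \<in> borel_measurable M" using assms by measurable
  have "integrable M (\<lambda>x. (cmod (f x + g x))\<^sup>2)"
  proof (rule Bochner_Integration.integrable_bound)
  show "integrable M (\<lambda>x. 2 * (cmod (f x))\<^sup>2 + 2 * (cmod (g x))\<^sup>2)"
      using assms by (auto simp: sq_integrable_def)
    have "(cmod (f x + g x))\<^sup>2 \<le> 2 * (cmod (f x))\<^sup>2 + 2 * (cmod (g x))\<^sup>2" for x
    proof -
      have "(cmod (f x + g x))\<^sup>2 \<le> (cmod (f x) + cmod (g x))\<^sup>2"
        by (simp add: norm_triangle_ineq power_mono)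
      also have "\<dots> \<le> 2 * (cmod (f x))\<^sup>2 + 2 * (cmod (g x))\<^sup>2"
        using sum_squares_bound[of "cmod (f x)" "cmod (g x)"] by (simp add: power2_sum)
      finally show ?thesis .
    qed
    then show "AE x in M. norm ((cmod (f x + g x))\<^sup>2) \<le> norm (2 * (cmod (f x))\<^sup>2 + 2 * (cmod (g x))\<^sup>2)" by simp
  qed measurable
  then show ?thesis by (simp add: sq_integrable_def)
qed

lemma sq_integrable_diff:
  assumes "sq_integrable M f" "sq_integrable M g" shows "sq_integrable M (\<lambda>x. f x - g x)"
  using sq_integrable_add[OF assms(1) sq_integrable_cmult[OF assms(2), of "-1"]] by simp

lemma sq_integrable_sum:
  assumes "\<And>i. i \<in> I \<Longrightarrow> sq_integrable M (f i)" shows "sq_integrable M (\<lambda>x. \<Sum>i\<in>I. f i x)"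
  using assms
proof (induction I rule: infinite_finite_induct)
  case (insert i I) then show ?case by (simp add: sq_integrable_add)
qed (simp_all add: sq_integrable_def)

lemma sq_integrable_bounded_mult:
  assumes "sq_integrable M f" and [measurable]: "g \<in> borel_measurable M" and "AE x in M. cmod (g x) \<le> C"
  shows "sq_integrable M (\<lambda>x. g x * f x)"
proof -
  have [measurable]: "f \<in> borel_measurable M" using assms(1) by measurable
  have "integrable M (\<lambda>x. (cmod (g x * f x))\<^sup>2)"
  proof (rule Bochner_Integration.integrable_bound)
  show "integrable M (\<lambda>x. C\<^sup>2 * (cmod (f x))\<^sup>2)"
      using assms by (auto simp: sq_integrable_def)
    show "AE x in M. norm ((cmod (g x * f x))\<^sup>2) \<le> norm (C\<^sup>2 * (cmod (f x))\<^sup>2)"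
      using assms(3)
      by eventually_elim (simp add: norm_mult power_mult_distrib mult_right_mono power_mono)
  qed measurable
  then show ?thesis by (simp add: sq_integrable_def)
qed

lemma (in finite_measure) sq_integrable_bounded:
  assumes [measurable]: "g \<in> borel_measurable M" and "AE x in M. cmod (g x) \<le> C"
  shows "sq_integrable M g"
  using sq_integrable_bounded_mult[OF _ assms, of "\<lambda>_. 1"] by (simp add: sq_integrable_def)

lemma l2norm_cong_AE:
  assumes [measurable]: "f \<in> borel_measurable M" "g \<in> borel_measurable M" and "AE x in M. f x = g x"
  shows "l2norm M f = l2norm M g"
  unfolding l2norm_def using assms(3) by (auto intro!: integral_cong_AE)

lemma l2norm_cmult: "l2norm M (\<lambda>x. c * f x) = cmod c * l2norm M f"
  by (simp add: l2norm_def norm_mult power_mult_distrib real_sqrt_mult)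

lemma l2norm_cnj: "l2norm M (\<lambda>x. cnj (f x)) = l2norm M f"
  by (simp add: l2norm_def)

lemma l2norm_minus_commute: "l2norm M (\<lambda>x. f x - g x) = l2norm M (\<lambda>x. g x - f x)"
  by (simp add: l2norm_def norm_minus_commute)

lemma l2norm_eq_0_AE:
  assumes "sq_integrable M f" "l2norm M f = 0" shows "AE x in M. f x = 0"
proof -
  have "(\<integral>x. (cmod (f x))\<^sup>2 \<partial>M) = 0" using assms(2) by (simp add: l2norm_def)
  then have "AE x in M. (cmod (f x))\<^sup>2 = 0"
    using assms(1) by (subst (asm) integral_nonneg_eq_0_iff_AE) (auto simp: sq_integrable_def)
  then show ?thesis by simp
qed

lemma l2norm_mult_bound:
  assumes "sq_integrable M f" and [measurable]: "g \<in> borel_measurable M"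
    and "AE x in M. cmod (g x) \<le> C" "0 \<le> C"
  shows "l2norm M (\<lambda>x. g x * f x) \<le> C * l2norm M f"
proof -
  have "(\<integral>x. (cmod (g x * f x))\<^sup>2 \<partial>M) \<le> (\<integral>x. C\<^sup>2 * (cmod (f x))\<^sup>2 \<partial>M)"
  proof (rule integral_mono_AE)
    show "AE x in M. (cmod (g x * f x))\<^sup>2 \<le> C\<^sup>2 * (cmod (f x))\<^sup>2"
      using assms(3)
      by eventually_elim (simp add: norm_mult power_mult_distrib mult_right_mono power_mono)
    show "integrable M (\<lambda>x. (cmod (g x * f x))\<^sup>2)"
      using sq_integrable_bounded_mult[OF assms(1-3)] by (simp add: sq_integrable_def)
  qed (use assms in \<open>auto simp: sq_integrable_def\<close>)
  then have "l2norm M (\<lambda>x. g x * f x) \<le> sqrt (C\<^sup>2 * (\<integral>x. (cmod (f x))\<^sup>2 \<partial>M))"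
    unfolding l2norm_def by simp
  then show ?thesis using assms(4) by (simp add: l2norm_def real_sqrt_mult)
qed

lemma l2norm_mono_AE:
  assumes "sq_integrable M f" and [measurable]: "g \<in> borel_measurable M"
    and "AE x in M. cmod (g x) \<le> cmod (f x)"
  shows "l2norm M g \<le> l2norm M f"
proof -
  have [measurable]: "f \<in> borel_measurable M" using assms(1) by measurable
  have "AE x in M. norm ((cmod (g x))\<^sup>2) \<le> norm ((cmod (f x))\<^sup>2)"
    using assms(3) by eventually_elim (simp add: power_mono)
  then have "integrable M (\<lambda>x. (cmod (g x))\<^sup>2)"
    using assms by (intro Bochner_Integration.integrable_bound[of M "\<lambda>x. (cmod (f x))\<^sup>2" "\<lambda>x. (cmod (g x))\<^sup>2"])
      (auto simp: sq_integrable_def)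
  moreover have "AE x in M. (cmod (g x))\<^sup>2 \<le> (cmod (f x))\<^sup>2"
    using assms(3) by eventually_elim (simp add: power_mono)
  ultimately show ?thesis
    unfolding l2norm_def using assms
    by (intro real_sqrt_le_mono integral_mono_AE) (auto simp: sq_integrable_def)
qed

lemma integral_cmod_mult_le:
  assumes "sq_integrable M f" "sq_integrable M g"
  shows "(\<integral>x. cmod (f x * g x) \<partial>M) \<le> l2norm M f * l2norm M g"
proof -
  have [measurable]: "f \<in> borel_measurable M" "g \<in> borel_measurable M" using assms by measurable
  let ?F = "\<integral>x. (cmod (f x))\<^sup>2 \<partial>M" and ?G = "\<integral>x. (cmod (g x))\<^sup>2 \<partial>M"
  let ?I = "\<integral>x. cmod (f x * g x) \<partial>M"
  have 1: "(\<integral>\<^sup>+x. ennreal (cmod (f x)) * ennreal (cmod (g x)) \<partial>M) = ennreal ?I"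
    using integrable_norm[OF sq_integrable_mult[OF assms]]
    by (subst nn_integral_eq_integral[symmetric]) (auto simp: norm_mult ennreal_mult)
  have 2: "(\<integral>\<^sup>+x. (ennreal (cmod (f x)))\<^sup>2 \<partial>M) = ennreal ?F" "(\<integral>\<^sup>+x. (ennreal (cmod (g x)))\<^sup>2 \<partial>M) = ennreal ?G"
    using assms by (auto simp: sq_integrable_def ennreal_power nn_integral_eq_integral)
  have "(ennreal ?I)\<^sup>2 \<le> ennreal ?F * ennreal ?G"
    using Cauchy_Schwarz_nn_integral[of "\<lambda>x. ennreal (cmod (f x))" M "\<lambda>x. ennreal (cmod (g x))"]
    unfolding 1 2 by simp
  then have "?I\<^sup>2 \<le> ?F * ?G"
    by (simp add: ennreal_power ennreal_mult[symmetric])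
  then have "?I \<le> sqrt (?F * ?G)" by (rule real_le_rsqrt)
  then show ?thesis by (simp add: l2norm_def real_sqrt_mult)
qed

lemma cmod_integral_mult_le:
  assumes "sq_integrable M f" "sq_integrable M g"
  shows "cmod (\<integral>x. f x * g x \<partial>M) \<le> l2norm M f * l2norm M g"
  by (rule order_trans[OF integral_norm_bound integral_cmod_mult_le[OF assms]])

lemma l2norm_triangle:
  assumes "sq_integrable M f" "sq_integrable M g"
  shows "l2norm M (\<lambda>x. f x + g x) \<le> l2norm M f + l2norm M g"
proof (rule power2_le_imp_le)
  have [measurable]: "f \<in> borel_measurable M" "g \<in> borel_measurable M" using assms by measurable
  have i: "integrable M (\<lambda>x. (cmod (f x))\<^sup>2)" "integrable M (\<lambda>x. (cmod (g x))\<^sup>2)"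
    using assms by (auto simp: sq_integrable_def)
  have j: "integrable M (\<lambda>x. cmod (f x * g x))" by (intro integrable_norm sq_integrable_mult assms)
  have "(l2norm M (\<lambda>x. f x + g x))\<^sup>2 \<le> (\<integral>x. (cmod (f x))\<^sup>2 + (cmod (g x))\<^sup>2 + 2 * cmod (f x * g x) \<partial>M)"
    unfolding l2norm_power2
  proof (rule integral_mono_AE)
    have "(cmod (f x + g x))\<^sup>2 \<le> (cmod (f x))\<^sup>2 + (cmod (g x))\<^sup>2 + 2 * cmod (f x * g x)" for x
    proof -
      have "(cmod (f x + g x))\<^sup>2 \<le> (cmod (f x) + cmod (g x))\<^sup>2"
        by (simp add: norm_triangle_ineq power_mono)
      then show ?thesis by (simp add: power2_sum norm_mult)
    qed
    then show "AE x in M. (cmod (f x + g x))\<^sup>2 \<le> (cmod (f x))\<^sup>2 + (cmod (g x))\<^sup>2 + 2 * cmod (f x * g x)" by simp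
    show "integrable M (\<lambda>x. (cmod (f x + g x))\<^sup>2)"
      using sq_integrable_add[OF assms] by (simp add: sq_integrable_def)
  qed (use i j in auto)
  also have "\<dots> = (l2norm M f)\<^sup>2 + (l2norm M g)\<^sup>2 + 2 * (\<integral>x. cmod (f x * g x) \<partial>M)"
    using i j by (simp add: l2norm_power2)
  also have "\<dots> \<le> (l2norm M f + l2norm M g)\<^sup>2"
    using integral_cmod_mult_le[OF assms] by (simp add: power2_sum)
  finally show "(l2norm M (\<lambda>x. f x + g x))\<^sup>2 \<le> (l2norm M f + l2norm M g)\<^sup>2" .
qed simp

lemma l2norm_triangle_mid:
  assumes "sq_integrable M f" "sq_integrable M g" "sq_integrable M h"
  shows "l2norm M (\<lambda>x. f x - h x) \<le> l2norm M (\<lambda>x. f x - g x) + l2norm M (\<lambda>x. g x - h x)"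
  using l2norm_triangle[OF sq_integrable_diff[OF assms(1,2)] sq_integrable_diff[OF assms(2,3)]] by simp

text \<open>Nonnegative integrals exist without integrability, so a bound obtained from Fatou's
  lemma can be turned into membership and a norm estimate at once.\<close>

lemma sq_integrable_nn_bound:
  assumes [measurable]: "f \<in> borel_measurable M"
    and "(\<integral>\<^sup>+x. ennreal ((cmod (f x))\<^sup>2) \<partial>M) \<le> ennreal (C\<^sup>2)" "0 \<le> C"
  shows "sq_integrable M f \<and> l2norm M f \<le> C"
proof -
  have i: "integrable M (\<lambda>x. (cmod (f x))\<^sup>2)"
    using assms(2) by (intro integrableI_nonneg) (auto simp: le_less_trans[OF _ ennreal_less_top])
  then have "ennreal (\<integral>x. (cmod (f x))\<^sup>2 \<partial>M) \<le> ennreal (C\<^sup>2)"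
    using assms(2) by (subst nn_integral_eq_integral[symmetric]) auto
  then have "(\<integral>x. (cmod (f x))\<^sup>2 \<partial>M) \<le> C\<^sup>2" by simp
  then have "l2norm M f \<le> sqrt (C\<^sup>2)" unfolding l2norm_def by (rule real_sqrt_le_mono)
  then show ?thesis using i assms(3) by (simp add: sq_integrable_def)
qed

lemma (in finite_measure) sq_integrable_imp_integrable:
  assumes "sq_integrable M f" shows "integrable M f"
proof -
  have "sq_integrable M (\<lambda>_. 1)" by (simp add: sq_integrable_def)
  from sq_integrable_mult[OF assms this] show ?thesis by simp
qed

text \<open>A subsequence with increments below \<open>(1/2)^k\<close> converges almost everywhere:
  on a finite measure space Cauchy-Schwarz against 1 bounds the L^1 norms of the increments by a
  summable series. Fatou's lemma along the subsequence then controls the distance of every late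
  \<open>f n\<close> from the limit.\<close>

theorem (in finite_measure) l2_complete:
  assumes f: "\<And>n. sq_integrable M (f n)"
    and cauchy: "\<And>e. e > 0 \<Longrightarrow> \<exists>N. \<forall>m\<ge>N. \<forall>n\<ge>N. l2norm M (\<lambda>x. f m x - f n x) < e"
  obtains g where "sq_integrable M g" "(\<lambda>n. l2norm M (\<lambda>x. f n x - g x)) \<longlonglongrightarrow> 0"
proof -
  have [measurable]: "f n \<in> borel_measurable M" for n using f[of n] by measurable
  obtain N where N: "\<And>k m n. m \<ge> N k \<Longrightarrow> n \<ge> N k \<Longrightarrow> l2norm M (\<lambda>x. f m x - f n x) < (1/2)^k"
  proof -
    have "\<forall>k. \<exists>N. \<forall>m\<ge>N. \<forall>n\<ge>N. l2norm M (\<lambda>x. f m x - f n x) < (1/2)^k"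
      by (intro allI cauchy) simp
    then show ?thesis using that by (auto dest!: choice)
  qed
  \<comment> \<open>Summing the \<open>N j\<close> gives an index beyond \<open>N 0\<close>, ...,
    \<open>N k\<close> without first making \<open>N\<close> monotone.\<close>
  define r where "r k = (\<Sum>j\<le>k. N j)" for k :: nat
  have r_ge: "N j \<le> r k" if "j \<le> k" for j k
    unfolding r_def using that by (intro member_le_sum) auto
  define d where "d k x = cmod (f (r (Suc k)) x - f (r k) x)" for k x
  have [measurable]: "d k \<in> borel_measurable M" for k unfolding d_def by measurable
  have d_int: "(\<integral>\<^sup>+x. ennreal (d k x) \<partial>M) \<le> ennreal ((1/2)^k * sqrt (measure M (space M)))" for k
  proof -
    have s: "sq_integrable M (\<lambda>x. f (r (Suc k)) x - f (r k) x)" by (intro sq_integrable_diff f)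
    have o: "sq_integrable M (\<lambda>_. 1)" by (simp add: sq_integrable_def)
    have "(\<integral>\<^sup>+x. ennreal (d k x) \<partial>M) = ennreal (\<integral>x. d k x \<partial>M)"
      unfolding d_def
      by (intro nn_integral_eq_integral integrable_norm sq_integrable_imp_integrable s) auto
    also have "(\<integral>x. d k x \<partial>M) \<le> l2norm M (\<lambda>x. f (r (Suc k)) x - f (r k) x) * l2norm M (\<lambda>_. 1)"
      using integral_cmod_mult_le[OF s o] by (simp add: d_def)
    also have "\<dots> \<le> (1/2)^k * sqrt (measure M (space M))"
      using N[of k "r (Suc k)" "r k"] r_ge[of k k] r_ge[of k "Suc k"]
      by (auto simp: l2norm_def[of M "\<lambda>_. 1"] intro!: mult_right_mono)
    finally show ?thesis by (simp add: ennreal_leI)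
  qed
  have "(\<integral>\<^sup>+x. (\<Sum>k. ennreal (d k x)) \<partial>M) = (\<Sum>k. \<integral>\<^sup>+x. ennreal (d k x) \<partial>M)"
    by (rule nn_integral_suminf) measurable
  also have "\<dots> \<le> (\<Sum>k. ennreal ((1/2)^k * sqrt (measure M (space M))))"
    by (intro suminf_le d_int) auto
  also have "\<dots> < top"
    by (subst suminf_ennreal2) (auto intro!: summable_mult2 summable_geometric)
  finally have "AE x in M. (\<Sum>k. ennreal (d k x)) \<noteq> \<infinity>"
    by (intro nn_integral_PInf_AE) auto
  then have conv: "AE x in M. (\<lambda>k. f (r k) x) \<longlonglongrightarrow> lim (\<lambda>k. f (r k) x)"
  proof eventually_elim
    case (elim x)
    then have "summable (\<lambda>k. d k x)"
      by (intro summable_suminf_not_top) (auto simp: d_def)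
    then have "summable (\<lambda>k. f (r (Suc k)) x - f (r k) x)"
      unfolding d_def by (rule summable_norm_cancel)
    then have "convergent (\<lambda>k. \<Sum>i<k. f (r (Suc i)) x - f (r i) x)"
      by (simp add: summable_iff_convergent)
    then have "convergent (\<lambda>k. f (r k) x - f (r 0) x)"
      by (simp only: sum_lessThan_telescope[of "\<lambda>k. f (r k) x"])
    then have "convergent (\<lambda>k. (f (r k) x - f (r 0) x) + f (r 0) x)"
      by (intro convergent_add convergent_const)
    then show ?case by (simp add: convergent_LIMSEQ_iff)
  qed
  \<comment> \<open>\<open>lim\<close> is total, so \<open>g\<close> is defined, and measurable,
    also where the subsequence diverges.\<close>
  define g where "g x = lim (\<lambda>k. f (r k) x)" for x
  have [measurable]: "g \<in> borel_measurable M" unfolding g_def by measurable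
  have bound: "sq_integrable M (\<lambda>x. f n x - g x) \<and> l2norm M (\<lambda>x. f n x - g x) \<le> (1/2)^j" if n: "n \<ge> N j" for n j
  proof (rule sq_integrable_nn_bound)
    have "AE x in M. ennreal ((cmod (f n x - g x))\<^sup>2) = liminf (\<lambda>k. ennreal ((cmod (f n x - f (r k) x))\<^sup>2))"
      using conv
    proof eventually_elim
      case (elim x)
      then have "(\<lambda>k. ennreal ((cmod (f n x - f (r k) x))\<^sup>2)) \<longlonglongrightarrow> ennreal ((cmod (f n x - g x))\<^sup>2)"
        unfolding g_def by (intro tendsto_ennrealI tendsto_intros)
      from lim_imp_Liminf[OF _ this] show ?case by simp
    qed
    then have "(\<integral>\<^sup>+x. ennreal ((cmod (f n x - g x))\<^sup>2) \<partial>M) = (\<integral>\<^sup>+x. liminf (\<lambda>k. ennreal ((cmod (f n x - f (r k) x))\<^sup>2)) \<partial>M)"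
      by (rule nn_integral_cong_AE)
    also have "\<dots> \<le> liminf (\<lambda>k. \<integral>\<^sup>+x. ennreal ((cmod (f n x - f (r k) x))\<^sup>2) \<partial>M)"
      by (rule nn_integral_liminf) measurable
    also have "\<dots> \<le> ennreal (((1/2)^j)\<^sup>2)"
    proof (rule Liminf_le)
      show "\<forall>\<^sub>F k in sequentially. (\<integral>\<^sup>+x. ennreal ((cmod (f n x - f (r k) x))\<^sup>2) \<partial>M) \<le> ennreal (((1/2)^j)\<^sup>2)"
        using eventually_ge_at_top[of j]
      proof eventually_elim
        case (elim k)
        have "sq_integrable M (\<lambda>x. f n x - f (r k) x)" by (intro sq_integrable_diff f)
        then have "(\<integral>\<^sup>+x. ennreal ((cmod (f n x - f (r k) x))\<^sup>2) \<partial>M) = ennreal ((l2norm M (\<lambda>x. f n x - f (r k) x))\<^sup>2)"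
          unfolding l2norm_power2 by (intro nn_integral_eq_integral) (auto simp: sq_integrable_def)
        also have "\<dots> \<le> ennreal (((1/2)^j)\<^sup>2)"
          using N[OF n r_ge[OF elim]] by (intro ennreal_leI power_mono) auto
        finally show ?case .
      qed
    qed simp
    finally show "(\<integral>\<^sup>+x. ennreal ((cmod (f n x - g x))\<^sup>2) \<partial>M) \<le> ennreal (((1/2)^j)\<^sup>2)" .
  qed auto
  show ?thesis
  proof
    have "sq_integrable M (\<lambda>x. f (N 0) x - g x)" using bound[of 0 "N 0"] by blast
    from sq_integrable_diff[OF f[of "N 0"] this] show "sq_integrable M g" by simp
    show "(\<lambda>n. l2norm M (\<lambda>x. f n x - g x)) \<longlonglongrightarrow> 0"
    proof (rule LIMSEQ_I)
      fix e :: real assume "e > 0"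
      then obtain j where j: "(1/2)^j < e" using real_arch_pow_inv[of e "1/2"] by auto
      show "\<exists>no. \<forall>n\<ge>no. norm (l2norm M (\<lambda>x. f n x - g x) - 0) < e"
        using bound[of j] j by (intro exI[of _ "N j"]) (auto intro: le_less_trans)
    qed
  qed
qed

section \<open>Uniqueness of Fourier coefficients\<close>

lemma L2T_iff: "L2T f \<longleftrightarrow> sq_integrable circ f"
proof (cases "f \<in> borel_measurable circ")
  case True
  then have "(\<lambda>z. (cmod (f z))\<^sup>2) \<in> borel_measurable circ" by measurable
  then show ?thesis
    using True by (simp add: L2T_def sq_integrable_def measT_iff integrable_circ_iff)
qed (simp add: L2T_def sq_integrable_def measT_iff)

lemma normL2_eq:
  assumes [measurable]: "f \<in> borel_measurable circ" shows "normL2 f = l2norm circ f"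
  unfolding normL2_def l2norm_def by (subst integral_circ) auto

lemma borel_sets_circ:
  assumes "A \<in> sets borel" shows "A \<in> sets circ"
proof -
  have "(\<lambda>z. z) \<in> borel_measurable circ" by (rule borel_measurable_circ_continuous) (rule continuous_on_id)
  from measurable_sets[OF this assms] show ?thesis by simp
qed

section \<open>Monomials on the circle and rules for Fourier coefficients\<close>

lemma AE_circ_nonzero: "AE z in circ. z \<noteq> 0"
  using AE_circ_cmod by eventually_elim auto

lemma powi_measurable_circ [measurable]: "(\<lambda>z. z powi n) \<in> borel_measurable circ"
  by (intro borel_measurable_circ_continuous continuous_intros) auto

lemma cmod_powi_circ: "cmod z = 1 \<Longrightarrow> cmod (z powi n) = 1"
  by (simp add: norm_power_int)

lemma cnj_powi_circ:
  assumes "cmod z = 1" shows "cnj (z powi n) = z powi (-n)"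
proof -
  have "z powi n * cnj (z powi n) = 1"
    using assms by (simp add: complex_norm_square[symmetric] cmod_powi_circ del: complex_cnj_power_int)
  moreover have "z powi n * z powi (-n) = 1"
    using assms by (subst power_int_add[symmetric]) auto
  ultimately show ?thesis
    by (metis mult_left_cancel mult_zero_left zero_neq_one)
qed

lemma powi_minus_one_circ: "cmod z = 1 \<Longrightarrow> z powi (-1) = cnj z"
  using cnj_powi_circ[of z 1] by simp

lemma fcoeff_eq:
  assumes [measurable]: "f \<in> borel_measurable circ"
  shows "fcoeff f n = (\<integral>z. f z * z powi (-n) \<partial>circ)"
proof -
  have c: "cis t powi (-n) = cis (- of_int n * t)" for t
  proof -
    have "cis t powi (-n) = cis (of_int (-n) * t)" by (rule cis_power_int)
    then show ?thesis by simp
  qed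
  show ?thesis unfolding fcoeff_def
    by (subst integral_circ) (auto simp: c scaleR_conv_of_real)
qed

lemma integrable_circ_mult_powi:
  assumes "integrable circ f" shows "integrable circ (\<lambda>z. f z * z powi k)"
proof (rule Bochner_Integration.integrable_bound)
  show "AE z in circ. norm (f z * z powi k) \<le> norm (f z)"
    using AE_circ_cmod by eventually_elim (simp add: norm_mult norm_power_int)
qed (use assms in measurable)

lemma sq_integrable_mult_powi:
  assumes "sq_integrable circ f" shows "sq_integrable circ (\<lambda>z. z powi k * f z)"
proof (rule sq_integrable_bounded_mult[OF assms, where C=1])
  show "AE z in circ. cmod (z powi k) \<le> 1"
    using AE_circ_cmod by eventually_elim (simp add: norm_power_int)
qed measurable

lemma sq_integrable_powi: "sq_integrable circ (\<lambda>z. z powi k)"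
  using sq_integrable_mult_powi[of "\<lambda>_. 1" k] by (simp add: sq_integrable_def)

lemma l2norm_powi: "l2norm circ (\<lambda>z. z powi k) = 1"
proof -
  have "(\<integral>z. (cmod (z powi k))\<^sup>2 \<partial>circ) = (\<integral>z. 1 \<partial>circ)"
  proof (rule integral_cong_AE)
    show "AE z in circ. (cmod (z powi k))\<^sup>2 = 1"
      using AE_circ_cmod by eventually_elim (simp add: norm_power_int)
  qed measurable
  then show ?thesis by (simp add: l2norm_def)
qed

lemma integral_powi_circ: "(\<integral>z. z powi n \<partial>circ) = (if n = 0 then 1 else 0)"
proof (cases "n = 0")
  case False
  define F where "F t = cis (of_int n * t) / (\<i> * of_int n)" for t
  have "((\<lambda>t. cis t powi n) has_integral F (2*pi) - F 0) {0..2*pi}"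
  proof (rule fundamental_theorem_of_calculus)
    fix t :: real
    have "((\<lambda>t. exp (\<i> * of_int n * of_real t) / (\<i> * of_int n)) has_vector_derivative
            exp (\<i> * of_int n * of_real t)) (at t within {0..2*pi})"
      using False by (auto intro!: derivative_eq_intros has_vector_derivative_real_field simp: field_simps)
    moreover have "exp (\<i> * of_int n * of_real t) = cis (of_int n * t)" for t :: real
      by (simp add: cis_conv_exp mult_ac)
    ultimately show "(F has_vector_derivative cis t powi n) (at t within {0..2*pi})"
      by (simp add: F_def[abs_def] cis_power_int)
  qed simp
  moreover have "F (2*pi) = F 0"
  proof -
    have "cis (of_int n * (2*pi)) = cis (2*pi) powi n" by (simp only: cis_power_int)
    then show ?thesis by (simp add: F_def)
  qed
  ultimately have h: "((\<lambda>t. cis t powi n) has_integral 0) {0..2*pi}" by simp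
  have c: "continuous_on {0..2*pi} (\<lambda>t. cis t powi n)" by (intro continuous_intros) auto
  then have "set_integrable lborel {0..2*pi} (\<lambda>t. cis t powi n)"
    unfolding set_integrable_def by (rule borel_integrable_compact[rotated]) auto
  then have "(LINT t:{0..2*pi}|lborel. cis t powi n) = 0"
    using h by (simp add: set_borel_integral_eq_integral(2) integral_unique)
  moreover have "(\<lambda>t. indicator {0..2*pi} t *\<^sub>R cis t powi n) \<in> borel_measurable lborel"
    using borel_measurable_continuous_on_indicator[OF _ c] by simp
  ultimately have "(LINT t:{0..2*pi}|lebesgue. cis t powi n) = 0"
    by (simp add: set_lebesgue_integral_def integral_completion)
  then show ?thesis using False by (simp add: integral_circ)
qed simp

lemma fcoeff_cong_AE:
  assumes [measurable]: "f \<in> borel_measurable circ" "g \<in> borel_measurable circ" and "AE z in circ. f z = g z"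
  shows "fcoeff f n = fcoeff g n"
  unfolding fcoeff_eq[OF assms(1)] fcoeff_eq[OF assms(2)]
  by (rule integral_cong_AE) (use assms(3) in auto)

lemma fcoeff_add:
  assumes "integrable circ f" "integrable circ g"
  shows "fcoeff (\<lambda>z. f z + g z) n = fcoeff f n + fcoeff g n"
  using integrable_circ_mult_powi[OF assms(1), of "-n"] integrable_circ_mult_powi[OF assms(2), of "-n"] assms
  by (simp add: fcoeff_eq distrib_right)

lemma fcoeff_diff:
  assumes "integrable circ f" "integrable circ g"
  shows "fcoeff (\<lambda>z. f z - g z) n = fcoeff f n - fcoeff g n"
  using integrable_circ_mult_powi[OF assms(1), of "-n"] integrable_circ_mult_powi[OF assms(2), of "-n"] assms
  by (simp add: fcoeff_eq left_diff_distrib)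

lemma fcoeff_cmult:
  assumes [measurable]: "f \<in> borel_measurable circ"
  shows "fcoeff (\<lambda>z. c * f z) n = c * fcoeff f n"
  by (simp add: fcoeff_eq mult.assoc)

lemma fcoeff_cnj:
  assumes [measurable]: "f \<in> borel_measurable circ"
  shows "fcoeff (\<lambda>z. cnj (f z)) n = cnj (fcoeff f (-n))"
proof -
  have [measurable]: "(\<lambda>z. cnj (f z)) \<in> borel_measurable circ"
    by (intro borel_measurable_continuous_on[OF continuous_on_cnj[OF continuous_on_id]]) measurable
  have [measurable]: "(\<lambda>z. cnj (f z * z powi n)) \<in> borel_measurable circ"
    by (intro borel_measurable_continuous_on[OF continuous_on_cnj[OF continuous_on_id]]) measurable
  have "fcoeff (\<lambda>z. cnj (f z)) n = (\<integral>z. cnj (f z * z powi n) \<partial>circ)"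
    unfolding fcoeff_eq[OF \<open>(\<lambda>z. cnj (f z)) \<in> borel_measurable circ\<close>]
  proof (rule integral_cong_AE)
    show "AE z in circ. cnj (f z) * z powi (-n) = cnj (f z * z powi n)"
      using AE_circ_cmod by eventually_elim (simp add: cnj_powi_circ del: complex_cnj_power_int)
  qed measurable
  then show ?thesis by (simp add: fcoeff_eq del: complex_cnj_mult complex_cnj_power_int)
qed

lemma fcoeff_shift:
  assumes [measurable]: "f \<in> borel_measurable circ"
  shows "fcoeff (\<lambda>z. z powi k * f z) n = fcoeff f (n - k)"
proof -
  have "(\<integral>z. z powi k * f z * z powi (-n) \<partial>circ) = (\<integral>z. f z * z powi (-(n-k)) \<partial>circ)"
  proof (rule integral_cong_AE)
    show "AE z in circ. z powi k * f z * z powi (-n) = f z * z powi (-(n-k))"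
      using AE_circ_nonzero
    proof eventually_elim
      case (elim z)
      then have "z powi (-(n-k)) = z powi k * z powi (-n)"
        by (subst power_int_add[symmetric]) auto
      then show ?case by simp
    qed
  qed measurable
  then show ?thesis by (simp add: fcoeff_eq)
qed

lemma cmod_fcoeff_le_l2norm:
  assumes "sq_integrable circ f" shows "cmod (fcoeff f n) \<le> l2norm circ f"
  using cmod_integral_mult_le[OF assms sq_integrable_powi[of "-n"]] assms
  by (simp add: fcoeff_eq l2norm_powi sq_integrable_measurable)

lemma fcoeff_trig:
  assumes "finite I"
  shows "fcoeff (\<lambda>z. \<Sum>k\<in>I. c k * z powi k) n = (if n \<in> I then c n else 0)"
proof -
  have i: "integrable circ (\<lambda>z. z powi k)" for k
    by (intro circ.sq_integrable_imp_integrable sq_integrable_powi)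
  have "fcoeff (\<lambda>z. \<Sum>k\<in>I. c k * z powi k) n = (\<integral>z. (\<Sum>k\<in>I. c k * z powi (k - n)) \<partial>circ)"
  proof (subst fcoeff_eq, measurable, rule integral_cong_AE)
    show "AE z in circ. (\<Sum>k\<in>I. c k * z powi k) * z powi (-n) = (\<Sum>k\<in>I. c k * z powi (k - n))"
      using AE_circ_nonzero
      by eventually_elim (simp add: sum_distrib_right power_int_diff power_int_minus divide_simps)
  qed measurable
  also have "\<dots> = (\<Sum>k\<in>I. c k * (\<integral>z. z powi (k - n) \<partial>circ))"
    by (simp add: Bochner_Integration.integral_sum i)
  also have "\<dots> = (\<Sum>k\<in>I. if k = n then c k else 0)"
    by (intro sum.cong) (auto simp: integral_powi_circ)
  finally show ?thesis using assms by (simp add: sum.delta)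
qed

lemma sq_integrable_trig: "sq_integrable circ (\<lambda>z. \<Sum>k\<in>I. c k * z powi k)"
  by (intro sq_integrable_sum sq_integrable_cmult sq_integrable_powi)

text \<open>The class of functions killed by all Fourier coefficients is a module over the trigonometric
  polynomials; Stone--Weierstrass and inner regularity then show that it is trivial.\<close>

definition fourier_null :: "(complex \<Rightarrow> complex) \<Rightarrow> bool" where
  "fourier_null f \<longleftrightarrow> integrable circ f \<and> (\<forall>n. fcoeff f n = 0)"

lemma fourier_null_add: "fourier_null f \<Longrightarrow> fourier_null g \<Longrightarrow> fourier_null (\<lambda>z. f z + g z)"
  by (simp add: fourier_null_def fcoeff_add)

lemma fourier_null_cmult: "fourier_null f \<Longrightarrow> fourier_null (\<lambda>z. c * f z)"
  by (auto simp: fourier_null_def fcoeff_cmult borel_measurable_integrable)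

lemma fourier_null_powi: "fourier_null f \<Longrightarrow> fourier_null (\<lambda>z. z powi k * f z)"
  using integrable_circ_mult_powi[of f k] fcoeff_shift[of f k]
  by (auto simp: fourier_null_def mult.commute borel_measurable_integrable)

lemma fourier_null_cong_AE:
  assumes "fourier_null f" "g \<in> borel_measurable circ" "AE z in circ. f z = g z"
  shows "fourier_null g"
proof -
  have "integrable circ g"
    using assms by (auto simp: fourier_null_def intro: integrable_cong_AE_imp)
  then show ?thesis
    using assms fcoeff_cong_AE[of f g] by (auto simp: fourier_null_def)
qed

text \<open>On the circle a real linear form is a combination of \<open>z\<close> and
  \<open>z powi (-1)\<close>, so multiplication by it merely combines shifts of Fourier
  coefficients. \<open>f\<close> is arbitrary in the induction because the product case applies the
  hypothesis for \<open>p\<close> to the function obtained from \<open>q\<close>.\<close>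

lemma fourier_null_polynomial:
  assumes "real_polynomial_function p" "fourier_null f"
  shows "fourier_null (\<lambda>z. of_real (p z) * f z)"
  using assms
proof (induction arbitrary: f rule: real_polynomial_function.induct)
  case (linear h)
  \<comment> \<open>Solves \<open>a * z + b * cnj z = Re z * h 1 + Im z * h \<i>\<close>, by writing
    real and imaginary part through \<open>z\<close> and \<open>cnj z\<close>.\<close>
  define a b where "a = Complex (h 1 / 2) (- h \<i> / 2)" and "b = Complex (h 1 / 2) (h \<i> / 2)"
  have [measurable]: "f \<in> borel_measurable circ" using linear by (auto simp: fourier_null_def)
  have [measurable]: "h \<in> borel_measurable circ"
    using linear by (intro borel_measurable_circ_continuous) (simp add: linear_continuous_on)
  have hz: "h z = Re z * h 1 + Im z * h \<i>" for z
  proof -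
    have "z = Re z *\<^sub>R 1 + Im z *\<^sub>R \<i>" by (simp add: complex_eq_iff)
    then have "h z = h (Re z *\<^sub>R 1 + Im z *\<^sub>R \<i>)" by (rule arg_cong)
    then show ?thesis using linear(1) by (simp add: bounded_linear.linear linear_add linear_cmul)
  qed
  have "fourier_null (\<lambda>z. a * (z powi 1 * f z) + b * (z powi (-1) * f z))"
    by (intro fourier_null_add fourier_null_cmult fourier_null_powi linear)
  then show ?case
  proof (rule fourier_null_cong_AE)
    show "AE z in circ. a * (z powi 1 * f z) + b * (z powi (-1) * f z) = of_real (h z) * f z"
      using AE_circ_cmod
    proof eventually_elim
      case (elim z)
      have "z powi (-1) = cnj z" using elim by (rule powi_minus_one_circ)
      moreover have "a * z + b * cnj z = of_real (h z)"
        unfolding hz[of z] a_def b_def by (simp add: complex_eq_iff algebra_simps)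
      ultimately have "a * z powi 1 + b * z powi (-1) = of_real (h z)" by (simp only: power_int_1_right)
      then have "(a * z powi 1 + b * z powi (-1)) * f z = of_real (h z) * f z" by (rule arg_cong)
      then show ?case by (simp only: distrib_right mult.assoc)
    qed
  qed measurable
next
  case (const c) then show ?case by (simp add: fourier_null_cmult)
next
  case (add p q) then show ?case using fourier_null_add by (simp add: distrib_right)
next
  case (mult p q)
  then show ?case by (simp add: mult.assoc)
qed

lemma fourier_null_continuous:
  fixes \<phi> :: "complex \<Rightarrow> real"
  assumes f: "fourier_null f" and \<phi>: "continuous_on (sphere 0 1) \<phi>"
  shows "(\<integral>z. of_real (\<phi> z) * f z \<partial>circ) = 0"
proof -
  have [measurable]: "f \<in> borel_measurable circ" and i: "integrable circ f" using f by (auto simp: fourier_null_def)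
  have [measurable]: "\<phi> \<in> borel_measurable circ" using \<phi> by (rule borel_measurable_circ_continuous)
  have bd: "integrable circ (\<lambda>z. of_real (u z) * f z) \<and> cmod (\<integral>z. of_real (u z) * f z \<partial>circ) \<le> B * (\<integral>z. cmod (f z) \<partial>circ)"
    if [measurable]: "u \<in> borel_measurable circ" and b: "\<And>z. cmod z = 1 \<Longrightarrow> \<bar>u z\<bar> \<le> B" for u :: "complex \<Rightarrow> real" and B
  proof -
    have a: "AE z in circ. norm (of_real (u z) * f z) \<le> B * cmod (f z)"
      using AE_circ_cmod by eventually_elim (simp add: norm_mult mult_right_mono b)
    have j: "integrable circ (\<lambda>z. B * cmod (f z))" using i by simp
    have "integrable circ (\<lambda>z. of_real (u z) * f z)"
      using j
    proof (rule Bochner_Integration.integrable_bound)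
      show "AE z in circ. norm (of_real (u z) * f z) \<le> norm (B * cmod (f z))"
        using a by eventually_elim simp
    qed measurable
    moreover have "cmod (\<integral>z. of_real (u z) * f z \<partial>circ) \<le> (\<integral>z. B * cmod (f z) \<partial>circ)"
      by (rule order_trans[OF integral_norm_bound]) (intro integral_mono_AE integrable_norm j calculation a)
    ultimately show ?thesis by simp
  qed
  obtain B where B: "\<And>z. z \<in> sphere 0 1 \<Longrightarrow> norm (\<phi> z) \<le> B"
    using compact_imp_bounded[OF compact_continuous_image[OF \<phi> compact_sphere]] unfolding bounded_iff by blast
  have i\<phi>: "integrable circ (\<lambda>z. of_real (\<phi> z) * f z)"
    using bd[of \<phi> B] B by auto
  have "cmod (\<integral>z. of_real (\<phi> z) * f z \<partial>circ) \<le> 0 + e" if "e > 0" for e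
  proof -
    define K where "K = (\<integral>z. cmod (f z) \<partial>circ)"
    have "K \<ge> 0" by (simp add: K_def)
    \<comment> \<open>The approximation error gets multiplied by the L^1 norm \<open>K\<close> of
      \<open>f\<close>; the added 1 keeps the tolerance positive when \<open>K\<close> is 0.\<close>
    then have e': "e / (K + 1) > 0" using that by simp
    obtain p where p: "real_polynomial_function p" "\<And>z. z \<in> sphere 0 1 \<Longrightarrow> \<bar>\<phi> z - p z\<bar> < e / (K+1)"
      using Stone_Weierstrass_real_polynomial_function[OF compact_sphere \<phi> e'] by metis
    have [measurable]: "p \<in> borel_measurable circ"
      using p(1) by (intro borel_measurable_circ_continuous)
        (auto simp: real_polynomial_function_eq intro: continuous_on_polymonial_function)
    have fp: "fourier_null (\<lambda>z. of_real (p z) * f z)" using p(1) f by (rule fourier_null_polynomial)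
    then have "(\<integral>z. of_real (p z) * f z \<partial>circ) = 0"
      using fcoeff_eq[of "\<lambda>z. of_real (p z) * f z" 0] by (simp add: fourier_null_def)
    then have "(\<integral>z. of_real (\<phi> z) * f z \<partial>circ) = (\<integral>z. of_real (\<phi> z) * f z - of_real (p z) * f z \<partial>circ)"
      using fp i\<phi> by (simp add: fourier_null_def)
    also have "\<dots> = (\<integral>z. of_real (\<phi> z - p z) * f z \<partial>circ)" by (simp add: left_diff_distrib)
    also have "cmod \<dots> \<le> e / (K+1) * K"
      unfolding K_def by (rule bd[THEN conjunct2]) (use p(2) in \<open>auto simp: K_def less_imp_le\<close>)
    also have "\<dots> \<le> e" using \<open>K \<ge> 0\<close> that by (simp add: field_simps)
    finally show ?thesis by simp
  qed
  then have "cmod (\<integral>z. of_real (\<phi> z) * f z \<partial>circ) \<le> 0" by (rule field_le_epsilon)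
  then show ?thesis by simp
qed

text \<open>The tents \<open>\<phi> n\<close> decrease to the indicator of \<open>K\<close> because
  \<open>K\<close> is closed, and \<open>cmod (f z)\<close> dominates. The empty set is separate
  since \<open>infdist\<close> to it is 0, which would make every tent equal to 1.\<close>

lemma fourier_null_compact:
  assumes f: "fourier_null f" and K: "compact K"
  shows "(\<integral>z. indicator K z *\<^sub>R f z \<partial>circ) = 0"
proof (cases "K = {}")
  case False
  have [measurable]: "f \<in> borel_measurable circ" and i: "integrable circ f" using f by (auto simp: fourier_null_def)
  define \<phi> where "\<phi> n z = max 0 (1 - real n * infdist z K)" for n z
  have c: "continuous_on (sphere 0 1) (\<phi> n)" for n
    unfolding \<phi>_def by (intro continuous_intros)
  have [measurable]: "\<phi> n \<in> borel_measurable circ" for n by (rule borel_measurable_circ_continuous[OF c])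
  have lim: "(\<lambda>n. \<phi> n z) \<longlonglongrightarrow> indicator K z" for z
  proof (cases "z \<in> K")
    case False
    then have "infdist z K > 0"
      using in_closed_iff_infdist_zero[OF compact_imp_closed[OF K] \<open>K \<noteq> {}\<close>, of z] infdist_nonneg[of z K] by linarith
    then obtain N where N: "real N * infdist z K > 1" using reals_Archimedean3 by blast
    have "\<phi> n z = 0" if "n \<ge> N" for n
    proof -
      have "real n * infdist z K \<ge> real N * infdist z K" using that by (intro mult_right_mono infdist_nonneg) auto
      then show ?thesis using N by (simp add: \<phi>_def)
    qed
    then show ?thesis using False by (auto intro: tendsto_eventually eventually_sequentiallyI)
  qed (simp add: \<phi>_def)
  have "indicator K \<in> borel_measurable circ"
    by (intro borel_measurable_indicator borel_sets_circ borel_compact K)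
  then have [measurable]: "(\<lambda>z. indicator K z *\<^sub>R f z) \<in> borel_measurable circ" by measurable
  have "(\<lambda>n. \<integral>z. of_real (\<phi> n z) * f z \<partial>circ) \<longlonglongrightarrow> (\<integral>z. indicator K z *\<^sub>R f z \<partial>circ)"
  proof (rule integral_dominated_convergence[where w="\<lambda>z. cmod (f z)"])
    show "AE z in circ. (\<lambda>n. of_real (\<phi> n z) * f z) \<longlonglongrightarrow> indicator K z *\<^sub>R f z"
      unfolding scaleR_conv_of_real by (intro AE_I2 tendsto_intros lim)
    show "AE z in circ. norm (of_real (\<phi> n z) * f z) \<le> cmod (f z)" for n
      by (intro AE_I2) (auto simp: norm_mult \<phi>_def infdist_nonneg intro!: mult_left_le_one_le)
  qed (use i in auto)
  then show ?thesis
    by (simp add: fourier_null_continuous[OF f c] LIMSEQ_const_iff)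
qed simp

text \<open>Every event is an increasing union of compact sets up to a null set.\<close>

theorem fourier_unique:
  assumes "integrable circ f" "\<And>n. fcoeff f n = 0"
  shows "AE z in circ. f z = 0"
proof (rule circ.density_zero[OF assms(1)])
  have f: "fourier_null f" using assms by (simp add: fourier_null_def)
  have [measurable]: "f \<in> borel_measurable circ" using assms by auto
  fix A assume A: "A \<in> sets circ"
  define S where "S = cis -` A \<inter> {0..2*pi}"
  have "S \<in> sets lebesgue" using A by (simp add: S_def sets_circ circ_events_def)
  then obtain C T where C: "fsigma C" "T \<in> null_sets lebesgue" "C \<union> T = S"
    by (rule lebesgue_set_almost_fsigma)
  obtain F :: "nat \<Rightarrow> real set" where F': "range F \<subseteq> Collect compact" and F2: "C = (\<Union>i. F i)"
    using C(1) unfolding fsigma_Union_compact by blast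
  have F: "compact (F i)" for i using F' by blast
  define K where "K n = cis ` (\<Union>i\<le>n. F i)" for n
  have K: "compact (K n)" for n
    unfolding K_def using F by (intro compact_continuous_image continuous_intros compact_UN) auto
  have KA: "K n \<subseteq> A" for n using C(3) F2 by (auto simp: K_def S_def)
  have "AE t in lebesgue. t \<notin> T" using C(2) by (rule AE_not_in)
  then have "AE t in lebesgue. t \<in> {0..2*pi} \<longrightarrow> (\<lambda>n. indicator (K n) (cis t) *\<^sub>R f (cis t)) \<longlonglongrightarrow> indicator A (cis t) *\<^sub>R f (cis t)"
  proof eventually_elim
    case (elim t)
    show ?case
    proof (intro impI)
      assume t: "t \<in> {0..2*pi}"
      show "(\<lambda>n. indicator (K n) (cis t) *\<^sub>R f (cis t)) \<longlonglongrightarrow> indicator A (cis t) *\<^sub>R f (cis t)"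
      proof (cases "cis t \<in> A")
        case True
        then have "t \<in> C" using t elim C(3) by (auto simp: S_def)
        then obtain m where m: "t \<in> F m" using F2 by auto
        have "cis t \<in> K n" if "n \<ge> m" for n using m that by (auto simp: K_def)
        then show ?thesis using True by (auto intro!: tendsto_eventually eventually_sequentiallyI[of m])
      next
        case False
        then have "cis t \<notin> K n" for n using KA by auto
        then show ?thesis using False by simp
      qed
    qed
  qed
  then have lim: "AE z in circ. (\<lambda>n. indicator (K n) z *\<^sub>R f z) \<longlonglongrightarrow> indicator A z *\<^sub>R f z"
    by (simp add: AE_circ_iff)
  have Km: "K n \<in> sets circ" for n by (intro borel_sets_circ borel_compact K)
  have "(\<lambda>n. \<integral>z. indicator (K n) z *\<^sub>R f z \<partial>circ) \<longlonglongrightarrow> (\<integral>z. indicator A z *\<^sub>R f z \<partial>circ)"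
  proof (rule integral_dominated_convergence[where w="\<lambda>z. cmod (f z)", OF _ _ _ lim])
    show "(\<lambda>z. indicator A z *\<^sub>R f z) \<in> borel_measurable circ"
         "(\<lambda>z. indicator (K n) z *\<^sub>R f z) \<in> borel_measurable circ" for n
      using A Km by measurable
    show "AE z in circ. norm (indicator (K n) z *\<^sub>R f z) \<le> cmod (f z)" for n
      by (intro AE_I2) (auto simp: indicator_def)
  qed (use assms in auto)
  then have "(\<integral>z. indicator A z *\<^sub>R f z \<partial>circ) = 0"
    by (simp add: fourier_null_compact[OF f K] LIMSEQ_const_iff)
  then show "set_lebesgue_integral circ A f = 0" by (simp add: set_lebesgue_integral_def)
qed

section \<open>Parseval and Riesz--Fischer\<close>

lemma integral_mult_trig:
  assumes f: "sq_integrable circ f"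
  shows "(\<integral>z. f z * cnj (\<Sum>k\<in>I. c k * z powi k) \<partial>circ) = (\<Sum>k\<in>I. fcoeff f k * cnj (c k))"
proof -
  have [measurable]: "f \<in> borel_measurable circ" using f by measurable
  have i: "integrable circ (\<lambda>z. f z * z powi (-k))" for k
    by (intro integrable_circ_mult_powi circ.sq_integrable_imp_integrable f)
  have "(\<integral>z. f z * cnj (\<Sum>k\<in>I. c k * z powi k) \<partial>circ) = (\<integral>z. (\<Sum>k\<in>I. cnj (c k) * (f z * z powi (-k))) \<partial>circ)"
  proof (rule integral_cong_AE)
    show "AE z in circ. f z * cnj (\<Sum>k\<in>I. c k * z powi k) = (\<Sum>k\<in>I. cnj (c k) * (f z * z powi (-k)))"
      using AE_circ_cmod
      by eventually_elim (simp add: cnj_powi_circ sum_distrib_left mult_ac del: complex_cnj_power_int)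
    have "sq_integrable circ (\<lambda>z. cnj (\<Sum>k\<in>I. c k * z powi k))" by (intro sq_integrable_cnj sq_integrable_trig)
    then show "(\<lambda>z. f z * cnj (\<Sum>k\<in>I. c k * z powi k)) \<in> borel_measurable circ" by measurable
  qed measurable
  also have "\<dots> = (\<Sum>k\<in>I. cnj (c k) * fcoeff f k)"
    by (simp add: Bochner_Integration.integral_sum i fcoeff_eq)
  finally show ?thesis by (simp add: mult.commute)
qed

lemma of_real_l2norm_power2:
  assumes "sq_integrable M f" shows "complex_of_real ((l2norm M f)\<^sup>2) = (\<integral>x. f x * cnj (f x) \<partial>M)"
  unfolding l2norm_power2 by (simp only: integral_complex_of_real[symmetric] complex_norm_square)

lemma l2norm_trig:
  assumes "finite I" shows "(l2norm circ (\<lambda>z. \<Sum>k\<in>I. c k * z powi k))\<^sup>2 = (\<Sum>k\<in>I. (cmod (c k))\<^sup>2)"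
proof -
  have "complex_of_real ((l2norm circ (\<lambda>z. \<Sum>k\<in>I. c k * z powi k))\<^sup>2) = (\<Sum>k\<in>I. c k * cnj (c k))"
    by (subst of_real_l2norm_power2[OF sq_integrable_trig], subst integral_mult_trig[OF sq_integrable_trig])
       (use assms in \<open>simp add: fcoeff_trig\<close>)
  also have "\<dots> = complex_of_real (\<Sum>k\<in>I. (cmod (c k))\<^sup>2)" by (simp only: of_real_sum complex_norm_square)
  finally show ?thesis by (simp only: of_real_eq_iff)
qed

text \<open>Pythagoras: the coefficients of the remainder vanish on \<open>I\<close>, so it is
  orthogonal to the partial sum.\<close>

lemma l2norm_minus_trig:
  assumes "finite I" and f: "sq_integrable circ f"
  shows "(l2norm circ (\<lambda>z. f z - (\<Sum>k\<in>I. fcoeff f k * z powi k)))\<^sup>2 = (l2norm circ f)\<^sup>2 - (\<Sum>k\<in>I. (cmod (fcoeff f k))\<^sup>2)"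
proof -
  define s where "s z = (\<Sum>k\<in>I. fcoeff f k * z powi k)" for z
  have s: "sq_integrable circ s" unfolding s_def[abs_def] by (rule sq_integrable_trig)
  have d: "sq_integrable circ (\<lambda>z. f z - s z)" by (intro sq_integrable_diff f s)
  have i: "integrable circ f" "integrable circ s" by (intro circ.sq_integrable_imp_integrable f s)+
  have c: "sq_integrable circ (\<lambda>z. cnj (f z))" "sq_integrable circ (\<lambda>z. cnj (s z))" by (intro sq_integrable_cnj f s)+
  have fs: "fcoeff s k = (if k \<in> I then fcoeff f k else 0)" for k
    unfolding s_def[abs_def] using assms(1) by (rule fcoeff_trig)
  have "(\<integral>z. (f z - s z) * cnj (s z) \<partial>circ) = (\<Sum>k\<in>I. fcoeff (\<lambda>z. f z - s z) k * cnj (fcoeff f k))"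
    using integral_mult_trig[OF d, of "fcoeff f" I] by (simp only: s_def)
  then have 1: "(\<integral>z. (f z - s z) * cnj (s z) \<partial>circ) = 0"
    by (simp add: fcoeff_diff i fs)
  have "(\<integral>z. f z * cnj (s z) \<partial>circ) = of_real (\<Sum>k\<in>I. (cmod (fcoeff f k))\<^sup>2)"
    by (simp only: s_def integral_mult_trig[OF f] of_real_sum complex_norm_square)
  then have "(\<integral>z. cnj (f z * cnj (s z)) \<partial>circ) = of_real (\<Sum>k\<in>I. (cmod (fcoeff f k))\<^sup>2)"
    by (simp del: complex_cnj_mult)
  then have 2: "(\<integral>z. s z * cnj (f z) \<partial>circ) = of_real (\<Sum>k\<in>I. (cmod (fcoeff f k))\<^sup>2)"
    by (simp add: mult.commute)
  have "complex_of_real ((l2norm circ (\<lambda>z. f z - s z))\<^sup>2) = (\<integral>z. (f z - s z) * cnj (f z - s z) \<partial>circ)"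
    by (rule of_real_l2norm_power2[OF d])
  also have "\<dots> = (\<integral>z. (f z * cnj (f z) - s z * cnj (f z)) - (f z - s z) * cnj (s z) \<partial>circ)"
    by (simp add: algebra_simps)
  also have "\<dots> = of_real ((l2norm circ f)\<^sup>2) - of_real (\<Sum>k\<in>I. (cmod (fcoeff f k))\<^sup>2)"
    using sq_integrable_mult[OF f c(1)] sq_integrable_mult[OF s c(1)] sq_integrable_mult[OF d c(2)]
    by (simp only: Bochner_Integration.integral_diff Bochner_Integration.integrable_diff 1 2 of_real_l2norm_power2[OF f] diff_zero)
  also have "\<dots> = of_real ((l2norm circ f)\<^sup>2 - (\<Sum>k\<in>I. (cmod (fcoeff f k))\<^sup>2))" by simp
  finally show ?thesis by (simp only: of_real_eq_iff s_def)
qed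

lemma bessel:
  assumes "finite I" "sq_integrable circ f"
  shows "(\<Sum>k\<in>I. (cmod (fcoeff f k))\<^sup>2) \<le> (l2norm circ f)\<^sup>2"
  using l2norm_minus_trig[OF assms] zero_le_power2[of "l2norm circ (\<lambda>z. f z - (\<Sum>k\<in>I. fcoeff f k * z powi k))"]
  by linarith

lemma fcoeff_l2_limit:
  assumes s: "\<And>n. sq_integrable circ (s n)" and f: "sq_integrable circ f"
    and l: "(\<lambda>n. l2norm circ (\<lambda>z. s n z - f z)) \<longlonglongrightarrow> 0"
  shows "(\<lambda>n. fcoeff (s n) k) \<longlonglongrightarrow> fcoeff f k"
proof -
  have "(\<lambda>n. fcoeff (s n) k - fcoeff f k) \<longlonglongrightarrow> 0"
  proof (rule Lim_null_comparison[OF _ l])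
    have "cmod (fcoeff (s n) k - fcoeff f k) \<le> l2norm circ (\<lambda>z. s n z - f z)" for n
      using cmod_fcoeff_le_l2norm[OF sq_integrable_diff[OF s[of n] f], of k]
      by (simp add: fcoeff_diff circ.sq_integrable_imp_integrable s f)
    then show "\<forall>\<^sub>F n in sequentially. cmod (fcoeff (s n) k - fcoeff f k) \<le> l2norm circ (\<lambda>z. s n z - f z)" by simp
  qed
  then show ?thesis by (simp add: LIM_zero_iff)
qed

text \<open>By Pythagoras the squared distance of two symmetric partial sums is a difference of
  bounded increasing square sums, so the partial sums are Cauchy. Completeness gives
  \<open>f\<close>, and each coefficient is eventually constant along the partial sums.\<close>

theorem riesz_fischer:
  assumes B: "\<And>I. finite I \<Longrightarrow> (\<Sum>k\<in>I. (cmod (c k))\<^sup>2) \<le> B"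
  obtains f where "sq_integrable circ f" "\<And>k. fcoeff f k = c k"
    "(\<lambda>N. l2norm circ (\<lambda>z. (\<Sum>k\<in>{- int N..int N}. c k * z powi k) - f z)) \<longlonglongrightarrow> 0"
proof -
  define s where "s N z = (\<Sum>k\<in>{- int N..int N}. c k * z powi k)" for N z
  define \<sigma> where "\<sigma> N = (\<Sum>k\<in>{- int N..int N}. (cmod (c k))\<^sup>2)" for N
  have s: "sq_integrable circ (s N)" for N unfolding s_def[abs_def] by (rule sq_integrable_trig)
  have "incseq \<sigma>" unfolding \<sigma>_def by (intro incseq_SucI sum_mono2) auto
  then have "Cauchy \<sigma>"
    using B by (intro convergent_Cauchy Bseq_mono_convergent BseqI'[of _ B]) (auto simp: \<sigma>_def sum_nonneg incseq_def)
  have diff: "(l2norm circ (\<lambda>z. s m z - s n z))\<^sup>2 = \<sigma> m - \<sigma> n" if "n \<le> m" for m n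
  proof -
    have sub: "{- int n..int n} \<subseteq> {- int m..int m}" using that by auto
    have "(\<lambda>z. s m z - s n z) = (\<lambda>z. \<Sum>k\<in>{- int m..int m} - {- int n..int n}. c k * z powi k)"
      unfolding s_def by (subst sum_diff[OF _ sub]) auto
    then have "(l2norm circ (\<lambda>z. s m z - s n z))\<^sup>2 = (\<Sum>k\<in>{- int m..int m} - {- int n..int n}. (cmod (c k))\<^sup>2)"
      by (simp only: l2norm_trig finite_Diff finite_atLeastAtMost_int)
    then show ?thesis unfolding \<sigma>_def by (subst (asm) sum_diff[OF _ sub]) auto
  qed
  have "\<exists>N. \<forall>m\<ge>N. \<forall>n\<ge>N. l2norm circ (\<lambda>z. s m z - s n z) < e" if "e > 0" for e
  proof -
    have "0 < e\<^sup>2" using that by simp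
    from metric_CauchyD[OF \<open>Cauchy \<sigma>\<close> this]
    obtain N where N: "\<And>m n. m \<ge> N \<Longrightarrow> n \<ge> N \<Longrightarrow> dist (\<sigma> m) (\<sigma> n) < e\<^sup>2" by blast
    have *: "l2norm circ (\<lambda>z. s m z - s n z) < e" if "m \<ge> N" "n \<ge> N" "n \<le> m" for m n
      using N[OF that(1,2)] diff[OF that(3)] \<open>e > 0\<close> by (intro power2_less_imp_less[of _ e]) (auto simp: dist_real_def)
    have "l2norm circ (\<lambda>z. s m z - s n z) < e" if "m \<ge> N" "n \<ge> N" for m n
      using *[of m n] *[of n m] that l2norm_minus_commute[of circ "s m" "s n"] by (cases "n \<le> m") auto
    then show ?thesis by blast
  qed
  from circ.l2_complete[OF s this] obtain f where f: "sq_integrable circ f" "(\<lambda>n. l2norm circ (\<lambda>z. s n z - f z)) \<longlonglongrightarrow> 0"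
    by blast
  have "fcoeff f k = c k" for k
  proof (rule LIMSEQ_unique[OF fcoeff_l2_limit[OF s f]])
    have "fcoeff (s n) k = c k" if "n \<ge> nat \<bar>k\<bar>" for n
      unfolding s_def[abs_def] using that by (subst fcoeff_trig) auto
    then show "(\<lambda>n. fcoeff (s n) k) \<longlonglongrightarrow> c k"
      by (intro tendsto_eventually eventually_sequentiallyI) auto
  qed
  then show ?thesis using f that unfolding s_def by blast
qed

lemma fourier_unique_eq:
  assumes "integrable circ f" "integrable circ g" "\<And>n. fcoeff f n = fcoeff g n"
  shows "AE z in circ. f z = g z"
  using fourier_unique[of "\<lambda>z. f z - g z"] assms by (simp add: fcoeff_diff)

text \<open>The partial sums converge by Riesz-Fischer to some function with the coefficients of
  \<open>f\<close>; uniqueness of Fourier coefficients identifies it with \<open>f\<close>.\<close>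

theorem fourier_l2_limit:
  assumes f: "sq_integrable circ f"
  shows "(\<lambda>N. l2norm circ (\<lambda>z. f z - (\<Sum>k\<in>{- int N..int N}. fcoeff f k * z powi k))) \<longlonglongrightarrow> 0"
proof -
  obtain g where g: "sq_integrable circ g" "\<And>k. fcoeff g k = fcoeff f k"
    "(\<lambda>N. l2norm circ (\<lambda>z. (\<Sum>k\<in>{- int N..int N}. fcoeff f k * z powi k) - g z)) \<longlonglongrightarrow> 0"
    by (rule riesz_fischer[OF bessel[OF _ f]]) blast+
  have ae: "AE z in circ. g z = f z"
    by (intro fourier_unique_eq circ.sq_integrable_imp_integrable f g)
  have "l2norm circ (\<lambda>z. (\<Sum>k\<in>{- int N..int N}. fcoeff f k * z powi k) - g z)
      = l2norm circ (\<lambda>z. f z - (\<Sum>k\<in>{- int N..int N}. fcoeff f k * z powi k))" for N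
  proof (subst l2norm_minus_commute, rule l2norm_cong_AE)
    have [measurable]: "f \<in> borel_measurable circ" "g \<in> borel_measurable circ" using f g by measurable
    show "(\<lambda>z. g z - (\<Sum>k\<in>{- int N..int N}. fcoeff f k * z powi k)) \<in> borel_measurable circ"
      "(\<lambda>z. f z - (\<Sum>k\<in>{- int N..int N}. fcoeff f k * z powi k)) \<in> borel_measurable circ" by measurable
    show "AE z in circ. g z - (\<Sum>k\<in>{- int N..int N}. fcoeff f k * z powi k) = f z - (\<Sum>k\<in>{- int N..int N}. fcoeff f k * z powi k)"
      using ae by eventually_elim simp
  qed
  then show ?thesis using g(3) by simp
qed

theorem parseval:
  assumes f: "sq_integrable circ f"
  shows "(\<lambda>N. \<Sum>k\<in>{- int N..int N}. (cmod (fcoeff f k))\<^sup>2) \<longlonglongrightarrow> (l2norm circ f)\<^sup>2"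
proof -
  have "(\<lambda>N. (l2norm circ f)\<^sup>2 - (\<Sum>k\<in>{- int N..int N}. (cmod (fcoeff f k))\<^sup>2)) \<longlonglongrightarrow> 0"
    using tendsto_power[OF fourier_l2_limit[OF f], of 2] by (simp add: l2norm_minus_trig f)
  from tendsto_diff[OF tendsto_const[of "(l2norm circ f)\<^sup>2"] this] show ?thesis by simp
qed

text \<open>Parseval in the form used for projections: cutting off coefficients does not increase
  the norm.\<close>

lemma l2norm_mono_fcoeff:
  assumes "sq_integrable circ f" "sq_integrable circ g" "\<And>k. cmod (fcoeff f k) \<le> cmod (fcoeff g k)"
  shows "l2norm circ f \<le> l2norm circ g"
proof (rule power2_le_imp_le)
  show "(l2norm circ f)\<^sup>2 \<le> (l2norm circ g)\<^sup>2"
    by (rule LIMSEQ_le[OF parseval parseval]) (use assms in \<open>auto intro!: sum_mono power_mono\<close>)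
qed simp

text \<open>Testing finitely many coefficients at a time allows a comparison function that depends
  on the finite set \<open>I\<close>.\<close>

lemma l2norm_le_fcoeff_bound:
  assumes "sq_integrable circ f" "\<And>I. finite I \<Longrightarrow> (\<Sum>k\<in>I. (cmod (fcoeff f k))\<^sup>2) \<le> B\<^sup>2" "0 \<le> B"
  shows "l2norm circ f \<le> B"
proof (rule power2_le_imp_le)
  show "(l2norm circ f)\<^sup>2 \<le> B\<^sup>2"
    by (rule LIMSEQ_le_const2[OF parseval[OF assms(1)]]) (use assms in auto)
qed fact

text \<open>A product of two square integrable functions is only integrable, yet Cauchy-Schwarz
  makes its coefficients continuous in each factor. Approximating \<open>f\<close> by its partial
  sums gives the convolution as a limit of symmetric sums.\<close>

lemma fcoeff_mult:
  assumes f: "sq_integrable circ f" and g: "sq_integrable circ g"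
  shows "(\<lambda>N. \<Sum>k\<in>{- int N..int N}. fcoeff f k * fcoeff g (n - k)) \<longlonglongrightarrow> fcoeff (\<lambda>z. f z * g z) n"
proof -
  have [measurable]: "f \<in> borel_measurable circ" "g \<in> borel_measurable circ" using f g by measurable
  define s where "s N z = (\<Sum>k\<in>{- int N..int N}. fcoeff f k * z powi k)" for N z
  have s: "sq_integrable circ (s N)" for N unfolding s_def[abs_def] by (rule sq_integrable_trig)
  have [measurable]: "s N \<in> borel_measurable circ" for N using s[of N] by measurable
  have h: "sq_integrable circ (\<lambda>z. z powi (-n) * g z)" by (intro sq_integrable_mult_powi g)
  have ig: "integrable circ (\<lambda>z. z powi k * g z)" for k
    by (intro circ.sq_integrable_imp_integrable sq_integrable_mult_powi g)
  have ifg: "integrable circ (\<lambda>z. f z * g z)" by (intro sq_integrable_mult f g)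
  have isg: "integrable circ (\<lambda>z. s N z * g z)" for N by (intro sq_integrable_mult s g)
  have sg: "fcoeff (\<lambda>z. s N z * g z) n = (\<Sum>k\<in>{- int N..int N}. fcoeff f k * fcoeff g (n - k))" for N
  proof -
    have "fcoeff (\<lambda>z. \<Sum>k\<in>I. c k * (z powi k * g z)) n = (\<Sum>k\<in>I. c k * fcoeff g (n - k))" if "finite I" for I c
      using that
    proof induction
      case (insert k I)
      have m: "(\<lambda>z. z powi k * g z) \<in> borel_measurable circ" by measurable
      show ?case
        using insert ig by (simp add: fcoeff_add fcoeff_cmult[OF m] fcoeff_shift)
    qed (simp add: fcoeff_eq)
    then show ?thesis unfolding s_def by (simp add: sum_distrib_right mult.assoc)
  qed
  have "cmod (fcoeff (\<lambda>z. s N z * g z) n - fcoeff (\<lambda>z. f z * g z) n) \<le> l2norm circ (\<lambda>z. f z - s N z) * l2norm circ (\<lambda>z. z powi (-n) * g z)" for N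
  proof -
    have "fcoeff (\<lambda>z. f z * g z) n - fcoeff (\<lambda>z. s N z * g z) n = fcoeff (\<lambda>z. f z * g z - s N z * g z) n"
      by (rule fcoeff_diff[symmetric, OF ifg isg])
    also have "\<dots> = (\<integral>z. (f z - s N z) * (z powi (-n) * g z) \<partial>circ)"
      by (subst fcoeff_eq) (auto simp: algebra_simps)
    finally show ?thesis
      using cmod_integral_mult_le[OF sq_integrable_diff[OF f s] h, of N] by (simp add: norm_minus_commute)
  qed
  note bd = this
  have "(\<lambda>N. fcoeff (\<lambda>z. s N z * g z) n - fcoeff (\<lambda>z. f z * g z) n) \<longlonglongrightarrow> 0"
  proof (rule Lim_null_comparison)
    show "\<forall>\<^sub>F N in sequentially. cmod (fcoeff (\<lambda>z. s N z * g z) n - fcoeff (\<lambda>z. f z * g z) n)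
        \<le> l2norm circ (\<lambda>z. f z - s N z) * l2norm circ (\<lambda>z. z powi (-n) * g z)"
      using bd by (intro always_eventually allI)
    show "(\<lambda>N. l2norm circ (\<lambda>z. f z - s N z) * l2norm circ (\<lambda>z. z powi (-n) * g z)) \<longlonglongrightarrow> 0"
      using tendsto_mult_left_zero[OF fourier_l2_limit[OF f]] by (simp only: s_def)
  qed
  then show ?thesis by (simp add: LIM_zero_iff sg)
qed

section \<open>The Hardy space\<close>

lemma H2_iff: "H2 f \<longleftrightarrow> sq_integrable circ f \<and> (\<forall>n<0. fcoeff f n = 0)"
  by (simp add: H2_def L2T_iff)

lemma H2_sq_integrable: "H2 f \<Longrightarrow> sq_integrable circ f"
  by (simp add: H2_iff)

lemma H2_measurable [measurable_dest]: "H2 f \<Longrightarrow> f \<in> borel_measurable circ"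
  by (simp add: H2_iff sq_integrable_measurable)

lemma starT_starT [simp]: "starT (starT f) = f"
  by (simp add: starT_def)

lemma starT_measurable [measurable]:
  assumes "f \<in> borel_measurable circ" shows "starT f \<in> borel_measurable circ"
  unfolding starT_def
  by (rule borel_measurable_continuous_on[OF continuous_on_cnj[OF continuous_on_id] assms])

lemma sq_integrable_starT: "sq_integrable circ f \<Longrightarrow> sq_integrable circ (starT f)"
  unfolding starT_def by (rule sq_integrable_cnj)

lemma fcoeff_starT: "f \<in> borel_measurable circ \<Longrightarrow> fcoeff (starT f) n = cnj (fcoeff f (-n))"
  unfolding starT_def by (rule fcoeff_cnj)

lemma at_inf_eq: "at_inf f = cnj (fcoeff (starT f) 0)"
  using powser_zero[of "\<lambda>n. fcoeff (starT f) (int n)"] by (simp add: at_inf_def H2ext_def)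

lemma H2ext_zero: "H2ext f 0 = fcoeff f 0"
  using powser_zero[of "\<lambda>n. fcoeff f (int n)"] by (simp add: H2ext_def)

lemma sq_fcoeff_add:
  "sq_integrable circ f \<Longrightarrow> sq_integrable circ g \<Longrightarrow> fcoeff (\<lambda>z. f z + g z) n = fcoeff f n + fcoeff g n"
  by (simp add: fcoeff_add circ.sq_integrable_imp_integrable)

lemma sq_fcoeff_diff:
  "sq_integrable circ f \<Longrightarrow> sq_integrable circ g \<Longrightarrow> fcoeff (\<lambda>z. f z - g z) n = fcoeff f n - fcoeff g n"
  by (simp add: fcoeff_diff circ.sq_integrable_imp_integrable)

lemma sq_fcoeff_cmult: "sq_integrable circ f \<Longrightarrow> fcoeff (\<lambda>z. c * f z) n = c * fcoeff f n"
  by (simp add: fcoeff_cmult sq_integrable_measurable)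

lemma H2_diff: "H2 f \<Longrightarrow> H2 g \<Longrightarrow> H2 (\<lambda>z. f z - g z)"
  by (simp add: H2_iff sq_integrable_diff sq_fcoeff_diff)

lemma H2_cmult: "H2 f \<Longrightarrow> H2 (\<lambda>z. c * f z)"
  by (simp add: H2_iff sq_integrable_cmult sq_fcoeff_cmult)

lemma fcoeff_const: "fcoeff (\<lambda>_. c) n = (if n = 0 then c else 0)"
  using integral_powi_circ[of "-n"] by (simp add: fcoeff_eq)

lemma H2_const: "H2 (\<lambda>_. c)"
  by (simp add: H2_iff fcoeff_const sq_integrable_def)

text \<open>In the convolution at an index up to \<open>i + j\<close> a term can survive only for
  \<open>k = i\<close> and \<open>n = i + j\<close>: lowest orders add and lowest coefficients
  multiply. With \<open>i = j = 0\<close> this says that evaluation at the origin is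
  multiplicative.\<close>

lemma fcoeff_mult_vanish:
  assumes f: "sq_integrable circ f" "\<And>k. k < i \<Longrightarrow> fcoeff f k = 0"
    and g: "sq_integrable circ g" "\<And>k. k < j \<Longrightarrow> fcoeff g k = 0"
  shows "n < i + j \<Longrightarrow> fcoeff (\<lambda>z. f z * g z) n = 0"
    and "fcoeff (\<lambda>z. f z * g z) (i + j) = fcoeff f i * fcoeff g j"
proof -
  have z: "fcoeff f k * fcoeff g (n - k) = 0" if "n < i + j \<or> n = i + j \<and> k \<noteq> i" for n k
  proof (cases "k < i")
    case False
    then have "n - k < j" using that by auto
    then show ?thesis using g by simp
  qed (simp add: f)
  note lim = fcoeff_mult[OF f(1) g(1)]
  show "fcoeff (\<lambda>z. f z * g z) n = 0" if "n < i + j"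
    using lim[of n] that by (simp add: z LIMSEQ_const_iff)
  have "(\<Sum>k\<in>{- int N..int N}. fcoeff f k * fcoeff g (i + j - k)) = fcoeff f i * fcoeff g j" if "N \<ge> nat \<bar>i\<bar>" for N
  proof -
    have "(\<Sum>k\<in>{- int N..int N}. fcoeff f k * fcoeff g (i + j - k)) = (\<Sum>k\<in>{i}. fcoeff f k * fcoeff g (i + j - k))"
      using that z by (intro sum.mono_neutral_right) (auto simp del: mult_eq_0_iff)
    then show ?thesis by simp
  qed
  then have "(\<lambda>N. \<Sum>k\<in>{- int N..int N}. fcoeff f k * fcoeff g (i + j - k)) \<longlonglongrightarrow> fcoeff f i * fcoeff g j"
    by (intro tendsto_eventually eventually_sequentiallyI) auto
  then show "fcoeff (\<lambda>z. f z * g z) (i + j) = fcoeff f i * fcoeff g j"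
    using lim[of "i + j"] LIMSEQ_unique by blast
qed

lemma H2_mult:
  assumes "H2 f" "H2 g" "sq_integrable circ (\<lambda>z. f z * g z)"
  shows "H2 (\<lambda>z. f z * g z)"
  using fcoeff_mult_vanish(1)[of f 0 g 0] assms by (auto simp: H2_iff)

lemma fcoeff_mult_0:
  assumes "H2 f" "H2 g" shows "fcoeff (\<lambda>z. f z * g z) 0 = fcoeff f 0 * fcoeff g 0"
  using fcoeff_mult_vanish(2)[of f 0 g 0] assms by (auto simp: H2_iff)

lemma H2_limit:
  assumes s: "\<And>n. H2 (s n)" and f: "sq_integrable circ f"
    and l: "(\<lambda>n. l2norm circ (\<lambda>z. s n z - f z)) \<longlonglongrightarrow> 0"
  shows "H2 f"
proof -
  have "fcoeff f k = 0" if "k < 0" for k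
    using fcoeff_l2_limit[OF _ f l, of k] s that by (auto simp: H2_iff LIMSEQ_const_iff)
  then show ?thesis using f by (simp add: H2_iff)
qed

lemma integrable_circ_const:
  assumes "integrable circ f" "\<And>n. n \<noteq> 0 \<Longrightarrow> fcoeff f n = 0"
  shows "AE z in circ. f z = fcoeff f 0"
  using assms by (intro fourier_unique_eq) (auto simp: fcoeff_const)

section \<open>Power series, dilations and inversion in the Hardy space\<close>

lemma fcoeff_power_series:
  assumes C: "summable (\<lambda>n. cmod (C n))" and g: "\<And>z. cmod z = 1 \<Longrightarrow> (\<lambda>n. C n * z ^ n) sums g z"
    and [measurable]: "g \<in> borel_measurable circ"
  shows "fcoeff g k = (if 0 \<le> k then C (nat k) else 0)"
proof -
  define s where "s N z = (\<Sum>k\<in>{0..<int N}. C (nat k) * z powi k)" for N z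
  have s_eq: "s N z = (\<Sum>n<N. C n * z ^ n)" for N z
    unfolding s_def by (rule sum.reindex_bij_witness[of _ int nat]) (auto simp: power_int_def)
  have [measurable]: "s N \<in> borel_measurable circ" for N
    unfolding s_def[abs_def] by measurable
  have "(\<lambda>N. fcoeff (s N) k) \<longlonglongrightarrow> fcoeff g k"
    unfolding fcoeff_eq[OF \<open>g \<in> borel_measurable circ\<close>] fcoeff_eq[OF \<open>s _ \<in> borel_measurable circ\<close>]
  proof (rule integral_dominated_convergence[where w="\<lambda>_. suminf (\<lambda>n. cmod (C n))"])
    show "AE z in circ. (\<lambda>N. s N z * z powi (-k)) \<longlonglongrightarrow> g z * z powi (-k)"
      using AE_circ_cmod
    proof eventually_elim
      case (elim z)
      then show ?case using g[OF elim] by (intro tendsto_intros) (simp add: s_eq sums_def)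
    qed
    show "AE z in circ. norm (s N z * z powi (-k)) \<le> suminf (\<lambda>n. cmod (C n))" for N
      using AE_circ_cmod
    proof eventually_elim
      case (elim z)
      have "cmod (s N z) \<le> (\<Sum>n<N. cmod (C n * z ^ n))" unfolding s_eq by (rule norm_sum)
      also have "\<dots> = (\<Sum>n<N. cmod (C n))" using elim by (simp add: norm_mult norm_power)
      also have "\<dots> \<le> suminf (\<lambda>n. cmod (C n))" by (rule sum_le_suminf[OF C]) auto
      finally show ?case using elim by (simp add: norm_mult norm_power_int)
    qed
  qed auto
  moreover have "fcoeff (s N) k = (if 0 \<le> k then C (nat k) else 0)" if "N > nat k" for N
    unfolding s_def[abs_def] using that by (subst fcoeff_trig) auto
  then have "(\<lambda>N. fcoeff (s N) k) \<longlonglongrightarrow> (if 0 \<le> k then C (nat k) else 0)"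
    by (intro tendsto_eventually eventually_sequentiallyI[of "Suc (nat k)"]) auto
  ultimately show ?thesis by (rule LIMSEQ_unique)
qed

lemma fcoeff_dilate:
  assumes g: "g holomorphic_on ball 0 1" and r: "0 \<le> r" "r < 1"
  shows "fcoeff (\<lambda>z. g (of_real r * z)) k = (if 0 \<le> k then (deriv ^^ nat k) g 0 / fact (nat k) * of_real r ^ nat k else 0)"
    and "(\<lambda>z. g (of_real r * z)) \<in> borel_measurable circ"
proof -
  define c where "c n = (deriv ^^ n) g 0 / fact n" for n
  have sums: "(\<lambda>n. c n * w ^ n) sums g w" if "cmod w < 1" for w
    using holomorphic_power_series[OF g, of w] that by (simp add: c_def)
  have "continuous_on (sphere 0 1) (\<lambda>z. g (of_real r * z))"
    using r by (intro continuous_on_compose2[OF holomorphic_on_imp_continuous_on[OF g]] continuous_intros)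
      (auto simp: norm_mult)
  then show m: "(\<lambda>z. g (of_real r * z)) \<in> borel_measurable circ"
    by (rule borel_measurable_circ_continuous)
  obtain R where R: "r < R" "R < 1" using dense[OF r(2)] by blast
  have "summable (\<lambda>n. c n * of_real R ^ n)"
    using sums[of "of_real R"] R r by (auto simp: sums_iff)
  then have "summable (\<lambda>n. cmod (c n * of_real r ^ n))"
    by (rule powser_insidea) (use R r in auto)
  then have "fcoeff (\<lambda>z. g (of_real r * z)) k = (if 0 \<le> k then c (nat k) * of_real r ^ nat k else 0)"
  proof (rule fcoeff_power_series[OF _ _ m])
    show "(\<lambda>n. c n * of_real r ^ n * z ^ n) sums g (of_real r * z)" if "cmod z = 1" for z
      using sums[of "of_real r * z"] that r by (simp add: norm_mult power_mult_distrib mult.assoc)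
  qed
  then show "fcoeff (\<lambda>z. g (of_real r * z)) k = (if 0 \<le> k then (deriv ^^ nat k) g 0 / fact (nat k) * of_real r ^ nat k else 0)"
    by (simp add: c_def)
qed

lemma H2ext_sums:
  assumes "H2 f" "cmod w < 1"
  shows "(\<lambda>n. fcoeff f (int n) * w ^ n) sums H2ext f w"
proof -
  have "summable (\<lambda>n. fcoeff f (int n) * w ^ n)"
  proof (rule summable_comparison_test'[where N=0])
    show "summable (\<lambda>n. l2norm circ f * cmod w ^ n)"
      using assms(2) by (intro summable_mult summable_geometric) auto
    show "norm (fcoeff f (int n) * w ^ n) \<le> l2norm circ f * cmod w ^ n" for n
      using cmod_fcoeff_le_l2norm[of f "int n"] assms(1)
      by (auto simp: norm_mult norm_power H2_iff intro: mult_right_mono)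
  qed
  then show ?thesis by (simp add: H2ext_def summable_sums)
qed

lemma H2ext_holomorphic: "H2 f \<Longrightarrow> H2ext f holomorphic_on ball 0 1"
  by (rule power_series_holomorphic[where a="\<lambda>n. fcoeff f (int n)"]) (auto intro: H2ext_sums)

text \<open>For negative \<open>k\<close> the exponent \<open>nat k\<close> is 0, but then both
  sides vanish because \<open>f\<close> is in H^2.\<close>

lemma fcoeff_H2ext_dilate:
  assumes f: "H2 f" and r: "0 \<le> r" "r < 1"
  shows "fcoeff (\<lambda>z. H2ext f (of_real r * z)) k = of_real (r ^ nat k) * fcoeff f k"
proof -
  have "summable (\<lambda>n. cmod (fcoeff f (int n) * of_real r ^ n))"
  proof -
    obtain R where R: "r < R" "R < 1" using dense[OF r(2)] by blast
    have "summable (\<lambda>n. fcoeff f (int n) * of_real R ^ n)"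
      using H2ext_sums[OF f, of "of_real R"] R r by (auto simp: sums_iff)
    then show ?thesis by (rule powser_insidea) (use R r in auto)
  qed
  then have "fcoeff (\<lambda>z. H2ext f (of_real r * z)) k = (if 0 \<le> k then fcoeff f (int (nat k)) * of_real r ^ nat k else 0)"
  proof (rule fcoeff_power_series[OF _ _ fcoeff_dilate(2)[OF H2ext_holomorphic[OF f] r]])
    show "(\<lambda>n. fcoeff f (int n) * of_real r ^ n * z ^ n) sums H2ext f (of_real r * z)" if "cmod z = 1" for z
      using H2ext_sums[OF f, of "of_real r * z"] that r by (simp add: norm_mult power_mult_distrib mult.assoc)
  qed
  then show ?thesis using f by (auto simp: H2_iff)
qed

lemma sq_integrable_dilate:
  assumes g: "g holomorphic_on ball 0 1" and r: "0 \<le> r" "r < 1"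
  shows "sq_integrable circ (\<lambda>z. g (of_real r * z))"
proof -
  have "continuous_on (cball 0 r) g"
    using r by (intro continuous_on_subset[OF holomorphic_on_imp_continuous_on[OF g]]) auto
  from compact_imp_bounded[OF compact_continuous_image[OF this compact_cball]]
  obtain B where "\<And>w. w \<in> cball 0 r \<Longrightarrow> cmod (g w) \<le> B" unfolding bounded_iff by blast
  then have B: "cmod (g w) \<le> B" if "cmod w \<le> r" for w using that by simp
  show ?thesis
  proof (rule circ.sq_integrable_bounded[OF fcoeff_dilate(2)[OF g r]])
    show "AE z in circ. cmod (g (of_real r * z)) \<le> B"
      using AE_circ_cmod by eventually_elim (use r in \<open>auto intro!: B simp: norm_mult\<close>)
  qed
qed

text \<open>This stands in for radial boundary limits. On the tail the factors
  \<open>r n ^ nat k - 1\<close> have modulus at most 1, so the error there is bounded by the tail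
  of \<open>f\<close> uniformly in \<open>n\<close>; on the finitely many remaining frequencies it
  tends to 0.\<close>

lemma H2ext_dilate_limit:
  assumes f: "H2 f"
  shows "(\<lambda>n. l2norm circ (\<lambda>z. H2ext f (of_real (1 - 1 / real (Suc n)) * z) - f z)) \<longlonglongrightarrow> 0"
proof (rule LIMSEQ_I)
  fix e :: real assume e: "e > 0"
  define r where "r n = 1 - 1 / real (Suc n)" for n
  have r: "0 \<le> r n" "r n < 1" for n by (auto simp: r_def)
  have r1: "r \<longlonglongrightarrow> 1" using tendsto_diff[OF tendsto_const[of 1] LIMSEQ_inverse_real_of_nat] by (simp add: r_def[abs_def] inverse_eq_divide)
  have sf: "sq_integrable circ f" using f by (rule H2_sq_integrable)
  have sd: "sq_integrable circ (\<lambda>z. H2ext f (of_real (r n) * z))" for n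
    by (intro sq_integrable_dilate H2ext_holomorphic f r)
  obtain N where N: "l2norm circ (\<lambda>z. f z - (\<Sum>k\<in>{- int N..int N}. fcoeff f k * z powi k)) < e / 2"
    using LIMSEQ_D[OF fourier_l2_limit[OF sf], of "e/2"] e by auto
  define I where "I = {- int N..int N}"
  define T where "T n z = (\<Sum>k\<in>I. (of_real (r n ^ nat k) - 1) * fcoeff f k * z powi k)" for n z
  define u where "u z = f z - (\<Sum>k\<in>I. fcoeff f k * z powi k)" for z
  have su: "sq_integrable circ u" unfolding u_def by (intro sq_integrable_diff sf sq_integrable_trig)
  have sT: "sq_integrable circ (T n)" for n unfolding T_def[abs_def] by (rule sq_integrable_trig)
  have fu: "fcoeff u k = (if k \<in> I then 0 else fcoeff f k)" for k
    unfolding u_def by (subst sq_fcoeff_diff[OF sf sq_integrable_trig]) (auto simp: fcoeff_trig I_def)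
  have fT: "fcoeff (T n) k = (if k \<in> I then (of_real (r n ^ nat k) - 1) * fcoeff f k else 0)" for n k
    unfolding T_def[abs_def] by (rule fcoeff_trig) (simp add: I_def)
  have "(\<lambda>n. \<Sum>k\<in>I. (cmod ((of_real (r n ^ nat k) - 1) * fcoeff f k))\<^sup>2) \<longlonglongrightarrow> (\<Sum>k\<in>I. (cmod ((of_real (1 ^ nat k) - 1) * fcoeff f k))\<^sup>2)"
    by (intro tendsto_intros r1)
  then have "(\<lambda>n. (l2norm circ (T n))\<^sup>2) \<longlonglongrightarrow> 0"
    unfolding T_def by (subst l2norm_trig) (auto simp: I_def)
  then obtain M where M: "\<And>n. n \<ge> M \<Longrightarrow> (l2norm circ (T n))\<^sup>2 < (e/2)\<^sup>2"
    using LIMSEQ_D[of "\<lambda>n. (l2norm circ (T n))\<^sup>2" 0 "(e/2)\<^sup>2"] e by auto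
  have "l2norm circ (\<lambda>z. H2ext f (of_real (r n) * z) - f z) < e" if "n \<ge> M" for n
  proof -
    have sdf: "sq_integrable circ (\<lambda>z. H2ext f (of_real (r n) * z) - f z)" by (intro sq_integrable_diff sd sf)
    have "l2norm circ (\<lambda>z. (H2ext f (of_real (r n) * z) - f z) - T n z) \<le> l2norm circ u"
    proof (rule l2norm_mono_fcoeff[OF sq_integrable_diff[OF sdf sT] su])
      fix k
      have 1: "fcoeff (\<lambda>z. (H2ext f (of_real (r n) * z) - f z) - T n z) k
        = (of_real (r n ^ nat k) - 1) * fcoeff f k - fcoeff (T n) k"
        by (simp only: sq_fcoeff_diff[OF sdf sT] sq_fcoeff_diff[OF sd sf] fcoeff_H2ext_dilate[OF f r])
           (simp add: algebra_simps)
      have "cmod (of_real (r n ^ nat k) - 1) \<le> 1"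
      proof -
        have "complex_of_real (r n ^ nat k) - 1 = of_real (r n ^ nat k - 1)" by simp
        then have "cmod (of_real (r n ^ nat k) - 1) = \<bar>r n ^ nat k - 1\<bar>" by (simp only: norm_of_real real_norm_def)
        then show ?thesis using r[of n] power_le_one[of "r n" "nat k"] zero_le_power[of "r n" "nat k"] by linarith
      qed
      then have "cmod ((of_real (r n ^ nat k) - 1) * fcoeff f k) \<le> cmod (fcoeff f k)"
        by (simp add: norm_mult mult_left_le_one_le)
      then show "cmod (fcoeff (\<lambda>z. (H2ext f (of_real (r n) * z) - f z) - T n z) k) \<le> cmod (fcoeff u k)"
        unfolding 1 fu fT by simp
    qed
    moreover have "l2norm circ u < e/2" using N by (simp only: u_def[abs_def] I_def)
    moreover have "l2norm circ (T n) < e/2"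
      using M[OF that] e by (intro power2_less_imp_less[of _ "e/2"]) auto
    moreover have "l2norm circ (\<lambda>z. H2ext f (of_real (r n) * z) - f z)
        \<le> l2norm circ (\<lambda>z. (H2ext f (of_real (r n) * z) - f z) - T n z) + l2norm circ (T n)"
      using l2norm_triangle[OF sq_integrable_diff[OF sdf sT] sT, of n n] by simp
    ultimately show ?thesis by linarith
  qed
  then show "\<exists>no. \<forall>n\<ge>no. norm (l2norm circ (\<lambda>z. H2ext f (of_real (1 - 1 / real (Suc n)) * z) - f z) - 0) < e"
    unfolding r_def by (intro exI[of _ M]) auto
qed

text \<open>The reciprocal of the extension is holomorphic on the disc, so its dilates have no
  negative coefficients. Passing to the boundary in L^2 preserves this, since taking reciprocals is
  Lipschitz where the modulus is at least \<open>c\<close>.\<close>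

lemma H2_inverse:
  assumes f: "H2 f" and c: "0 < c" and lower: "\<And>w. cmod w < 1 \<Longrightarrow> c \<le> cmod (H2ext f w)"
  shows "AE z in circ. c \<le> cmod (f z)" and "H2 (\<lambda>z. 1 / f z)"
proof -
  define r where "r n = 1 - 1 / real (Suc n)" for n
  have r: "0 \<le> r n" "r n < 1" for n by (auto simp: r_def)
  define fr where "fr n z = H2ext f (of_real (r n) * z)" for n z
  have hol: "H2ext f holomorphic_on ball 0 1" using f by (rule H2ext_holomorphic)
  have sf: "sq_integrable circ f" using f by (rule H2_sq_integrable)
  have [measurable]: "f \<in> borel_measurable circ" using f by measurable
  have sfr: "sq_integrable circ (fr n)" for n unfolding fr_def[abs_def] by (intro sq_integrable_dilate hol r)
  have [measurable]: "fr n \<in> borel_measurable circ" for n using sfr[of n] by measurable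
  have sd: "sq_integrable circ (\<lambda>z. fr n z - f z)" for n by (intro sq_integrable_diff sfr sf)
  have lim: "(\<lambda>n. l2norm circ (\<lambda>z. fr n z - f z)) \<longlonglongrightarrow> 0"
    unfolding fr_def r_def by (rule H2ext_dilate_limit[OF f])
  have low: "AE z in circ. c \<le> cmod (fr n z)" for n
    using AE_circ_cmod unfolding fr_def by eventually_elim (use r[of n] in \<open>auto intro!: lower simp: norm_mult\<close>)
  \<comment> \<open>The amount by which \<open>cmod (f z)\<close> falls short of \<open>c\<close>.
    It is at most the distance of \<open>f\<close> from each dilate, so its norm is 0.\<close>
  define \<phi> where "\<phi> z = complex_of_real (max 0 (c - cmod (f z)))" for z
  have [measurable]: "\<phi> \<in> borel_measurable circ" unfolding \<phi>_def[abs_def] by measurable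
  have \<phi>_le: "AE z in circ. cmod (\<phi> z) \<le> cmod (fr n z - f z)" for n
    using low[of n]
  proof eventually_elim
    case (elim z)
    have "cmod (fr n z) - cmod (f z) \<le> cmod (fr n z - f z)" by (rule norm_triangle_ineq2)
    then show ?case using elim by (auto simp: \<phi>_def)
  qed
  have s\<phi>: "sq_integrable circ \<phi>"
    by (rule circ.sq_integrable_bounded[where C=c]) (auto simp: \<phi>_def c less_imp_le)
  have "l2norm circ \<phi> \<le> 0"
    by (rule LIMSEQ_le_const[OF lim]) (use l2norm_mono_AE[OF sd _ \<phi>_le] in auto)
  then have "AE z in circ. \<phi> z = 0" using s\<phi> by (intro l2norm_eq_0_AE) (auto intro: antisym)
  then show lowf: "AE z in circ. c \<le> cmod (f z)" by eventually_elim (auto simp: \<phi>_def max_def split: if_splits)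
  have s1f: "sq_integrable circ (\<lambda>z. 1 / f z)"
  proof (rule circ.sq_integrable_bounded[where C="1/c"])
    show "AE z in circ. cmod (1 / f z) \<le> 1 / c"
      using lowf by eventually_elim (use c in \<open>auto simp: norm_divide intro!: divide_left_mono mult_pos_pos\<close>)
  qed measurable
  show "H2 (\<lambda>z. 1 / f z)"
  proof (rule H2_limit[OF _ s1f])
    fix n
    have nz: "H2ext f w \<noteq> 0" if "w \<in> ball 0 1" for w using lower[of w] that c by auto
    have hol': "(\<lambda>w. 1 / H2ext f w) holomorphic_on ball 0 1" by (intro holomorphic_intros hol nz)
    show "H2 (\<lambda>z. 1 / fr n z)"
      unfolding fr_def using sq_integrable_dilate[OF hol' r, of n] fcoeff_dilate(1)[OF hol' r, of n]
      by (simp add: H2_iff)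
  next
    have "l2norm circ (\<lambda>z. 1 / fr n z - 1 / f z) \<le> l2norm circ (\<lambda>z. of_real (1 / c\<^sup>2) * (fr n z - f z))" for n
    proof (rule l2norm_mono_AE[OF sq_integrable_cmult[OF sd]])
      show "AE z in circ. cmod (1 / fr n z - 1 / f z) \<le> cmod (of_real (1 / c\<^sup>2) * (fr n z - f z))"
        using low[of n] lowf
      proof eventually_elim
        case (elim z)
        then have nz: "fr n z \<noteq> 0" "f z \<noteq> 0" using c by auto
        have "1 / fr n z - 1 / f z = (f z - fr n z) / (fr n z * f z)" using nz by (simp add: field_simps)
        then have "cmod (1 / fr n z - 1 / f z) = cmod (fr n z - f z) / (cmod (fr n z) * cmod (f z))"
          by (simp add: norm_divide norm_mult norm_minus_commute)
        also have "\<dots> \<le> cmod (fr n z - f z) / (c * c)"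
          using elim c by (intro divide_left_mono mult_mono mult_pos_pos) auto
        finally show ?case using c by (simp add: norm_mult power2_eq_square norm_divide)
      qed
    qed measurable
    then have "l2norm circ (\<lambda>z. 1 / fr n z - 1 / f z) \<le> (1 / c\<^sup>2) * l2norm circ (\<lambda>z. fr n z - f z)" for n
      by (subst (asm) l2norm_cmult) (simp add: norm_divide norm_power)
    then show "(\<lambda>n. l2norm circ (\<lambda>z. 1 / fr n z - 1 / f z)) \<longlonglongrightarrow> 0"
      by (intro tendsto_sandwich[OF _ _ tendsto_const tendsto_mult_right_zero[OF lim, of "1 / c\<^sup>2"]]) auto
  qed
qed

section \<open>The linear system behind the factorization\<close>

lemma ae_filter_circ: "ae_filter circ \<noteq> bot"
  by (simp add: ae_filter_eq_bot_iff emeasure_circ)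

lemma riesz_projection:
  assumes f: "sq_integrable circ f"
  shows "\<exists>g. H2 g \<and> (\<forall>n\<ge>0. fcoeff g n = fcoeff f n)"
proof -
  have "(\<Sum>k\<in>I. (cmod (if 0 \<le> k then fcoeff f k else 0))\<^sup>2) \<le> (l2norm circ f)\<^sup>2" if "finite I" for I
  proof -
    have "(\<Sum>k\<in>I. (cmod (if 0 \<le> k then fcoeff f k else 0))\<^sup>2) \<le> (\<Sum>k\<in>I. (cmod (fcoeff f k))\<^sup>2)"
      by (intro sum_mono) auto
    also have "\<dots> \<le> (l2norm circ f)\<^sup>2" by (rule bessel[OF that f])
    finally show ?thesis .
  qed
  then obtain g where "sq_integrable circ g" "\<And>k. fcoeff g k = (if 0 \<le> k then fcoeff f k else 0)"
    by (rule riesz_fischer[where c="\<lambda>k. if 0 \<le> k then fcoeff f k else 0"]) blast+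
  then show ?thesis by (intro exI[of _ g]) (auto simp: H2_iff)
qed

text \<open>Projection onto the nonnegative frequencies; the representative is chosen arbitrarily,
  since Fourier coefficients determine it only almost everywhere.\<close>

definition rproj :: "(complex \<Rightarrow> complex) \<Rightarrow> complex \<Rightarrow> complex" where
  "rproj f = (SOME g. H2 g \<and> (\<forall>n\<ge>0. fcoeff g n = fcoeff f n))"

lemma rproj:
  assumes "sq_integrable circ f"
  shows "H2 (rproj f)" "n \<ge> 0 \<Longrightarrow> fcoeff (rproj f) n = fcoeff f n"
  using someI_ex[OF riesz_projection[OF assms]] by (auto simp: rproj_def)

text \<open>\<open>A\<close> and \<open>B\<close> stand for the star of a_+ and for b_+, and the two
  coefficient conditions are the projected equations. The constant \<open>k\<close> stays free
  because the normalisation |A|^2 + |B|^2 = 1 is not linear; for a factorization it is the quotient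
  of the values of a_- and a at infinity.\<close>

definition rh_system :: "(complex \<Rightarrow> complex) \<Rightarrow> complex \<Rightarrow> (complex \<Rightarrow> complex) \<Rightarrow> (complex \<Rightarrow> complex) \<Rightarrow> bool" where
  "rh_system w k A B \<longleftrightarrow> H2 A \<and> H2 B \<and>
     (\<forall>n\<ge>0. fcoeff (\<lambda>z. w z * cnj (A z)) n = fcoeff B n) \<and>
     (\<forall>n\<ge>0. fcoeff (\<lambda>z. w z * cnj (B z)) n + fcoeff A n = (if n = 0 then k else 0))"

locale contractive_symbol =
  fixes w :: "complex \<Rightarrow> complex" and q :: real
  assumes w_meas [measurable]: "w \<in> borel_measurable circ"
    and w_le: "AE z in circ. cmod (w z) \<le> q" and q: "0 \<le> q" "q < 1"
begin

lemma sq_w_cnj: "sq_integrable circ f \<Longrightarrow> sq_integrable circ (\<lambda>z. w z * cnj (f z))"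
  by (rule sq_integrable_bounded_mult[OF sq_integrable_cnj w_meas w_le])

lemma l2norm_w_cnj: "sq_integrable circ f \<Longrightarrow> l2norm circ (\<lambda>z. w z * cnj (f z)) \<le> q * l2norm circ f"
  using l2norm_mult_bound[OF sq_integrable_cnj w_meas w_le q(1), of f] by (simp add: l2norm_cnj)

lemma sq_w_cnj_diff:
  assumes "sq_integrable circ f" "sq_integrable circ g"
  shows "fcoeff (\<lambda>z. w z * cnj (f z)) n - fcoeff (\<lambda>z. w z * cnj (g z)) n = fcoeff (\<lambda>z. w z * cnj (f z - g z)) n"
proof -
  have "fcoeff (\<lambda>z. w z * cnj (f z)) n - fcoeff (\<lambda>z. w z * cnj (g z)) n
      = fcoeff (\<lambda>z. w z * cnj (f z) - w z * cnj (g z)) n"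
    by (intro sq_fcoeff_diff[symmetric] sq_w_cnj assms)
  then show ?thesis by (simp add: right_diff_distrib)
qed

text \<open>Projection does not increase norms, so the homogeneous equations give ||B|| <= q ||A||
  and ||A|| <= q ||B||, and \<open>q < 1\<close> forces both norms to be 0.\<close>

lemma rh_system_zero:
  assumes "rh_system w 0 A B" shows "AE z in circ. A z = 0 \<and> B z = 0"
proof -
  have A: "H2 A" "sq_integrable circ A" and B: "H2 B" "sq_integrable circ B"
    using assms by (auto simp: rh_system_def H2_iff)
  have "l2norm circ B \<le> l2norm circ (\<lambda>z. w z * cnj (A z))"
  proof (rule l2norm_mono_fcoeff[OF B(2) sq_w_cnj[OF A(2)]])
    show "cmod (fcoeff B k) \<le> cmod (fcoeff (\<lambda>z. w z * cnj (A z)) k)" for k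
      using assms B(1) by (cases "k < 0") (auto simp: rh_system_def H2_iff)
  qed
  then have 1: "l2norm circ B \<le> q * l2norm circ A" using l2norm_w_cnj[OF A(2)] by linarith
  have "l2norm circ A \<le> l2norm circ (\<lambda>z. w z * cnj (B z))"
  proof (rule l2norm_mono_fcoeff[OF A(2) sq_w_cnj[OF B(2)]])
    show "cmod (fcoeff A k) \<le> cmod (fcoeff (\<lambda>z. w z * cnj (B z)) k)" for k
    proof (cases "k < 0")
      case False
      then have "fcoeff (\<lambda>z. w z * cnj (B z)) k + fcoeff A k = 0" using assms by (simp add: rh_system_def)
      then have "fcoeff A k = - fcoeff (\<lambda>z. w z * cnj (B z)) k" by (simp add: eq_neg_iff_add_eq_0 add.commute)
      then show ?thesis by simp
    qed (use A(1) in \<open>simp add: H2_iff\<close>)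
  qed
  then have 2: "l2norm circ A \<le> q * l2norm circ B" using l2norm_w_cnj[OF B(2)] by linarith
  have "l2norm circ A \<le> q * (q * l2norm circ A)"
    using 2 mult_left_mono[OF 1 q(1)] by linarith
  moreover have "q * (q * l2norm circ A) \<le> q * l2norm circ A"
    using q by (intro mult_left_mono mult_left_le_one_le) auto
  ultimately have "(1 - q) * l2norm circ A \<le> 0" by (simp add: algebra_simps)
  then have "l2norm circ A = 0" using q by (simp add: mult_le_0_iff antisym)
  moreover from this have "l2norm circ B = 0" using 1 by (simp add: antisym)
  ultimately have "AE z in circ. A z = 0" "AE z in circ. B z = 0"
    using A B by (auto intro: l2norm_eq_0_AE)
  then show ?thesis by eventually_elim simp
qed

text \<open>Only real multipliers are admissible: the equations are antilinear, and real scalars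
  pass through \<open>cnj\<close>.\<close>

lemma rh_system_lincomb:
  assumes 1: "rh_system w k A B" and 2: "rh_system w k' A' B'"
  shows "rh_system w (of_real x * k - of_real y * k')
     (\<lambda>z. of_real x * A z - of_real y * A' z) (\<lambda>z. of_real x * B z - of_real y * B' z)"
proof -
  have H: "H2 A" "H2 B" "H2 A'" "H2 B'" using assms by (auto simp: rh_system_def)
  note S = H[THEN H2_sq_integrable]
  have lin: "fcoeff (\<lambda>z. of_real x * f z - of_real y * g z) n = of_real x * fcoeff f n - of_real y * fcoeff g n"
    if "sq_integrable circ f" "sq_integrable circ g" for f g n
    using that by (simp add: sq_fcoeff_diff sq_integrable_cmult sq_fcoeff_cmult)
  have wlin: "fcoeff (\<lambda>z. w z * cnj (of_real x * f z - of_real y * g z)) n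
     = of_real x * fcoeff (\<lambda>z. w z * cnj (f z)) n - of_real y * fcoeff (\<lambda>z. w z * cnj (g z)) n"
    if "sq_integrable circ f" "sq_integrable circ g" for f g n
  proof -
    have "(\<lambda>z. w z * cnj (of_real x * f z - of_real y * g z)) = (\<lambda>z. of_real x * (w z * cnj (f z)) - of_real y * (w z * cnj (g z)))"
      by (auto simp: algebra_simps)
    then show ?thesis using lin[OF sq_w_cnj sq_w_cnj] that by simp
  qed
  show ?thesis
    unfolding rh_system_def
  proof (intro conjI allI impI)
    fix n :: int assume n: "0 \<le> n"
    show "fcoeff (\<lambda>z. w z * cnj (of_real x * A z - of_real y * A' z)) n = fcoeff (\<lambda>z. of_real x * B z - of_real y * B' z) n"
      using assms n by (simp only: wlin lin S rh_system_def)
    have "fcoeff (\<lambda>z. w z * cnj (of_real x * B z - of_real y * B' z)) n + fcoeff (\<lambda>z. of_real x * A z - of_real y * A' z) n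
      = of_real x * (fcoeff (\<lambda>z. w z * cnj (B z)) n + fcoeff A n) - of_real y * (fcoeff (\<lambda>z. w z * cnj (B' z)) n + fcoeff A' n)"
      by (simp only: wlin lin S) (simp add: algebra_simps)
    also have "\<dots> = (if n = 0 then of_real x * k - of_real y * k' else 0)"
      using assms n by (simp add: rh_system_def)
    finally show "fcoeff (\<lambda>z. w z * cnj (of_real x * B z - of_real y * B' z)) n + fcoeff (\<lambda>z. of_real x * A z - of_real y * A' z) n
      = (if n = 0 then of_real x * k - of_real y * k' else 0)" .
  qed (intro H2_diff H2_cmult H)+
qed

text \<open>Eliminating \<open>B\<close> turns the system into \<open>A + H (H A) = 1\<close> for the antilinear Hankel
  operator \<open>H f = P\<^sub>+ (w f\<^sup>*)\<close>, a contraction; it is solved by a Neumann series.\<close>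

definition hankel :: "(complex \<Rightarrow> complex) \<Rightarrow> complex \<Rightarrow> complex" where
  "hankel f = rproj (\<lambda>z. w z * cnj (f z))"

lemma hankel_H2: "sq_integrable circ f \<Longrightarrow> H2 (hankel f)"
  by (simp add: hankel_def rproj sq_w_cnj)

lemma hankel_sq: "sq_integrable circ f \<Longrightarrow> sq_integrable circ (hankel f)"
  by (simp add: hankel_H2 H2_sq_integrable)

lemma fcoeff_hankel: "sq_integrable circ f \<Longrightarrow> n \<ge> 0 \<Longrightarrow> fcoeff (hankel f) n = fcoeff (\<lambda>z. w z * cnj (f z)) n"
  by (simp add: hankel_def rproj sq_w_cnj)

lemma hankel_diff_le:
  assumes f: "sq_integrable circ f" and g: "sq_integrable circ g"
  shows "l2norm circ (\<lambda>z. hankel f z - hankel g z) \<le> q * l2norm circ (\<lambda>z. f z - g z)"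
proof -
  have d: "sq_integrable circ (\<lambda>z. f z - g z)" by (intro sq_integrable_diff f g)
  have "l2norm circ (\<lambda>z. hankel f z - hankel g z) \<le> l2norm circ (\<lambda>z. w z * cnj (f z - g z))"
  proof (rule l2norm_mono_fcoeff[OF sq_integrable_diff[OF hankel_sq[OF f] hankel_sq[OF g]] sq_w_cnj[OF d]])
    fix k
    show "cmod (fcoeff (\<lambda>z. hankel f z - hankel g z) k) \<le> cmod (fcoeff (\<lambda>z. w z * cnj (f z - g z)) k)"
    proof (cases "k < 0")
      case True
      then show ?thesis using hankel_H2[OF f] hankel_H2[OF g] by (simp add: sq_fcoeff_diff H2_iff)
    next
      case False
      then show ?thesis
        using f g by (simp add: sq_fcoeff_diff hankel_sq fcoeff_hankel sq_w_cnj_diff del: complex_cnj_diff)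
    qed
  qed
  also have "\<dots> \<le> q * l2norm circ (\<lambda>z. f z - g z)" by (rule l2norm_w_cnj[OF d])
  finally show ?thesis .
qed

lemma rh_system_exists: "\<exists>A B. rh_system w 1 A B"
proof -
  define step where "step f = (\<lambda>z. 1 - hankel (hankel f) z)" for f
  have step_H2: "H2 (step f)" if "sq_integrable circ f" for f
    unfolding step_def using that by (intro H2_diff H2_const hankel_H2 hankel_sq)
  note step_sq = H2_sq_integrable[OF step_H2]
  have contr: "l2norm circ (\<lambda>z. step f z - step g z) \<le> q * l2norm circ (\<lambda>z. f z - g z)"
    if f: "sq_integrable circ f" and g: "sq_integrable circ g" for f g
  proof -
    have "l2norm circ (\<lambda>z. step f z - step g z) = l2norm circ (\<lambda>z. hankel (hankel f) z - hankel (hankel g) z)"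
      unfolding step_def using l2norm_minus_commute[of circ "hankel (hankel g)" "hankel (hankel f)"] by simp
    also have "\<dots> \<le> q * l2norm circ (\<lambda>z. hankel f z - hankel g z)"
      by (intro hankel_diff_le hankel_sq f g)
    \<comment> \<open>Two applications of \<open>hankel\<close> contract by q^2; the weaker factor
      \<open>q\<close> is enough for the iteration.\<close>
    also have "\<dots> \<le> 1 * l2norm circ (\<lambda>z. hankel f z - hankel g z)"
      using q by (intro mult_right_mono) auto
    also have "\<dots> \<le> q * l2norm circ (\<lambda>z. f z - g z)" using hankel_diff_le[OF f g] by simp
    finally show ?thesis .
  qed
  define S where "S n = (step ^^ n) (\<lambda>_. 0)" for n
  have S0: "S 0 = (\<lambda>_. 0)" and SS: "S (Suc n) = step (S n)" for n by (simp_all add: S_def)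
  have S: "H2 (S n)" for n
    by (induction n) (auto simp: S0 SS H2_const intro: step_H2 H2_sq_integrable)
  note Ssq = H2_sq_integrable[OF S]
  \<comment> \<open>The fixed point of \<open>x = q * x + l2norm circ (S 1)\<close>, the recursion
    that bounds the distances from \<open>S 0\<close>, which is the zero function.\<close>
  define R where "R = l2norm circ (S 1) / (1 - q)"
  have R: "l2norm circ (\<lambda>z. S k z - S 0 z) \<le> R" for k
  proof (induction k)
    case 0 then show ?case using q by (simp add: S0 R_def l2norm_def)
  next
    case (Suc k)
    have "l2norm circ (\<lambda>z. S (Suc k) z - S 0 z) \<le> l2norm circ (\<lambda>z. S (Suc k) z - S (Suc 0) z) + l2norm circ (\<lambda>z. S (Suc 0) z - S 0 z)"
      by (intro l2norm_triangle_mid Ssq)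
    also have "l2norm circ (\<lambda>z. S (Suc k) z - S (Suc 0) z) \<le> q * l2norm circ (\<lambda>z. S k z - S 0 z)"
      unfolding SS by (intro contr Ssq)
    also have "\<dots> \<le> q * R" using q Suc by (intro mult_left_mono) auto
    also have "l2norm circ (\<lambda>z. S (Suc 0) z - S 0 z) = (1 - q) * R" using q by (simp add: S0 R_def)
    finally show ?case by (simp add: algebra_simps)
  qed
  have geo: "l2norm circ (\<lambda>z. S (n + k) z - S n z) \<le> q ^ n * R" for n k
  proof (induction n)
    case 0 then show ?case using R[of k] by simp
  next
    case (Suc n)
    have "l2norm circ (\<lambda>z. S (Suc n + k) z - S (Suc n) z) \<le> q * l2norm circ (\<lambda>z. S (n + k) z - S n z)"
      using contr[OF Ssq Ssq, of "n + k" n] by (simp add: SS)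
    also have "\<dots> \<le> q * (q ^ n * R)" using q Suc by (intro mult_left_mono) auto
    finally show ?case by simp
  qed
  have "\<exists>N. \<forall>m\<ge>N. \<forall>n\<ge>N. l2norm circ (\<lambda>z. S m z - S n z) < e" if "e > 0" for e
  proof -
    have "(\<lambda>n. q ^ n * R) \<longlonglongrightarrow> 0" using q by (intro tendsto_mult_left_zero LIMSEQ_realpow_zero) auto
    then have "\<forall>\<^sub>F n in sequentially. q ^ n * R < e / 2" by (rule order_tendstoD) (use \<open>e > 0\<close> in simp)
    then obtain N where N: "q ^ N * R < e / 2"
      by (auto simp: eventually_sequentially)
    have "l2norm circ (\<lambda>z. S m z - S n z) < e" if "m \<ge> N" "n \<ge> N" for m n
    proof -
      have "l2norm circ (\<lambda>z. S m z - S n z) \<le> l2norm circ (\<lambda>z. S m z - S N z) + l2norm circ (\<lambda>z. S N z - S n z)"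
        by (intro l2norm_triangle_mid Ssq)
      also have "l2norm circ (\<lambda>z. S N z - S n z) = l2norm circ (\<lambda>z. S n z - S N z)" by (rule l2norm_minus_commute)
      finally show ?thesis using geo[of N "m - N"] geo[of N "n - N"] that N by simp
    qed
    then show ?thesis by blast
  qed
  from circ.l2_complete[OF Ssq this] obtain A where A: "sq_integrable circ A" "(\<lambda>n. l2norm circ (\<lambda>z. S n z - A z)) \<longlonglongrightarrow> 0"
    by blast
  have HA: "H2 A" using H2_limit[OF S A] .
  define B where "B = hankel A"
  have sB: "sq_integrable circ B" unfolding B_def by (rule hankel_sq[OF A(1)])
  have "fcoeff (\<lambda>z. w z * cnj (B z)) n + fcoeff A n = (if n = 0 then 1 else 0)" if n: "n \<ge> 0" for n
  proof -
    have "(\<lambda>m. l2norm circ (\<lambda>z. step (S m) z - step A z)) \<longlonglongrightarrow> 0"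
      by (rule tendsto_sandwich[OF _ _ tendsto_const tendsto_mult_right_zero[OF A(2), of q]])
         (use contr[OF Ssq A(1)] in auto)
    then have "(\<lambda>m. fcoeff (step (S m)) n) \<longlonglongrightarrow> fcoeff (step A) n"
      by (intro fcoeff_l2_limit step_sq Ssq A(1))
    moreover have "(\<lambda>m. fcoeff (step (S m)) n) \<longlonglongrightarrow> fcoeff A n"
      using LIMSEQ_Suc[OF fcoeff_l2_limit[OF Ssq A, of n]] by (simp add: SS)
    ultimately have "fcoeff A n = fcoeff (step A) n" by (metis LIMSEQ_unique)
    also have "\<dots> = fcoeff (\<lambda>_. 1) n - fcoeff (hankel B) n"
      unfolding step_def B_def
      by (intro sq_fcoeff_diff hankel_sq A(1) H2_sq_integrable[OF H2_const])
    also have "\<dots> = (if n = 0 then 1 else 0) - fcoeff (\<lambda>z. w z * cnj (B z)) n"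
      by (simp only: fcoeff_const fcoeff_hankel[OF sB n])
    finally show ?thesis by simp
  qed
  moreover have "fcoeff (\<lambda>z. w z * cnj (A z)) n = fcoeff B n" if "n \<ge> 0" for n
    unfolding B_def using fcoeff_hankel[OF A(1) that] by simp
  moreover have "H2 B" unfolding B_def by (rule hankel_H2[OF A(1)])
  ultimately have "rh_system w 1 A B" using HA by (simp add: rh_system_def)
  then show ?thesis by blast
qed

text \<open>With \<open>X = A + w B\<^sup>*\<close> and \<open>Y = w A\<^sup>* - B\<close> the function \<open>|A|\<^sup>2 + |B|\<^sup>2 = X\<^sup>* A - Y\<^sup>* B\<close> is real and
  has no negative frequencies, hence it is constant.\<close>

lemma rh_system_star:
  assumes "rh_system w 1 A B"
  defines "X \<equiv> \<lambda>z. A z + w z * cnj (B z)" and "Y \<equiv> \<lambda>z. w z * cnj (A z) - B z"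
  shows "H2 (starT X)" "fcoeff (starT X) 0 = 1" "H2 (starT Y)" "fcoeff (starT Y) 0 = 0"
proof -
  have A: "H2 A" "sq_integrable circ A" and B: "H2 B" "sq_integrable circ B"
    using assms(1) by (auto simp: rh_system_def H2_iff)
  have sX: "sq_integrable circ X" and sY: "sq_integrable circ Y"
    unfolding X_def Y_def by (intro sq_integrable_add sq_integrable_diff sq_w_cnj A B)+
  note m = sq_integrable_measurable[OF sX] sq_integrable_measurable[OF sY]
  have X: "fcoeff X n = (if n = 0 then 1 else 0)" if "n \<ge> 0" for n
    unfolding X_def using assms(1) that
    by (simp add: sq_fcoeff_add[OF A(2) sq_w_cnj[OF B(2)]] rh_system_def add.commute)
  have Y: "fcoeff Y n = 0" if "n \<ge> 0" for n
    unfolding Y_def using assms(1) that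
    by (simp add: sq_fcoeff_diff[OF sq_w_cnj[OF A(2)] B(2)] rh_system_def)
  show "H2 (starT X)" "fcoeff (starT X) 0 = 1" "H2 (starT Y)" "fcoeff (starT Y) 0 = 0"
    using X Y by (auto simp: H2_iff sq_integrable_starT sX sY fcoeff_starT m)
qed

lemma rh_system_modulus:
  assumes "rh_system w 1 A B"
  shows "AE z in circ. complex_of_real ((cmod (A z))\<^sup>2 + (cmod (B z))\<^sup>2) = fcoeff A 0"
proof -
  have A: "H2 A" "sq_integrable circ A" and B: "H2 B" "sq_integrable circ B"
    using assms by (auto simp: rh_system_def H2_iff)
  define X where "X z = A z + w z * cnj (B z)" for z
  define Y where "Y z = w z * cnj (A z) - B z" for z
  note XY = rh_system_star[OF assms, folded X_def[abs_def] Y_def[abs_def]]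
  define G where "G z = complex_of_real ((cmod (A z))\<^sup>2 + (cmod (B z))\<^sup>2)" for z
  have G: "G z = starT X z * A z - starT Y z * B z" for z
    unfolding G_def starT_def X_def Y_def of_real_add complex_norm_square by (simp add: algebra_simps)
  have iX: "integrable circ (\<lambda>z. starT X z * A z)" and iY: "integrable circ (\<lambda>z. starT Y z * B z)"
    by (rule sq_integrable_mult[OF H2_sq_integrable[OF XY(1)] A(2)], rule sq_integrable_mult[OF H2_sq_integrable[OF XY(3)] B(2)])
  have iG: "integrable circ G" unfolding G[abs_def] by (intro Bochner_Integration.integrable_diff iX iY)
  have fG: "fcoeff G n = fcoeff (\<lambda>z. starT X z * A z) n - fcoeff (\<lambda>z. starT Y z * B z) n" for n
    unfolding G[abs_def] by (rule fcoeff_diff[OF iX iY])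
  have neg: "fcoeff G n = 0" if "n < 0" for n
  proof -
    have "fcoeff (\<lambda>z. f z * g z) n = 0" if "H2 f" "H2 g" for f g
      using that \<open>n < 0\<close> by (intro fcoeff_mult_vanish(1)[where i=0 and j=0]) (auto simp: H2_iff)
    then show ?thesis unfolding fG using XY A B by simp
  qed
  have "starT G = G" by (auto simp: starT_def G_def)
  then have refl: "fcoeff G n = cnj (fcoeff G (-n))" for n
    using fcoeff_starT[of G n] iG by (simp add: borel_measurable_integrable)
  have "fcoeff G n = 0" if "n \<noteq> 0" for n
    using neg[of n] neg[of "-n"] refl[of n] that by (cases "n < 0") auto
  \<comment> \<open>\<open>G\<close> is so far only known to be integrable, which is all that
    uniqueness of Fourier coefficients asks for.\<close>
  then have "AE z in circ. G z = fcoeff G 0" by (intro integrable_circ_const iG)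
  moreover have "fcoeff G 0 = fcoeff A 0"
    unfolding fG using fcoeff_mult_0[OF XY(1) A(1)] fcoeff_mult_0[OF XY(3) B(1)] XY by simp
  ultimately show ?thesis by (simp add: G_def)
qed

lemma rh_system_normalisation:
  assumes "rh_system w 1 A B"
  obtains K where "K > 0" "fcoeff A 0 = complex_of_real K" "AE z in circ. (cmod (A z))\<^sup>2 + (cmod (B z))\<^sup>2 = K"
proof -
  have A: "H2 A" "sq_integrable circ A" and B: "H2 B" "sq_integrable circ B"
    using assms by (auto simp: rh_system_def H2_iff)
  note mod = rh_system_modulus[OF assms]
  obtain z0 where z0: "complex_of_real ((cmod (A z0))\<^sup>2 + (cmod (B z0))\<^sup>2) = fcoeff A 0"
    using eventually_happens'[OF ae_filter_circ mod] by blast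
  define K where "K = (cmod (A z0))\<^sup>2 + (cmod (B z0))\<^sup>2"
  have K: "fcoeff A 0 = of_real K" using z0 by (simp add: K_def)
  have ae: "AE z in circ. (cmod (A z))\<^sup>2 + (cmod (B z))\<^sup>2 = K"
    using mod unfolding K by eventually_elim (simp only: of_real_eq_iff)
  have "K \<ge> 0" by (simp add: K_def)
  \<comment> \<open>If \<open>K\<close> were 0, then \<open>B\<close> would vanish and the zeroth
    equation would read \<open>fcoeff A 0 = 1\<close>, against
    \<open>fcoeff A 0 = of_real K\<close>.\<close>
  moreover have "K \<noteq> 0"
  proof
    assume "K = 0"
    have "AE z in circ. B z = 0" using ae by eventually_elim (use \<open>K = 0\<close> in \<open>simp add: add_nonneg_eq_0_iff\<close>)
    then have "AE z in circ. w z * cnj (B z) = 0" by eventually_elim simp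
    then have "fcoeff (\<lambda>z. w z * cnj (B z)) 0 = fcoeff (\<lambda>_. 0) 0"
      using sq_w_cnj[OF B(2)] by (intro fcoeff_cong_AE) (auto simp: sq_integrable_measurable)
    then show False using assms K \<open>K = 0\<close> by (auto simp: rh_system_def fcoeff_const)
  qed
  ultimately show ?thesis using that K ae by force
qed

text \<open>Multiplying each solution by the other's constant and subtracting gives a solution with
  right-hand side 0, so the two solutions are proportional; the common normalisation makes the
  positive constants equal.\<close>

lemma rh_system_scale_unique:
  assumes 1: "rh_system w (of_real k) A B" and 2: "rh_system w (of_real k') A' B'" and k: "k > 0" "k' > 0"
    and n1: "AE z in circ. (cmod (A z))\<^sup>2 + (cmod (B z))\<^sup>2 = 1"
    and n2: "AE z in circ. (cmod (A' z))\<^sup>2 + (cmod (B' z))\<^sup>2 = 1"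
  shows "AE z in circ. A z = A' z \<and> B z = B' z"
proof -
  have "rh_system w 0 (\<lambda>z. of_real k' * A z - of_real k * A' z) (\<lambda>z. of_real k' * B z - of_real k * B' z)"
    using rh_system_lincomb[OF 1 2, of k' k] by (simp add: mult.commute)
  from rh_system_zero[OF this] have ae: "AE z in circ. of_real k' * A z = of_real k * A' z \<and> of_real k' * B z = of_real k * B' z"
    by eventually_elim auto
  have "AE z in circ. k'\<^sup>2 = k\<^sup>2"
    using ae n1 n2
  proof eventually_elim
    case (elim z)
    have "cmod (of_real k' * A z) = k' * cmod (A z)" "cmod (of_real k' * B z) = k' * cmod (B z)"
      "cmod (of_real k * A' z) = k * cmod (A' z)" "cmod (of_real k * B' z) = k * cmod (B' z)"
      using k by (simp_all add: norm_mult)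
    then have "k' * cmod (A z) = k * cmod (A' z)" "k' * cmod (B z) = k * cmod (B' z)" using elim by metis+
    then have "k'\<^sup>2 * ((cmod (A z))\<^sup>2 + (cmod (B z))\<^sup>2) = k\<^sup>2 * ((cmod (A' z))\<^sup>2 + (cmod (B' z))\<^sup>2)"
      by (simp only: distrib_left power_mult_distrib[symmetric])
    then show ?case using elim by simp
  qed
  then have "k'\<^sup>2 = k\<^sup>2" using ae_filter_circ by (simp add: eventually_const_iff)
  then have "k' = k" using k by simp
  show ?thesis using ae by eventually_elim (use k \<open>k' = k\<close> in auto)
qed

end

section \<open>The factorization\<close>

lemma inL_iff: "inL (a, b) \<longleftrightarrow> a \<in> borel_measurable circ \<and> b \<in> borel_measurable circ \<and>
    (AE z in circ. (cmod (a z))\<^sup>2 + (cmod (b z))\<^sup>2 = 1) \<and> H2 (starT a) \<and>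
    (\<exists>k>0. fcoeff (starT a) 0 = complex_of_real k)"
proof -
  have 1: "a z * starT a z + b z * starT b z = 1 \<longleftrightarrow> (cmod (a z))\<^sup>2 + (cmod (b z))\<^sup>2 = 1" for z
  proof -
    have "a z * starT a z + b z * starT b z = complex_of_real ((cmod (a z))\<^sup>2 + (cmod (b z))\<^sup>2)"
      by (simp only: starT_def of_real_add complex_norm_square)
    then show ?thesis by (metis of_real_1 of_real_eq_iff)
  qed
  have 2: "at_inf a \<in> \<real> \<and> Re (at_inf a) > 0 \<longleftrightarrow> (\<exists>k>0. fcoeff (starT a) 0 = complex_of_real k)"
    by (auto simp: at_inf_eq complex_is_Real_iff complex_eq_iff)
  show ?thesis
    by (simp only: inL_def prod.case measT_iff onT_AE_iff 1 H2s_def) (use 2 in blast)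
qed

lemma inL_bounded:
  assumes "inL (a, b)"
  shows "AE z in circ. cmod (a z) \<le> 1" "AE z in circ. cmod (b z) \<le> 1"
proof -
  have ae: "AE z in circ. (cmod (a z))\<^sup>2 + (cmod (b z))\<^sup>2 = 1" using assms by (simp add: inL_iff)
  show "AE z in circ. cmod (a z) \<le> 1"
    using ae
  proof eventually_elim
    case (elim z)
    have "(cmod (a z))\<^sup>2 \<le> 1\<^sup>2"
      unfolding one_power2 using elim zero_le_power2[of "cmod (b z)"] by linarith
    then show ?case by (rule power2_le_imp_le) simp
  qed
  show "AE z in circ. cmod (b z) \<le> 1"
    using ae
  proof eventually_elim
    case (elim z)
    have "(cmod (b z))\<^sup>2 \<le> 1\<^sup>2"
      unfolding one_power2 using elim zero_le_power2[of "cmod (a z)"] by linarith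
    then show ?case by (rule power2_le_imp_le) simp
  qed
qed

lemma inL_sq:
  assumes "inL (a, b)" shows "sq_integrable circ a" "sq_integrable circ b"
  using assms inL_bounded[OF assms] by (auto intro: circ.sq_integrable_bounded simp: inL_iff)

lemma inL_starT_snd: "inL (a, b) \<Longrightarrow> inL (a, starT b)"
  using starT_measurable[of b] by (auto simp: inL_iff starT_def[of b])

text \<open>The reflection \<open>w \<mapsto> 1 / cnj w\<close> carries the punctured disc to the
  exterior, and the point at infinity, listed separately in \<open>inB\<close>, corresponds to
  \<open>w = 0\<close>. Hence the extension of \<open>starT a\<close> is bounded below on the whole
  disc.\<close>

lemma inB_inverse:
  assumes "inB (a, b)"
  obtains c where "0 < c" "1/2 < c\<^sup>2" "AE z in circ. c \<le> cmod (a z)" "H2 (\<lambda>z. 1 / starT a z)"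
proof -
  define S where "S = insert ((cmod (at_inf a))\<^sup>2) ((\<lambda>z. (cmod (H2s_ext a z))\<^sup>2) ` {z. 1 < cmod z})"
  have S: "1/2 < Inf S" using assms by (simp add: inB_def S_def)
  have "bdd_below S" unfolding S_def by (rule bdd_belowI[of _ 0]) auto
  then have low: "Inf S \<le> x" if "x \<in> S" for x using that by (rule cInf_lower[rotated])
  define c where "c = sqrt (Inf S)"
  have c: "0 < c" "c\<^sup>2 = Inf S" using S by (simp_all add: c_def)
  have H: "H2 (starT a)" using assms by (simp add: inB_def inL_iff)
  have "c \<le> cmod (H2ext (starT a) w)" if w: "cmod w < 1" for w
  proof (rule power2_le_imp_le)
    have "(cmod (H2ext (starT a) w))\<^sup>2 \<in> S"
    proof (cases "w = 0")
      case True then show ?thesis by (simp add: S_def at_inf_def)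
    next
      case False
      then have "1 < cmod (1 / cnj w)" using w by (simp add: norm_divide)
      moreover have "cmod (H2ext (starT a) w) = cmod (H2s_ext a (1 / cnj w))" by (simp add: H2s_ext_def)
      ultimately show ?thesis unfolding S_def by (intro insertI2 image_eqI[of _ _ "1 / cnj w"]) auto
    qed
    then show "c\<^sup>2 \<le> (cmod (H2ext (starT a) w))\<^sup>2" using low c by simp
  qed simp
  note inv = H2_inverse[OF H c(1) this]
  have "AE z in circ. c \<le> cmod (a z)" using inv(1) by (simp add: starT_def)
  with inv(2) show ?thesis using that[of c] c S by auto
qed

text \<open>The minus sign is that of the first component of \<open>pmul\<close>. Boundedness of
  \<open>U\<close> and \<open>V\<close> ensures that multiplying H^2 functions by them stays in
  H^2.\<close>

definition bezout :: "(complex \<Rightarrow> complex) \<times> (complex \<Rightarrow> complex) \<Rightarrow> bool" where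
  "bezout p \<longleftrightarrow> (\<exists>U V M. H2 U \<and> H2 V \<and> (AE z in circ. cmod (U z) \<le> M) \<and> (AE z in circ. cmod (V z) \<le> M) \<and>
      (AE z in circ. starT (fst p) z * U z - snd p z * V z = 1))"

text \<open>A common inner divisor \<open>g\<close> of \<open>A = a\<^sup>*\<close> and \<open>B = b\<close> satisfies
  \<open>1 / g = (A / g) U - (B / g) V\<close>, so that \<open>g\<close> and its conjugate both lie in \<open>H\<^sup>2\<close>.\<close>

lemma inH_of_bezout:
  assumes "inHbar p" "bezout p" shows "inH p"
  unfolding inH_def
proof (intro conjI allI impI)
  fix g assume *: "inner g \<and> H2 (\<lambda>z. starT (fst p) z / bdry g z) \<and> H2 (\<lambda>z. snd p z / bdry g z)"
  obtain U V M where U: "H2 U" "AE z in circ. cmod (U z) \<le> M" and V: "H2 V" "AE z in circ. cmod (V z) \<le> M"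
    and UV: "AE z in circ. starT (fst p) z * U z - snd p z * V z = 1"
    using assms(2) by (auto simp: bezout_def)
  have hol: "g holomorphic_on ball 0 1" and bdd: "bounded (g ` ball 0 1)"
    and lim: "AE z in circ. ((\<lambda>r::real. g (of_real r * z)) \<longlongrightarrow> bdry g z) (at_left 1)" "AE z in circ. cmod (bdry g z) = 1"
    using * by (auto simp: inner_def onT_AE_iff)
  obtain K where K: "\<And>z. z \<in> ball 0 1 \<Longrightarrow> cmod (g z) \<le> K"
    using bdd unfolding bounded_iff by blast
  define W where "W z = U z * (starT (fst p) z / bdry g z) - V z * (snd p z / bdry g z)" for z
  have "H2 (\<lambda>z. U z * (starT (fst p) z / bdry g z))"
    using * U by (intro H2_mult sq_integrable_bounded_mult[where C=M]) (auto intro: H2_sq_integrable simp: H2_measurable)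
  moreover have "H2 (\<lambda>z. V z * (snd p z / bdry g z))"
    using * V by (intro H2_mult sq_integrable_bounded_mult[where C=M]) (auto intro: H2_sq_integrable simp: H2_measurable)
  ultimately have W: "H2 W" unfolding W_def[abs_def] by (rule H2_diff)
  have [measurable]: "W \<in> borel_measurable circ" using W by measurable
  have Wg: "AE z in circ. starT W z = bdry g z"
    using UV lim(2)
  proof eventually_elim
    case (elim z)
    have "W z = (starT (fst p) z * U z - snd p z * V z) / bdry g z" by (simp add: W_def diff_divide_distrib mult.commute)
    then have "W z = 1 / bdry g z" using elim by simp
    moreover have "bdry g z * cnj (bdry g z) = 1" using elim by (simp add: complex_norm_square[symmetric])
    ultimately have "W z = cnj (bdry g z)" by (metis divide_eq_eq mult.commute mult_zero_left zero_neq_one)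
    then show ?case by (simp add: starT_def)
  qed
  define r where "r n = 1 - 1 / real (Suc n)" for n
  have r: "0 \<le> r n" "r n < 1" for n by (auto simp: r_def)
  have rl: "r \<longlonglongrightarrow> 1"
    using tendsto_diff[OF tendsto_const[of 1] LIMSEQ_inverse_real_of_nat] by (simp add: r_def[abs_def] inverse_eq_divide)
  have r1: "filterlim r (at_left 1) sequentially"
    unfolding filterlim_at using rl r by (auto intro!: always_eventually simp: less_imp_neq)
  define gr where "gr n z = g (of_real (r n) * z)" for n z
  have [measurable]: "gr n \<in> borel_measurable circ" for n
    unfolding gr_def[abs_def] by (rule fcoeff_dilate(2)[OF hol r])
  \<comment> \<open>Bounded convergence of the dilates of \<open>g\<close> shows that the Fourier
    coefficients of \<open>starT W\<close> are the Taylor coefficients of \<open>g\<close>; those of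
    positive index vanish because \<open>W\<close> has no negative frequencies.\<close>
  have fl: "(\<lambda>n. fcoeff (gr n) k) \<longlonglongrightarrow> fcoeff (starT W) k" for k
    unfolding fcoeff_eq[OF \<open>gr _ \<in> borel_measurable circ\<close>] fcoeff_eq[OF starT_measurable[OF \<open>W \<in> borel_measurable circ\<close>]]
  proof (rule integral_dominated_convergence[where w="\<lambda>_. K"])
    show "AE z in circ. (\<lambda>n. gr n z * z powi (-k)) \<longlonglongrightarrow> starT W z * z powi (-k)"
      using lim(1) Wg
    proof eventually_elim
      case (elim z)
      have "(\<lambda>n. gr n z) \<longlonglongrightarrow> bdry g z"
        unfolding gr_def by (rule filterlim_compose[OF elim(1) r1])
      then show ?case using elim by (auto intro: tendsto_intros)
    qed
    show "AE z in circ. norm (gr n z * z powi (-k)) \<le> K" for n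
      using AE_circ_cmod
    proof eventually_elim
      case (elim z)
      have "cmod (gr n z) \<le> K" unfolding gr_def using elim r[of n] by (intro K) (simp add: norm_mult)
      then show ?case using elim by (simp add: norm_mult norm_power_int)
    qed
  qed auto
  have c0: "(deriv ^^ n) g 0 / fact n = 0" if "n > 0" for n
  proof -
    have "fcoeff (starT W) (int n) = 0"
      using W that fcoeff_starT[of W "int n"] by (simp add: H2_iff)
    moreover have "fcoeff (gr m) (int n) = (deriv ^^ n) g 0 / fact n * of_real (r m) ^ n" for m
      unfolding gr_def using fcoeff_dilate(1)[OF hol r, of m "int n"] by simp
    moreover have "(\<lambda>m. (deriv ^^ n) g 0 / fact n * of_real (r m) ^ n) \<longlonglongrightarrow> (deriv ^^ n) g 0 / fact n * of_real 1 ^ n"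
      by (intro tendsto_intros rl)
    ultimately show ?thesis using fl[of "int n"] LIMSEQ_unique by fastforce
  qed
  have "g w = (deriv ^^ 0) g 0 / fact 0" if "w \<in> ball 0 1" for w
  proof -
    have "(\<lambda>n. (deriv ^^ n) g 0 / fact n * (w - 0) ^ n) sums g w" by (rule holomorphic_power_series[OF hol that])
    moreover have "(\<lambda>n. (deriv ^^ n) g 0 / fact n * (w - 0) ^ n) = (\<lambda>n. if n = 0 then (deriv ^^ 0) g 0 / fact 0 else 0)"
      using c0 by (intro ext) auto
    ultimately show ?thesis using sums_single[of 0 "\<lambda>_. (deriv ^^ 0) g 0 / fact 0"] by (auto intro: sums_unique2)
  qed
  then show "\<exists>c. \<forall>z\<in>ball 0 1. g z = c" by blast
qed (rule assms)

section \<open>The factorization problem for a pair whose first component is invertible\<close>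

locale rh_problem =
  fixes a b :: "complex \<Rightarrow> complex" and c :: real
  assumes ab: "inL (a, b)" and c: "0 < c" "1/2 < c\<^sup>2" and low: "AE z in circ. c \<le> cmod (a z)"
    and inv: "H2 (\<lambda>z. 1 / starT a z)"
begin

definition sym :: "complex \<Rightarrow> complex" where "sym z = b z / a z"

lemma ab_meas [measurable]: "a \<in> borel_measurable circ" "b \<in> borel_measurable circ"
  using ab by (auto simp: inL_iff)

text \<open>The contraction constant is below 1 precisely because \<open>1/2 < c\<^sup>2\<close>;
  \<open>c \<le> 1\<close> serves to make the radicand nonnegative.\<close>

sublocale contractive_symbol sym "sqrt (1 / c\<^sup>2 - 1)"
proof
  show "sym \<in> borel_measurable circ" unfolding sym_def[abs_def] by measurable
  have "c \<le> 1"
  proof -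
    have "AE z in circ. c \<le> 1" using low inL_bounded(1)[OF ab] by eventually_elim linarith
    then show ?thesis using ae_filter_circ by (simp add: eventually_const_iff)
  qed
  then have "c\<^sup>2 \<le> 1" using c by (simp add: power_le_one)
  then have "1 \<le> 1 / c\<^sup>2" using c by simp
  then show "0 \<le> sqrt (1 / c\<^sup>2 - 1)" by simp
  have "1 / c\<^sup>2 < 2" using c by (simp add: field_simps)
  then show "sqrt (1 / c\<^sup>2 - 1) < 1" by simp
  have "AE z in circ. (cmod (a z))\<^sup>2 + (cmod (b z))\<^sup>2 = 1" using ab by (simp add: inL_iff)
  then show "AE z in circ. cmod (sym z) \<le> sqrt (1 / c\<^sup>2 - 1)"
    using low
  proof eventually_elim
    case (elim z)
    have az: "0 < (cmod (a z))\<^sup>2" using elim c by (intro zero_less_power) linarith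
    have "(cmod (sym z))\<^sup>2 = (cmod (b z))\<^sup>2 / (cmod (a z))\<^sup>2" by (simp add: sym_def norm_divide power_divide)
    also have "\<dots> = 1 / (cmod (a z))\<^sup>2 - 1" using elim az by (simp add: field_simps)
    also have "\<dots> \<le> 1 / c\<^sup>2 - 1" using elim c by (intro diff_right_mono divide_left_mono power_mono mult_pos_pos az) auto
    finally show ?case by (rule real_le_rsqrt)
  qed
qed

lemma inv_bounded: "AE z in circ. cmod (1 / starT a z) \<le> 1 / c"
  using low by eventually_elim (use c in \<open>auto simp: starT_def norm_divide intro!: divide_left_mono mult_pos_pos\<close>)

lemma H2_inv_mult:
  assumes "H2 f" shows "H2 (\<lambda>z. 1 / starT a z * f z)"
  by (intro H2_mult inv assms sq_integrable_bounded_mult[OF H2_sq_integrable[OF assms] H2_measurable[OF inv] inv_bounded])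

text \<open>The first claim is the conjugate of the first component of the product. The second
  undoes the right factor, whose inverse on the circle is the pair of \<open>starT ap\<close> and
  \<open>- bp\<close>.\<close>

lemma factorization_star:
  assumes "inL (ap, bp)" "ae_pair (pmul (am, bm) (ap, bp)) (a, b)"
  shows "AE z in circ. starT ap z * starT am z - bp z * starT bm z = starT a z"
    and "AE z in circ. bm z = b z * ap z - a z * bp z \<and> am z = a z * cnj (ap z) + b z * cnj (bp z)"
proof -
  have e: "AE z in circ. am z * ap z - bm z * cnj (bp z) = a z \<and> am z * bp z + bm z * cnj (ap z) = b z"
    using assms(2) by (simp add: ae_pair_def onT_AE_iff pmul_def starT_def)
  then show "AE z in circ. starT ap z * starT am z - bp z * starT bm z = starT a z"
  proof eventually_elim
    case (elim z)
    then have "cnj (a z) = cnj (am z * ap z - bm z * cnj (bp z))" by simp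
    then show ?case by (simp add: starT_def mult.commute)
  qed
  have "AE z in circ. (cmod (ap z))\<^sup>2 + (cmod (bp z))\<^sup>2 = 1" using assms(1) by (simp add: inL_iff)
  then show "AE z in circ. bm z = b z * ap z - a z * bp z \<and> am z = a z * cnj (ap z) + b z * cnj (bp z)"
    using e
  proof eventually_elim
    case (elim z)
    have n: "ap z * cnj (ap z) + bp z * cnj (bp z) = 1"
      using elim(1) by (metis complex_norm_square of_real_1 of_real_add)
    have "b z * ap z - a z * bp z = bm z * (ap z * cnj (ap z) + bp z * cnj (bp z))"
      by (simp flip: elim(2)[THEN conjunct1] elim(2)[THEN conjunct2] add: algebra_simps)
    moreover have "a z * cnj (ap z) + b z * cnj (bp z) = am z * (ap z * cnj (ap z) + bp z * cnj (bp z))"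
      by (simp flip: elim(2)[THEN conjunct1] elim(2)[THEN conjunct2] add: algebra_simps)
    ultimately show ?case by (simp add: n)
  qed
qed

lemma factorization_bezout:
  assumes p: "inL (ap, bp)" "H2 bp" and m: "inL (am, bm)" "H2 (starT bm)"
    and ae: "ae_pair (pmul (am, bm) (ap, bp)) (a, b)"
  shows "bezout (ap, bp)" "bezout (am, starT bm)"
proof -
  have H: "H2 (starT ap)" "H2 (starT am)" using p m by (auto simp: inL_iff)
  have bd: "AE z in circ. cmod (1 / starT a z * f z) \<le> 1 / c" if "AE z in circ. cmod (f z) \<le> 1" for f
    using that inv_bounded
  proof eventually_elim
    case (elim z)
    have "cmod (1 / starT a z * f z) \<le> 1 / c * 1"
      unfolding norm_mult using elim c by (intro mult_mono) auto
    then show ?case by simp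
  qed
  have star: "AE z in circ. cmod (starT f z) \<le> 1" if "AE z in circ. cmod (f z) \<le> 1" for f
    using that by (simp add: starT_def)
  have key: "AE z in circ. starT ap z * (1 / starT a z * starT am z) - bp z * (1 / starT a z * starT bm z) = 1"
    using factorization_star(1)[OF p(1) ae] low
  proof eventually_elim
    case (elim z)
    have "starT a z \<noteq> 0" using elim c by (auto simp: starT_def)
    moreover have "starT ap z * (1 / starT a z * starT am z) - bp z * (1 / starT a z * starT bm z)
       = (starT ap z * starT am z - bp z * starT bm z) / starT a z"
      by (simp add: diff_divide_distrib)
    ultimately show ?case using elim by simp
  qed
  show "bezout (ap, bp)"
    unfolding bezout_def
    using key by (intro exI[of _ "\<lambda>z. 1 / starT a z * starT am z"] exI[of _ "\<lambda>z. 1 / starT a z * starT bm z"] exI[of _ "1/c"]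
        conjI H2_inv_mult H m bd star inL_bounded[OF m(1)]) simp
  have "AE z in circ. starT am z * (1 / starT a z * starT ap z) - starT bm z * (1 / starT a z * bp z) = 1"
    using key by eventually_elim (simp add: mult_ac)
  then show "bezout (am, starT bm)"
    unfolding bezout_def
    by (intro exI[of _ "\<lambda>z. 1 / starT a z * starT ap z"] exI[of _ "\<lambda>z. 1 / starT a z * bp z"] exI[of _ "1/c"]
        conjI H2_inv_mult H p bd star inL_bounded[OF p(1)]) simp
qed

text \<open>\<open>X\<close> and \<open>Y\<close> are the stars of a_-/a and b_-/a. They lie in H^2,
  so these quotients carry no positive frequencies; the constants left over are
  \<open>k2 / k1\<close>, a quotient of values at infinity, and 0.\<close>

lemma factorization_imp_system:
  assumes p: "inL (ap, bp)" "H2 bp" and m: "inL (am, bm)" "H2 (starT bm)" "fcoeff (starT bm) 0 = 0"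
    and ae: "ae_pair (pmul (am, bm) (ap, bp)) (a, b)"
  shows "\<exists>k>0. rh_system sym (of_real k) (starT ap) bp"
proof -
  obtain k1 where k1: "k1 > 0" "fcoeff (starT a) 0 = complex_of_real k1" using ab by (auto simp: inL_iff)
  obtain k2 where k2: "k2 > 0" "fcoeff (starT am) 0 = complex_of_real k2" using m by (auto simp: inL_iff)
  have H: "H2 (starT ap)" "H2 (starT am)" "H2 (starT a)" using p m ab by (auto simp: inL_iff)
  have [measurable]: "am \<in> borel_measurable circ" "bm \<in> borel_measurable circ" "ap \<in> borel_measurable circ" "bp \<in> borel_measurable circ"
    using m p by (auto simp: inL_iff)
  note sq = H2_sq_integrable[OF H(1)] H2_sq_integrable[OF p(2)]
  define X where "X z = 1 / starT a z * starT am z" for z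
  define Y where "Y z = 1 / starT a z * starT bm z" for z
  have HX: "H2 X" "H2 Y" unfolding X_def[abs_def] Y_def[abs_def] by (intro H2_inv_mult H m)+
  have [measurable]: "X \<in> borel_measurable circ" "Y \<in> borel_measurable circ" using HX by measurable
  have nz: "AE z in circ. a z \<noteq> 0" using low by eventually_elim (use c in auto)
  have inv0: "fcoeff (\<lambda>z. 1 / starT a z) 0 = of_real (1 / k1)"
  proof -
    have "fcoeff (\<lambda>z. 1 / starT a z * starT a z) 0 = fcoeff (\<lambda>_. 1) 0"
      using nz by (intro fcoeff_cong_AE) (auto simp: starT_def)
    then have "fcoeff (\<lambda>z. 1 / starT a z) 0 * of_real k1 = 1"
      using fcoeff_mult_0[OF inv H(3)] k1 by (simp add: fcoeff_const)
    then show ?thesis using k1 by (simp add: field_simps)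
  qed
  have X0: "fcoeff X 0 = of_real (k2 / k1)" "fcoeff Y 0 = 0"
    unfolding X_def[abs_def] Y_def[abs_def] using fcoeff_mult_0[OF inv H(2)] fcoeff_mult_0[OF inv m(2)] inv0 k2 m(3)
    by (simp_all add: field_simps)
  have XY: "AE z in circ. sym z * cnj (bp z) + starT ap z = starT X z \<and> sym z * cnj (starT ap z) - bp z = starT Y z"
    using factorization_star(2)[OF p(1) ae] nz
    by eventually_elim (auto simp: X_def Y_def sym_def starT_def field_simps)
  have 1: "fcoeff (\<lambda>z. sym z * cnj (bp z)) n + fcoeff (starT ap) n = (if n = 0 then of_real (k2 / k1) else 0)" if "n \<ge> 0" for n
  proof -
    have "fcoeff (\<lambda>z. sym z * cnj (bp z)) n + fcoeff (starT ap) n = fcoeff (\<lambda>z. sym z * cnj (bp z) + starT ap z) n"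
      by (rule sq_fcoeff_add[symmetric, OF sq_w_cnj[OF sq(2)] sq(1)])
    also have "\<dots> = fcoeff (starT X) n"
      using XY sq_integrable_measurable[OF sq_integrable_add[OF sq_w_cnj[OF sq(2)] sq(1)]] by (intro fcoeff_cong_AE) auto
    also have "\<dots> = cnj (fcoeff X (-n))" by (simp add: fcoeff_starT)
    also have "\<dots> = (if n = 0 then of_real (k2 / k1) else 0)" using X0 HX that by (auto simp: H2_iff)
    finally show ?thesis .
  qed
  have 2: "fcoeff (\<lambda>z. sym z * cnj (starT ap z)) n = fcoeff bp n" if "n \<ge> 0" for n
  proof -
    have "fcoeff (\<lambda>z. sym z * cnj (starT ap z)) n - fcoeff bp n = fcoeff (\<lambda>z. sym z * cnj (starT ap z) - bp z) n"
      by (rule sq_fcoeff_diff[symmetric, OF sq_w_cnj[OF sq(1)] sq(2)])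
    also have "\<dots> = fcoeff (starT Y) n"
      using XY sq_integrable_measurable[OF sq_integrable_diff[OF sq_w_cnj[OF sq(1)] sq(2)]] by (intro fcoeff_cong_AE) auto
    also have "\<dots> = cnj (fcoeff Y (-n))" by (simp add: fcoeff_starT)
    also have "\<dots> = 0" using X0 HX that by (cases "n = 0") (auto simp: H2_iff)
    finally show ?thesis by simp
  qed
  have "rh_system sym (of_real (k2 / k1)) (starT ap) bp"
    using 1 2 H p by (simp add: rh_system_def)
  then show ?thesis using k1 k2 by (intro exI[of _ "k2 / k1"]) simp
qed

text \<open>The system determines the right factor, and the product formula then determines the left
  one. The hypotheses ask for H^2 membership, so the result also covers pairs that arise as limits
  of nonlinear Fourier series.\<close>

lemma factorization_unique:
  assumes p: "inL (ap, bp)" "H2 bp" and m: "inL (am, bm)" "H2 (starT bm)" "fcoeff (starT bm) 0 = 0"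
    and ae: "ae_pair (pmul (am, bm) (ap, bp)) (a, b)"
    and p': "inL (ap', bp')" "H2 bp'" and m': "inL (am', bm')" "H2 (starT bm')" "fcoeff (starT bm') 0 = 0"
    and ae': "ae_pair (pmul (am', bm') (ap', bp')) (a, b)"
  shows "ae_pair (ap, bp) (ap', bp') \<and> ae_pair (am, bm) (am', bm')"
proof -
  obtain k where k: "k > 0" "rh_system sym (of_real k) (starT ap) bp" using factorization_imp_system[OF p m ae] by auto
  obtain k' where k': "k' > 0" "rh_system sym (of_real k') (starT ap') bp'" using factorization_imp_system[OF p' m' ae'] by auto
  have "AE z in circ. (cmod (starT ap z))\<^sup>2 + (cmod (bp z))\<^sup>2 = 1" "AE z in circ. (cmod (starT ap' z))\<^sup>2 + (cmod (bp' z))\<^sup>2 = 1"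
    using p p' by (simp_all add: inL_iff starT_def)
  from rh_system_scale_unique[OF k(2) k'(2) k(1) k'(1) this]
  have pp: "AE z in circ. ap z = ap' z \<and> bp z = bp' z" by eventually_elim (simp add: starT_def)
  then have "AE z in circ. am z = am' z \<and> bm z = bm' z"
    using factorization_star(2)[OF p(1) ae] factorization_star(2)[OF p'(1) ae'] by eventually_elim auto
  with pp show ?thesis by (simp add: ae_pair_def onT_AE_iff)
qed

theorem factorization_exists:
  "\<exists>ap bp am bm. inL (ap, bp) \<and> H2 bp \<and> inL (am, bm) \<and> H2 (starT bm) \<and> fcoeff (starT bm) 0 = 0 \<and>
     ae_pair (pmul (am, bm) (ap, bp)) (a, b)"
proof -
  obtain A B where AB: "rh_system sym 1 A B" using rh_system_exists by blast
  obtain K where K: "K > 0" "fcoeff A 0 = complex_of_real K" "AE z in circ. (cmod (A z))\<^sup>2 + (cmod (B z))\<^sup>2 = K"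
    using rh_system_normalisation[OF AB] .
  define X where "X z = A z + sym z * cnj (B z)" for z
  define Y where "Y z = sym z * cnj (A z) - B z" for z
  note XY = rh_system_star[OF AB, folded X_def[abs_def] Y_def[abs_def]]
  have HA: "H2 A" and HB: "H2 B" using AB by (auto simp: rh_system_def)
  have [measurable]: "A \<in> borel_measurable circ" "B \<in> borel_measurable circ" using HA HB by measurable
  \<comment> \<open>As \<open>fcoeff A 0\<close> equals \<open>K\<close>, this scaling normalises
    the modulus to 1 and leaves the positive constant coefficient \<open>sqrt K\<close>; being real,
    it commutes with the star.\<close>
  define s where "s = complex_of_real (1 / sqrt K)"
  have s: "cnj s = s" "s * s * of_real K = 1" "cmod s = 1 / sqrt K"
    using K by (simp_all add: s_def norm_divide real_sqrt_mult_self flip: of_real_mult)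
  define ap where "ap z = s * cnj (A z)" for z
  define bp where "bp z = s * B z" for z
  \<comment> \<open>Defined through the quotients a_-/a and b_-/a, so that analyticity of their
    stars comes from \<open>rh_system_star\<close>; the fact \<open>form\<close> recovers the
    expressions obtained by inverting the right factor.\<close>
  define am where "am z = a z * (s * X z)" for z
  define bm where "bm z = a z * (s * Y z)" for z
  have Hap: "starT ap = (\<lambda>z. s * A z)" by (auto simp: ap_def starT_def s)
  have "(\<lambda>z. s * cnj (A z)) \<in> borel_measurable circ"
    using starT_measurable[OF \<open>A \<in> borel_measurable circ\<close>] by (simp add: starT_def)
  then have [measurable]: "ap \<in> borel_measurable circ" by (simp add: ap_def[abs_def])
  have [measurable]: "bp \<in> borel_measurable circ" unfolding bp_def[abs_def] by measurable
  have n: "AE z in circ. (cmod (ap z))\<^sup>2 + (cmod (bp z))\<^sup>2 = 1"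
    using K(3)
  proof eventually_elim
    case (elim z)
    have "(cmod (ap z))\<^sup>2 + (cmod (bp z))\<^sup>2 = (1 / sqrt K)\<^sup>2 * ((cmod (A z))\<^sup>2 + (cmod (B z))\<^sup>2)"
      by (simp only: ap_def bp_def norm_mult s(3) complex_mod_cnj power_mult_distrib distrib_left)
    then show ?case using elim K by (simp add: power_divide)
  qed
  have kp: "s * of_real K = of_real (sqrt K)"
    unfolding s_def of_real_mult[symmetric] using K by (simp add: real_div_sqrt)
  have p: "inL (ap, bp)"
    unfolding inL_iff Hap using n HA K kp
    by (auto intro!: H2_cmult exI[of _ "sqrt K"] simp: sq_fcoeff_cmult H2_sq_integrable)
  have Hbp: "H2 bp" unfolding bp_def[abs_def] by (intro H2_cmult HB)
  have Xm [measurable]: "X \<in> borel_measurable circ" "Y \<in> borel_measurable circ"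
    using starT_measurable[OF H2_measurable[OF XY(1)]] starT_measurable[OF H2_measurable[OF XY(3)]] by simp_all
  have [measurable]: "am \<in> borel_measurable circ" "bm \<in> borel_measurable circ"
    unfolding am_def[abs_def] bm_def[abs_def] by measurable
  have nz: "AE z in circ. a z \<noteq> 0" using low by eventually_elim (use c in auto)
  have abn: "AE z in circ. (cmod (a z))\<^sup>2 + (cmod (b z))\<^sup>2 = 1" using ab by (simp add: inL_iff)
  have form: "AE z in circ. am z = a z * cnj (ap z) + b z * cnj (bp z) \<and> bm z = b z * ap z - a z * bp z"
    using nz by eventually_elim (auto simp: am_def bm_def ap_def bp_def X_def Y_def sym_def s field_simps)
  have prod: "AE z in circ. am z * ap z - bm z * cnj (bp z) = a z \<and> am z * bp z + bm z * cnj (ap z) = b z \<and>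
      (cmod (am z))\<^sup>2 + (cmod (bm z))\<^sup>2 = 1"
    using form n abn
  proof eventually_elim
    case (elim z)
    have n: "ap z * cnj (ap z) + bp z * cnj (bp z) = 1" using elim(2) by (metis complex_norm_square of_real_1 of_real_add)
    have ab1: "a z * cnj (a z) + b z * cnj (b z) = 1" using elim(3) by (metis complex_norm_square of_real_1 of_real_add)
    have e: "am z = a z * cnj (ap z) + b z * cnj (bp z)" "bm z = b z * ap z - a z * bp z" using elim(1) by auto
    have "am z * ap z - bm z * cnj (bp z) = a z * (ap z * cnj (ap z) + bp z * cnj (bp z))"
      "am z * bp z + bm z * cnj (ap z) = b z * (ap z * cnj (ap z) + bp z * cnj (bp z))"
      by (simp_all add: e algebra_simps)
    moreover have "am z * cnj (am z) + bm z * cnj (bm z) = (a z * cnj (a z) + b z * cnj (b z)) * (ap z * cnj (ap z) + bp z * cnj (bp z))"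
      by (simp add: e algebra_simps)
    then have "complex_of_real ((cmod (am z))\<^sup>2 + (cmod (bm z))\<^sup>2) = of_real 1"
      by (simp only: of_real_add complex_norm_square n ab1 of_real_1 mult_1)
    ultimately show ?case by (simp only: n mult_1_right of_real_eq_iff simp_thms)
  qed
  have Ha: "H2 (starT a)" using ab by (simp add: inL_iff)
  have sX: "starT am = (\<lambda>z. starT a z * (s * starT X z))" "starT bm = (\<lambda>z. starT a z * (s * starT Y z))"
    by (auto simp: starT_def am_def bm_def s)
  have ba: "AE z in circ. cmod (starT a z) \<le> 1" using inL_bounded(1)[OF ab] by (simp add: starT_def)
  have HsX: "H2 (\<lambda>z. s * starT X z)" "H2 (\<lambda>z. s * starT Y z)" by (intro H2_cmult XY)+
  have Ham: "H2 (starT am)" "H2 (starT bm)"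
    unfolding sX by (intro H2_mult Ha HsX sq_integrable_bounded_mult[OF H2_sq_integrable[OF HsX(1)] H2_measurable[OF Ha] ba]
       sq_integrable_bounded_mult[OF H2_sq_integrable[OF HsX(2)] H2_measurable[OF Ha] ba])+
  obtain k where k: "k > 0" "fcoeff (starT a) 0 = complex_of_real k" using ab by (auto simp: inL_iff)
  have fs: "fcoeff (\<lambda>z. s * starT X z) 0 = s" "fcoeff (\<lambda>z. s * starT Y z) 0 = 0"
    by (simp_all only: sq_fcoeff_cmult[OF H2_sq_integrable[OF XY(1)]] sq_fcoeff_cmult[OF H2_sq_integrable[OF XY(3)]] XY(2,4)
        mult_1_right mult_zero_right)
  have f0: "fcoeff (starT am) 0 = of_real (k / sqrt K)" "fcoeff (starT bm) 0 = 0"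
    unfolding sX fcoeff_mult_0[OF Ha HsX(1)] fcoeff_mult_0[OF Ha HsX(2)] fs
    by (simp_all add: k s_def)
  have m: "inL (am, bm)"
    unfolding inL_iff using prod Ham f0 k K by (auto intro!: exI[of _ "k / sqrt K"])
  have "ae_pair (pmul (am, bm) (ap, bp)) (a, b)"
    unfolding ae_pair_def onT_AE_iff using prod by eventually_elim (simp add: pmul_def starT_def)
  then show ?thesis using p Hbp m Ham f0 by blast
qed

end

section \<open>Finite nonlinear Fourier series\<close>

lemma pmul_assoc: "pmul p (pmul q r) = pmul (pmul p q) r"
  by (cases p; cases q; cases r) (simp add: pmul_def starT_def algebra_simps)

text \<open>Finite products satisfy their identities at every point of the circle, not merely almost
  everywhere. Off the circle they may fail, as the conjugate of \<open>z powi k\<close> need not be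
  \<open>z powi (- k)\<close> there.\<close>

definition circ_eq :: "(complex \<Rightarrow> complex) \<times> (complex \<Rightarrow> complex) \<Rightarrow> (complex \<Rightarrow> complex) \<times> (complex \<Rightarrow> complex) \<Rightarrow> bool" where
  "circ_eq p q \<longleftrightarrow> (\<forall>z. cmod z = 1 \<longrightarrow> fst p z = fst q z \<and> snd p z = snd q z)"

lemma circ_eq_refl [simp]: "circ_eq p p"
  by (simp add: circ_eq_def)

lemma circ_eq_sym: "circ_eq p q \<Longrightarrow> circ_eq q p"
  by (simp add: circ_eq_def)

lemma circ_eq_trans [trans]: "circ_eq p q \<Longrightarrow> circ_eq q r \<Longrightarrow> circ_eq p r"
  by (simp add: circ_eq_def)

lemma circ_eq_pmul: "circ_eq p p' \<Longrightarrow> circ_eq q q' \<Longrightarrow> circ_eq (pmul p q) (pmul p' q')"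
  by (cases p; cases p'; cases q; cases q') (simp add: circ_eq_def pmul_def starT_def)

definition star2 :: "(complex \<Rightarrow> complex) \<times> (complex \<Rightarrow> complex) \<Rightarrow> (complex \<Rightarrow> complex) \<times> (complex \<Rightarrow> complex)" where
  "star2 p = (fst p, starT (snd p))"

lemma star2_pmul: "star2 (pmul p q) = pmul (star2 q) (star2 p)"
  by (cases p; cases q) (simp add: star2_def pmul_def starT_def algebra_simps)

lemma circ_eq_star2: "circ_eq p q \<Longrightarrow> circ_eq (star2 p) (star2 q)"
  by (simp add: circ_eq_def star2_def starT_def)

text \<open>First row of the adjoint matrix, hence the inverse wherever the determinant |a|^2 +
  |b|^2 is 1.\<close>

definition pinv :: "(complex \<Rightarrow> complex) \<times> (complex \<Rightarrow> complex) \<Rightarrow> (complex \<Rightarrow> complex) \<times> (complex \<Rightarrow> complex)" where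
  "pinv p = (starT (fst p), \<lambda>z. - snd p z)"

definition cn :: "complex \<Rightarrow> real" where "cn f = 1 / sqrt (1 + (cmod f)\<^sup>2)"

lemma one_plus_cmod_pos: "0 < 1 + (cmod f)\<^sup>2"
  by (simp add: add_pos_nonneg)

lemma cn_pos: "0 < cn f"
  using one_plus_cmod_pos[of f] by (simp add: cn_def)

lemma cn_le_1: "cn f \<le> 1"
proof -
  have "1 \<le> sqrt (1 + (cmod f)\<^sup>2)" by simp
  then show ?thesis unfolding cn_def by (subst divide_le_eq_1) linarith
qed

lemma cn_power2: "(cn f)\<^sup>2 = 1 / (1 + (cmod f)\<^sup>2)"
  using one_plus_cmod_pos[of f] by (simp add: cn_def power_divide less_imp_le)

lemma cn_mult: "(cn f)\<^sup>2 * (1 + (cmod f)\<^sup>2) = 1"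
  using one_plus_cmod_pos[of f] by (simp add: cn_power2)

definition factor :: "int \<Rightarrow> complex \<Rightarrow> (complex \<Rightarrow> complex) \<times> (complex \<Rightarrow> complex)" where
  "factor k f = (\<lambda>_. of_real (cn f), \<lambda>z. (of_real (cn f) * f) * z powi k)"

text \<open>Inverse of \<open>factor k f\<close> on the circle: the first component is a real
  constant, so taking the adjoint only changes the sign of the second.\<close>

definition cofactor :: "int \<Rightarrow> complex \<Rightarrow> (complex \<Rightarrow> complex) \<times> (complex \<Rightarrow> complex)" where
  "cofactor k f = (\<lambda>_. of_real (cn f), \<lambda>z. (- (of_real (cn f) * f)) * z powi k)"

text \<open>Peels factors off at the left end, as layer stripping does, whereas
  \<open>nlfs_fin\<close> accumulates on the right.\<close>

primrec seg :: "(int \<Rightarrow> complex) \<Rightarrow> int \<Rightarrow> nat \<Rightarrow> (complex \<Rightarrow> complex) \<times> (complex \<Rightarrow> complex)" where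
  "seg G m 0 = (\<lambda>_. 1, \<lambda>_. 0)"
| "seg G m (Suc k) = pmul (factor m (G m)) (seg G (m + 1) k)"

lemma pmul_unit [simp]: "pmul p (\<lambda>_. 1, \<lambda>_. 0) = p" "pmul (\<lambda>_. 1, \<lambda>_. 0) p = p"
  by (cases p; simp add: pmul_def starT_def)+

lemma seg_add: "seg G m (k + l) = pmul (seg G m k) (seg G (m + int k) l)"
  by (induction k arbitrary: m) (simp_all add: pmul_assoc algebra_simps)

lemma seg_Suc_right: "seg G m (Suc k) = pmul (seg G m k) (factor (m + int k) (G (m + int k)))"
  using seg_add[of G m k 1] by simp

lemma seg_cong: "(\<And>j. m \<le> j \<Longrightarrow> j < m + int k \<Longrightarrow> G j = G' j) \<Longrightarrow> seg G m k = seg G' m k"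
  by (induction k arbitrary: m) simp_all

lemma nlfs_step_circ_eq: "circ_eq (nlfs_step G p k) (pmul p (factor k (G k)))"
  using cnj_powi_circ[of _ k]
  by (cases p) (simp add: circ_eq_def nlfs_step_def pmul_def factor_def starT_def cn_def algebra_simps power_int_minus add_divide_distrib
      del: complex_cnj_power_int)

lemma nlfs_fin_circ_eq: "circ_eq (nlfs_fin G m (m + int k - 1)) (seg G m k)"
proof -
  have "circ_eq (foldl (nlfs_step G) p [m..m + int k - 1]) (pmul p (seg G m k))" for p
  proof (induction k arbitrary: m p)
    case (Suc k)
    have l: "[m..m + int (Suc k) - 1] = m # [m + 1..(m + 1) + int k - 1]"
      by (subst upto_rec1) (auto simp: algebra_simps)
    have "circ_eq (foldl (nlfs_step G) (nlfs_step G p m) [m + 1..(m + 1) + int k - 1]) (pmul (nlfs_step G p m) (seg G (m + 1) k))"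
      by (rule Suc)
    moreover have "circ_eq (pmul (nlfs_step G p m) (seg G (m + 1) k)) (pmul (pmul p (factor m (G m))) (seg G (m + 1) k))"
      by (intro circ_eq_pmul nlfs_step_circ_eq circ_eq_refl)
    ultimately have "circ_eq (foldl (nlfs_step G) (nlfs_step G p m) [m + 1..(m + 1) + int k - 1])
        (pmul (pmul p (factor m (G m))) (seg G (m + 1) k))" by (rule circ_eq_trans)
    then show ?case unfolding l by (simp add: pmul_assoc)
  qed simp
  from this[of "(\<lambda>_. 1, \<lambda>_. 0)"] show ?thesis by (simp add: nlfs_fin_def)
qed

lemma star2_factor: "circ_eq (star2 (factor (- k) f)) (factor k (cnj f))"
proof -
  have "cnj (z powi (- k)) = z powi k" if "cmod z = 1" for z
    using cnj_powi_circ[OF that, of "- k"] by simp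
  then show ?thesis by (simp add: circ_eq_def star2_def starT_def factor_def cn_def del: complex_cnj_power_int)
qed

text \<open>\<open>star2\<close> reverses the order of products, so the factors at -k, ..., -1 turn
  into those at 1, ..., k. Index 0 is absent since it belongs to the right half-line.\<close>

lemma star2_seg:
  assumes "\<And>m. 1 \<le> m \<Longrightarrow> G m = cnj (F (- m))"
  shows "circ_eq (star2 (seg F (- int k) k)) (seg G 1 k)"
proof (induction k)
  case 0 then show ?case by (simp add: circ_eq_def star2_def starT_def)
next
  case (Suc k)
  have 1: "seg F (- int (Suc k)) (Suc k) = pmul (factor (- (1 + int k)) (F (- (1 + int k)))) (seg F (- int k) k)"
    by (simp add: algebra_simps)
  have 2: "G (1 + int k) = cnj (F (- (1 + int k)))" by (rule assms) simp
  show ?case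
    unfolding 1 seg_Suc_right[of G 1 k] star2_pmul 2
    by (intro circ_eq_pmul Suc star2_factor)
qed

lemma pmul_modulus:
  assumes "(cmod (fst p z))\<^sup>2 + (cmod (snd p z))\<^sup>2 = 1" "(cmod (fst q z))\<^sup>2 + (cmod (snd q z))\<^sup>2 = 1"
  shows "(cmod (fst (pmul p q) z))\<^sup>2 + (cmod (snd (pmul p q) z))\<^sup>2 = 1"
proof -
  obtain a b where p: "p = (a, b)" by force
  obtain c d where q: "q = (c, d)" by force
  have 1: "a z * cnj (a z) + b z * cnj (b z) = 1" "c z * cnj (c z) + d z * cnj (d z) = 1"
    using assms unfolding p q fst_conv snd_conv by (metis complex_norm_square of_real_1 of_real_add)+
  have "complex_of_real ((cmod (fst (pmul p q) z))\<^sup>2 + (cmod (snd (pmul p q) z))\<^sup>2)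
     = (a z * cnj (a z) + b z * cnj (b z)) * (c z * cnj (c z) + d z * cnj (d z))"
    unfolding of_real_add complex_norm_square p q by (simp add: pmul_def starT_def algebra_simps)
  then show ?thesis unfolding 1 by (metis mult_1 of_real_1 of_real_eq_iff)
qed

lemma pinv_pmul:
  assumes "(cmod (fst p z))\<^sup>2 + (cmod (snd p z))\<^sup>2 = 1"
  shows "fst (pmul (pinv p) (pmul p q)) z = fst q z" "snd (pmul (pinv p) (pmul p q)) z = snd q z"
    and "fst (pmul (pmul q p) (pinv p)) z = fst q z" "snd (pmul (pmul q p) (pinv p)) z = snd q z"
proof -
  obtain a b where p: "p = (a, b)" by force
  obtain c d where q: "q = (c, d)" by force
  have 1: "a z * cnj (a z) + b z * cnj (b z) = 1"
    using assms unfolding p fst_conv snd_conv by (metis complex_norm_square of_real_1 of_real_add)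
  have "fst (pmul (pinv p) (pmul p q)) z = (a z * cnj (a z) + b z * cnj (b z)) * c z"
    "snd (pmul (pinv p) (pmul p q)) z = (a z * cnj (a z) + b z * cnj (b z)) * d z"
    "fst (pmul (pmul q p) (pinv p)) z = (a z * cnj (a z) + b z * cnj (b z)) * c z"
    "snd (pmul (pmul q p) (pinv p)) z = (a z * cnj (a z) + b z * cnj (b z)) * d z"
    unfolding p q by (simp_all add: pinv_def pmul_def starT_def algebra_simps)
  then show "fst (pmul (pinv p) (pmul p q)) z = fst q z" "snd (pmul (pinv p) (pmul p q)) z = snd q z"
    "fst (pmul (pmul q p) (pinv p)) z = fst q z" "snd (pmul (pmul q p) (pinv p)) z = snd q z"
    unfolding 1 by (simp_all add: q)
qed

lemma factor_cofactor: "circ_eq (pmul (factor k f) (pmul (cofactor k f) q)) q"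
  unfolding circ_eq_def
proof (intro allI impI)
  fix z :: complex assume z: "cmod z = 1"
  obtain c d where q: "q = (c, d)" by force
  have "(of_real (cn f) * f) * z powi k * cnj ((of_real (cn f) * f) * z powi k) = of_real ((cn f)\<^sup>2 * (cmod f)\<^sup>2)"
    unfolding complex_norm_square[symmetric] using z cn_pos[of f] by (simp add: norm_mult norm_power_int power_mult_distrib)
  then have "of_real (cn f) * of_real (cn f) + (of_real (cn f) * f) * z powi k * cnj ((of_real (cn f) * f) * z powi k)
      = complex_of_real ((cn f)\<^sup>2 * (1 + (cmod f)\<^sup>2))"
    by (simp add: power2_eq_square distrib_left)
  also have "\<dots> = 1" by (simp only: cn_mult of_real_1)
  finally have 1: "of_real (cn f) * of_real (cn f) + (of_real (cn f) * f) * z powi k * cnj ((of_real (cn f) * f) * z powi k) = 1" .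
  define u where "u = (of_real (cn f) * f) * z powi k"
  have "fst (pmul (factor k f) (pmul (cofactor k f) q)) z = (of_real (cn f) * of_real (cn f) + u * cnj u) * c z"
    "snd (pmul (factor k f) (pmul (cofactor k f) q)) z = (of_real (cn f) * of_real (cn f) + u * cnj u) * d z"
    unfolding q u_def by (simp_all add: factor_def cofactor_def pmul_def starT_def algebra_simps)
  then show "fst (pmul (factor k f) (pmul (cofactor k f) q)) z = fst q z \<and> snd (pmul (factor k f) (pmul (cofactor k f) q)) z = snd q z"
    using 1 by (simp add: q u_def)
qed

section \<open>Values at infinity and orders of vanishing\<close>

definition val :: "(complex \<Rightarrow> complex) \<times> (complex \<Rightarrow> complex) \<Rightarrow> real" where
  "val p = Re (at_inf (fst p))"

text \<open>The class in which nonlinear Fourier series of coefficients supported on indices from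
  \<open>m\<close> on live; for \<open>m = 0\<close> these are the pairs of
  \<open>inHbar\<close>.\<close>

definition hb :: "int \<Rightarrow> (complex \<Rightarrow> complex) \<times> (complex \<Rightarrow> complex) \<Rightarrow> bool" where
  "hb m p \<longleftrightarrow> inL p \<and> (\<forall>j<m. fcoeff (snd p) j = 0)"

lemma inL_val:
  assumes "inL p"
  shows "val p > 0" "fcoeff (starT (fst p)) 0 = of_real (val p)" "fcoeff (fst p) 0 = of_real (val p)"
proof -
  obtain a b where p: "p = (a, b)" by force
  obtain k where k: "k > 0" "fcoeff (starT a) 0 = complex_of_real k" using assms by (auto simp: p inL_iff)
  have v: "val p = k" using k by (simp add: val_def p at_inf_eq)
  show "val p > 0" "fcoeff (starT (fst p)) 0 = of_real (val p)" using k v by (simp_all add: p)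
  have "a \<in> borel_measurable circ" using assms by (simp add: p inL_iff)
  from fcoeff_starT[OF this, of 0] have "cnj (fcoeff a 0) = of_real k" using k by simp
  then have "fcoeff a 0 = of_real k" by (metis complex_cnj_cnj complex_cnj_complex_of_real)
  then show "fcoeff (fst p) 0 = of_real (val p)" using v by (simp add: p)
qed

lemma inL_pairD:
  assumes "inL p"
  shows "fst p \<in> borel_measurable circ" "snd p \<in> borel_measurable circ"
    "AE z in circ. (cmod (fst p z))\<^sup>2 + (cmod (snd p z))\<^sup>2 = 1" "H2 (starT (fst p))"
    "sq_integrable circ (fst p)" "sq_integrable circ (snd p)"
    "AE z in circ. cmod (fst p z) \<le> 1" "AE z in circ. cmod (snd p z) \<le> 1"
  using assms inL_iff[of "fst p" "snd p"] inL_sq[of "fst p" "snd p"] inL_bounded[of "fst p" "snd p"] by auto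

lemma hb_H2: "hb m p \<Longrightarrow> 0 \<le> m \<Longrightarrow> H2 (snd p)"
  by (auto simp: hb_def H2_iff dest: inL_pairD(6))

lemma inL_l2norm:
  assumes "inL p" shows "(l2norm circ (fst p))\<^sup>2 + (l2norm circ (snd p))\<^sup>2 = 1"
proof -
  note d = inL_pairD[OF assms]
  have "(l2norm circ (fst p))\<^sup>2 + (l2norm circ (snd p))\<^sup>2 = (\<integral>z. (cmod (fst p z))\<^sup>2 + (cmod (snd p z))\<^sup>2 \<partial>circ)"
    unfolding l2norm_power2 using d(5,6) by (subst Bochner_Integration.integral_add) (auto simp: sq_integrable_def)
  also have "\<dots> = (\<integral>z. 1 \<partial>circ)"
    using d by (intro integral_cong_AE) auto
  finally show ?thesis by simp
qed

text \<open>The total mass is 1 and the constant coefficient alone carries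
  \<open>(val p)\<^sup>2\<close>, so a value near 1 forces the pair to be near the unit. The factor
  2 accounts for the nonconstant part of \<open>fst p\<close> and for \<open>1 - val p\<close>, each
  at most the square root.\<close>

lemma inL_near_unit:
  assumes "inL p"
  shows "val p \<le> 1" "l2norm circ (\<lambda>z. fst p z - 1) \<le> 2 * sqrt (1 - (val p)\<^sup>2)" "l2norm circ (snd p) \<le> sqrt (1 - (val p)\<^sup>2)"
proof -
  note d = inL_pairD[OF assms] and v = inL_val[OF assms] and n = inL_l2norm[OF assms]
  have "cmod (fcoeff (fst p) 0) \<le> l2norm circ (fst p)" by (rule cmod_fcoeff_le_l2norm[OF d(5)])
  then have 1: "val p \<le> l2norm circ (fst p)" unfolding v(3) norm_of_real by linarith
  have 2: "l2norm circ (fst p) \<le> 1"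
  proof (rule power2_le_imp_le)
    show "(l2norm circ (fst p))\<^sup>2 \<le> 1\<^sup>2" unfolding one_power2 using n zero_le_power2[of "l2norm circ (snd p)"] by linarith
  qed simp
  show v1: "val p \<le> 1" using 1 2 by simp
  have sq: "(val p)\<^sup>2 \<le> (l2norm circ (fst p))\<^sup>2" using 1 v(1) by (intro power_mono) auto
  show "l2norm circ (snd p) \<le> sqrt (1 - (val p)\<^sup>2)"
    using n sq by (intro real_le_rsqrt) linarith
  have "(l2norm circ (\<lambda>z. fst p z - (\<Sum>k\<in>{0}. fcoeff (fst p) k * z powi k)))\<^sup>2 = (l2norm circ (fst p))\<^sup>2 - (val p)\<^sup>2"
    by (subst l2norm_minus_trig[OF _ d(5)]) (use v(1,3) in auto)
  then have "(l2norm circ (\<lambda>z. fst p z - of_real (val p)))\<^sup>2 = (l2norm circ (fst p))\<^sup>2 - (val p)\<^sup>2"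
    by (simp add: v(3))
  then have "(l2norm circ (\<lambda>z. fst p z - of_real (val p)))\<^sup>2 \<le> 1 - (val p)\<^sup>2"
    using n zero_le_power2[of "l2norm circ (snd p)"] by linarith
  then have 3: "l2norm circ (\<lambda>z. fst p z - of_real (val p)) \<le> sqrt (1 - (val p)\<^sup>2)" by (rule real_le_rsqrt)
  have "(1 - val p)\<^sup>2 \<le> 1 - (val p)\<^sup>2"
  proof -
    have "(1 - val p) * (1 - val p) \<le> (1 - val p) * (1 + val p)" using v(1) v1 by (intro mult_left_mono) auto
    then show ?thesis by (simp add: power2_eq_square algebra_simps)
  qed
  then have 4: "1 - val p \<le> sqrt (1 - (val p)\<^sup>2)" by (rule real_le_rsqrt)
  have s: "sq_integrable circ (\<lambda>_. c)" for c by (rule H2_sq_integrable[OF H2_const])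
  have "l2norm circ (\<lambda>z. fst p z - 1) \<le> l2norm circ (\<lambda>z. fst p z - of_real (val p)) + l2norm circ (\<lambda>z. of_real (val p) - 1)"
    by (intro l2norm_triangle_mid d s)
  also have "l2norm circ (\<lambda>z. complex_of_real (val p) - 1) = 1 - val p"
  proof -
    have "cmod (of_real (val p) - 1) = \<bar>val p - 1\<bar>"
      by (metis norm_of_real of_real_1 of_real_diff)
    then show ?thesis using v1 by (simp add: l2norm_def[of circ "\<lambda>_. _ - 1"])
  qed
  finally show "l2norm circ (\<lambda>z. fst p z - 1) \<le> 2 * sqrt (1 - (val p)\<^sup>2)" using 3 4 by linarith
qed

text \<open>Adding a factor and removing one are the same kind of left multiplication. The new first
  component stays analytic outside the disc because \<open>snd q\<close> vanishes to order
  \<open>m\<close>, which absorbs the power \<open>z powi (-m)\<close>; its value at infinity mixes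
  in the coefficient of order \<open>m\<close>.\<close>

lemma left_step:
  fixes c :: real
  assumes q: "inL q" and cg: "c\<^sup>2 + (cmod g)\<^sup>2 = 1" and m: "0 \<le> m" and ord: "\<And>j. j < m \<Longrightarrow> fcoeff (snd q) j = 0"
    and v: "of_real c * of_real (val q) - cnj g * fcoeff (snd q) m = complex_of_real v" "v > 0"
  defines "p \<equiv> pmul (\<lambda>_. of_real c, \<lambda>z. g * z powi m) q"
  shows "hb m p" "val p = v" "fcoeff (snd p) m = of_real c * fcoeff (snd q) m + g * of_real (val q)"
proof -
  define \<alpha> \<beta> where "\<alpha> = fst q" and "\<beta> = snd q"
  have q_eq: "q = (\<alpha>, \<beta>)" by (simp add: \<alpha>_def \<beta>_def)
  note d = inL_pairD[OF q, folded \<alpha>_def \<beta>_def]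
  note [measurable] = d(1,2)
  have s\<alpha>: "sq_integrable circ (starT \<alpha>)" by (rule sq_integrable_starT[OF d(5)])
  define a where "a z = of_real c * \<alpha> z - (g * z powi m) * starT \<beta> z" for z
  define b where "b z = of_real c * \<beta> z + (g * z powi m) * starT \<alpha> z" for z
  have p: "p = (a, b)" by (auto simp: p_def q_eq pmul_def a_def b_def)
  have [measurable]: "a \<in> borel_measurable circ" "b \<in> borel_measurable circ"
    unfolding a_def[abs_def] b_def[abs_def] by measurable
  have "AE z in circ. starT a z = of_real c * starT \<alpha> z - cnj g * (z powi (-m) * \<beta> z)"
    using AE_circ_cmod
    by eventually_elim (simp add: starT_def a_def cnj_powi_circ mult.assoc del: complex_cnj_power_int)
  then have fa: "fcoeff (starT a) n = of_real c * fcoeff (starT \<alpha>) n - cnj g * fcoeff \<beta> (n + m)" for n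
  proof (subst fcoeff_cong_AE[of "starT a" "\<lambda>z. of_real c * starT \<alpha> z - cnj g * (z powi (-m) * \<beta> z)"])
    show "fcoeff (\<lambda>z. of_real c * starT \<alpha> z - cnj g * (z powi (-m) * \<beta> z)) n = of_real c * fcoeff (starT \<alpha>) n - cnj g * fcoeff \<beta> (n + m)"
      by (simp only: sq_fcoeff_diff sq_integrable_cmult sq_integrable_mult_powi s\<alpha> d sq_fcoeff_cmult fcoeff_shift) simp
  qed measurable
  have "AE z in circ. b z = of_real c * \<beta> z + g * (z powi m * starT \<alpha> z)"
    by (simp add: b_def mult.assoc)
  then have fb: "fcoeff b n = of_real c * fcoeff \<beta> n + g * fcoeff (starT \<alpha>) (n - m)" for n
  proof (subst fcoeff_cong_AE[of b "\<lambda>z. of_real c * \<beta> z + g * (z powi m * starT \<alpha> z)"])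
    show "fcoeff (\<lambda>z. of_real c * \<beta> z + g * (z powi m * starT \<alpha> z)) n = of_real c * fcoeff \<beta> n + g * fcoeff (starT \<alpha>) (n - m)"
      by (simp only: sq_fcoeff_add sq_integrable_cmult sq_integrable_mult_powi s\<alpha> d sq_fcoeff_cmult fcoeff_shift starT_measurable)
  qed measurable
  have mod: "AE z in circ. (cmod (a z))\<^sup>2 + (cmod (b z))\<^sup>2 = 1"
    using AE_circ_cmod d(3)
  proof eventually_elim
    case (elim z)
    have "(cmod (fst p z))\<^sup>2 + (cmod (snd p z))\<^sup>2 = 1"
      unfolding p_def using elim cg by (intro pmul_modulus) (auto simp: norm_mult norm_power_int \<alpha>_def \<beta>_def)
    then show ?case by (simp add: p)
  qed
  have \<alpha>neg: "fcoeff (starT \<alpha>) n = 0" if "n < 0" for n using d(4) that by (simp add: H2_iff)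
  have \<beta>neg: "fcoeff \<beta> n = 0" if "n < m" for n using ord that by (simp add: \<beta>_def)
  have \<alpha>0: "fcoeff (starT \<alpha>) 0 = of_real (val q)" using inL_val(2)[OF q] by (simp add: \<alpha>_def)
  have "sq_integrable circ a"
  proof (rule circ.sq_integrable_bounded)
    show "AE z in circ. cmod (a z) \<le> 1" using mod
    proof eventually_elim
      case (elim z)
      have "(cmod (a z))\<^sup>2 \<le> 1\<^sup>2" unfolding one_power2 using elim zero_le_power2[of "cmod (b z)"] by linarith
      then show ?case by (rule power2_le_imp_le) simp
    qed
  qed measurable
  then have Ha: "H2 (starT a)" using \<alpha>neg \<beta>neg m by (auto simp: H2_iff sq_integrable_starT fa)
  have fa0: "fcoeff (starT a) 0 = of_real v" using v(1) by (simp add: fa \<alpha>0 \<beta>_def)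
  have L: "inL p" unfolding p inL_iff using mod Ha fa0 v(2) by auto
  then show "hb m p" by (simp add: hb_def) (simp add: p fb \<alpha>neg \<beta>neg)
  show "val p = v" using inL_val(2)[OF L] fa0 by (simp add: p)
  show "fcoeff (snd p) m = of_real c * fcoeff (snd q) m + g * of_real (val q)"
    by (simp add: p fb \<alpha>0 \<beta>_def)
qed

lemma cn_modulus: "(cn f)\<^sup>2 + (cmod (of_real (cn f) * f))\<^sup>2 = 1"
  using cn_mult[of f] cn_pos[of f] by (simp add: norm_mult power_mult_distrib distrib_left)

text \<open>\<open>snd q\<close> has no coefficient of order \<open>m\<close>, so the one of the
  product comes from the factor alone, and its quotient by the value at infinity returns
  \<open>f\<close>.\<close>

lemma factor_hb:
  assumes q: "hb (m + 1) q" and m: "0 \<le> m"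
  shows "hb m (pmul (factor m f) q)" "val (pmul (factor m f) q) = cn f * val q"
    "fcoeff (snd (pmul (factor m f) q)) m = f * of_real (val (pmul (factor m f) q))"
proof -
  have L: "inL q" and o: "\<And>j. j < m + 1 \<Longrightarrow> fcoeff (snd q) j = 0" using q by (auto simp: hb_def)
  have v: "of_real (cn f) * of_real (val q) - cnj (of_real (cn f) * f) * fcoeff (snd q) m = complex_of_real (cn f * val q)"
    using o[of m] by simp
  have v0: "cn f * val q > 0" using cn_pos inL_val(1)[OF L] by simp
  have o': "fcoeff (snd q) j = 0" if "j < m" for j using o that by simp
  note ls = left_step[OF L cn_modulus m o' v v0]
  show "hb m (pmul (factor m f) q)" "val (pmul (factor m f) q) = cn f * val q"
    using ls by (simp_all add: factor_def)
  show "fcoeff (snd (pmul (factor m f) q)) m = f * of_real (val (pmul (factor m f) q))"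
    using ls o[of m] by (simp add: factor_def mult_ac)
qed

text \<open>This \<open>f\<close> is the quotient that a leading factor would leave behind. Removing
  that factor cancels the coefficient of order \<open>m\<close>, and the value grows by
  \<open>1 / cn f\<close> because
  \<open>(cn f)\<^sup>2 * (1 + (cmod f)\<^sup>2) = 1\<close>.\<close>

lemma cofactor_hb:
  assumes q: "hb m q" and m: "0 \<le> m" and f: "f = fcoeff (snd q) m / of_real (val q)"
  shows "hb (m + 1) (pmul (cofactor m f) q)" "val (pmul (cofactor m f) q) = val q / cn f"
proof -
  have L: "inL q" and o: "\<And>j. j < m \<Longrightarrow> fcoeff (snd q) j = 0" using q by (auto simp: hb_def)
  have vq: "val q > 0" by (rule inL_val(1)[OF L])
  have fm: "fcoeff (snd q) m = f * of_real (val q)" using f vq by simp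
  have "of_real (cn f) * of_real (val q) - cnj (- (of_real (cn f) * f)) * fcoeff (snd q) m = of_real (cn f) * of_real (val q) * (1 + f * cnj f)"
    by (simp add: fm algebra_simps)
  also have "\<dots> = complex_of_real (cn f * val q * (1 + (cmod f)\<^sup>2))"
    by (simp only: complex_norm_square[symmetric] of_real_mult of_real_add of_real_1)
  also have "cn f * val q * (1 + (cmod f)\<^sup>2) = val q / cn f"
  proof -
    have "cn f * val q * (1 + (cmod f)\<^sup>2) * cn f = val q * ((cn f)\<^sup>2 * (1 + (cmod f)\<^sup>2))"
      by (simp add: power2_eq_square mult_ac)
    then show ?thesis unfolding cn_mult using cn_pos[of f] by (simp add: eq_divide_eq)
  qed
  finally have v: "of_real (cn f) * of_real (val q) - cnj (- (of_real (cn f) * f)) * fcoeff (snd q) m = complex_of_real (val q / cn f)" .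
  have g: "(cn f)\<^sup>2 + (cmod (- (of_real (cn f) * f)))\<^sup>2 = 1" using cn_modulus[of f] by simp
  have v0: "val q / cn f > 0" using cn_pos vq by simp
  note ls = left_step[OF L g m o v v0, folded cofactor_def]
  show "val (pmul (cofactor m f) q) = val q / cn f" by (rule ls(2))
  have "fcoeff (snd (pmul (cofactor m f) q)) m = 0" using ls(3) by (simp add: fm)
  then show "hb (m + 1) (pmul (cofactor m f) q)"
    using ls(1) by (auto simp: hb_def) (metis zle_add1_eq_le order_le_less)
qed

lemma unit_hb: "hb m (\<lambda>_. 1, \<lambda>_. 0)" "val (\<lambda>_. 1, \<lambda>_. 0) = 1"
proof -
  have s: "starT (\<lambda>_. 1) = (\<lambda>_. 1)" by (simp add: starT_def)
  show "hb m (\<lambda>_. 1, \<lambda>_. 0)" unfolding hb_def inL_iff by (auto simp: s H2_const fcoeff_const intro!: exI[of _ 1])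
  show "val (\<lambda>_. 1, \<lambda>_. 0) = 1" by (simp add: val_def at_inf_eq s fcoeff_const)
qed

lemma seg_pmul_hb:
  assumes "hb (m + int k) q" "0 \<le> m"
  shows "hb m (pmul (seg G m k) q) \<and> val (pmul (seg G m k) q) = (\<Prod>j<k. cn (G (m + int j))) * val q"
  using assms
proof (induction k arbitrary: m)
  case (Suc k)
  have IH: "hb (m + 1) (pmul (seg G (m + 1) k) q)" "val (pmul (seg G (m + 1) k) q) = (\<Prod>j<k. cn (G (m + 1 + int j))) * val q"
    using Suc.IH[of "m + 1"] Suc.prems by (simp_all add: algebra_simps)
  have "(\<Prod>j<Suc k. cn (G (m + int j))) = cn (G m) * (\<Prod>j<k. cn (G (m + 1 + int j)))"
    by (subst prod.lessThan_Suc_shift) (simp add: algebra_simps)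
  then show ?case
    using factor_hb[OF IH(1) Suc.prems(2), of "G m"] IH(2) by (simp add: pmul_assoc[symmetric])
qed simp

lemma seg_hb:
  assumes "0 \<le> m" shows "hb m (seg G m k)" "val (seg G m k) = (\<Prod>j<k. cn (G (m + int j)))"
  using seg_pmul_hb[OF unit_hb(1) assms, where k=k and G=G] unit_hb(2) by simp_all

lemma fcoeff_seg_Suc:
  assumes "0 \<le> m" shows "fcoeff (snd (seg G m (Suc k))) m = G m * of_real (val (seg G m (Suc k)))"
  using factor_hb(3)[OF seg_hb(1)[of "m + 1" G k], of "G m"] assms by simp

section \<open>Layer stripping\<close>

lemma normL2_cong: "(\<And>z. cmod z = 1 \<Longrightarrow> cmod (f z) = cmod (g z)) \<Longrightarrow> normL2 f = normL2 g"
  by (simp add: normL2_def)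

lemma fcoeff_cong: "(\<And>z. cmod z = 1 \<Longrightarrow> f z = g z) \<Longrightarrow> fcoeff f n = fcoeff g n"
  by (simp add: fcoeff_def)

lemma rho_cong:
  assumes "circ_eq p p'" shows "rho p q = rho p' q"
proof -
  have e: "fst p z = fst p' z" "snd p z = snd p' z" if "cmod z = 1" for z using assms that by (auto simp: circ_eq_def)
  have "at_inf (fst p) = at_inf (fst p')"
    unfolding at_inf_eq by (simp add: starT_def e cong: fcoeff_cong)
  moreover have "normL2 (\<lambda>z. fst p z - fst q z) = normL2 (\<lambda>z. fst p' z - fst q z)"
    "normL2 (\<lambda>z. snd p z - snd q z) = normL2 (\<lambda>z. snd p' z - snd q z)"
    by (intro normL2_cong; simp add: e)+
  ultimately show ?thesis by (simp add: rho_def)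
qed

lemma rho_star2: "rho (star2 p) (star2 q) = rho p q"
proof -
  have "cmod (cnj (snd p z) - cnj (snd q z)) = cmod (snd p z - snd q z)" for z
    by (metis complex_cnj_diff complex_mod_cnj)
  then have "normL2 (\<lambda>z. starT (snd p) z - starT (snd q) z) = normL2 (\<lambda>z. snd p z - snd q z)"
    by (intro normL2_cong) (simp add: starT_def)
  then show ?thesis by (simp add: rho_def star2_def)
qed

lemma rho_eq:
  assumes "inL p" "inL q"
  shows "rho p q = l2norm circ (\<lambda>z. fst p z - fst q z) + l2norm circ (\<lambda>z. snd p z - snd q z) + \<bar>ln (val p) - ln (val q)\<bar>"
proof -
  have [measurable]: "fst p \<in> borel_measurable circ" "snd p \<in> borel_measurable circ"
    "fst q \<in> borel_measurable circ" "snd q \<in> borel_measurable circ" using assms by (auto dest: inL_pairD)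
  show ?thesis by (simp add: rho_def val_def normL2_eq)
qed

lemma inL_star2: "inL (star2 p) \<longleftrightarrow> inL p"
  using inL_starT_snd[of "fst p" "snd p"] inL_starT_snd[of "fst p" "starT (snd p)"] by (auto simp: star2_def)

lemma star2_star2 [simp]: "star2 (star2 p) = p"
  by (simp add: star2_def)

lemma nlfs_fin_nonneg: "circ_eq (nlfs_fin F 0 (int k)) (seg F 0 (Suc k))"
  using nlfs_fin_circ_eq[of F 0 "Suc k"] by simp

text \<open>\<open>star2\<close> turns the left half-line into the indices from 1 on. Setting
  \<open>G 0 = 0\<close> inserts a unit factor, so that both sequences take the form handled for
  nonnegative indices.\<close>

lemma rho_lim_minus:
  assumes G: "\<And>m. 1 \<le> m \<Longrightarrow> G m = cnj (F (- m))" and G0: "G 0 = 0"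
  shows "rho_lim (\<lambda>k. nlfs_fin F (- int k) (-1)) p \<longleftrightarrow> rho_lim (\<lambda>k. nlfs_fin G 0 (int k)) (star2 p)"
proof -
  have f: "factor 0 0 = (\<lambda>_. 1, \<lambda>_. 0)" by (simp add: factor_def cn_def)
  have eq: "circ_eq (star2 (nlfs_fin F (- int k) (-1))) (nlfs_fin G 0 (int k))" for k
  proof -
    have "circ_eq (nlfs_fin F (- int k) (-1)) (seg F (- int k) k)" using nlfs_fin_circ_eq[of F "- int k" k] by simp
    then have "circ_eq (star2 (nlfs_fin F (- int k) (-1))) (star2 (seg F (- int k) k))" by (rule circ_eq_star2)
    also have "circ_eq \<dots> (seg G 1 k)" by (rule star2_seg) (rule G)
    also have "seg G 1 k = seg G 0 (Suc k)" by (simp add: G0 f)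
    also have "circ_eq \<dots> (nlfs_fin G 0 (int k))" by (rule circ_eq_sym[OF nlfs_fin_nonneg])
    finally show ?thesis .
  qed
  have "rho (nlfs_fin F (- int k) (-1)) p = rho (nlfs_fin G 0 (int k)) (star2 p)" for k
    using rho_cong[OF eq] by (simp only: rho_star2[symmetric, of "nlfs_fin F (- int k) (-1)" p])
  then show ?thesis by (simp add: rho_lim_def inL_star2)
qed

text \<open>A Schur algorithm: the remainder after \<open>n\<close> steps vanishes to order
  \<open>n\<close>, and its coefficient of order \<open>n\<close> over its value at infinity is the
  next coefficient.\<close>

primrec strip :: "(complex \<Rightarrow> complex) \<times> (complex \<Rightarrow> complex) \<Rightarrow> nat \<Rightarrow> (complex \<Rightarrow> complex) \<times> (complex \<Rightarrow> complex)" where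
  "strip p 0 = p"
| "strip p (Suc n) = pmul (cofactor (int n) (fcoeff (snd (strip p n)) (int n) / of_real (val (strip p n)))) (strip p n)"

definition reflection :: "(complex \<Rightarrow> complex) \<times> (complex \<Rightarrow> complex) \<Rightarrow> int \<Rightarrow> complex" where
  "reflection p k = fcoeff (snd (strip p (nat k))) k / of_real (val (strip p (nat k)))"

lemma sum_le_prod_one_plus:
  fixes x :: "nat \<Rightarrow> real" assumes "\<And>j. 0 \<le> x j" shows "1 + (\<Sum>j<n. x j) \<le> (\<Prod>j<n. 1 + x j)"
proof (induction n)
  case (Suc n)
  have "1 \<le> (\<Prod>j<n. 1 + x j)" using assms by (intro prod_ge_1) auto
  then have "x n \<le> (\<Prod>j<n. 1 + x j) * x n" using assms[of n] by (simp add: mult_le_cancel_right1)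
  then show ?case using Suc by (simp add: distrib_left)
qed simp

section \<open>Remainders of layer stripping and their limit\<close>

locale layer_stripping =
  fixes p :: "(complex \<Rightarrow> complex) \<times> (complex \<Rightarrow> complex)"
  assumes hb0: "hb 0 p"
begin

abbreviation "r n \<equiv> strip p n"
abbreviation "F \<equiv> reflection p"

lemma strip_Suc: "r (Suc n) = pmul (cofactor (int n) (F (int n))) (r n)"
  by (simp add: reflection_def)

lemma strip_hb: "hb (int n) (r n)"
proof (induction n)
  case (Suc n)
  have "hb (int n + 1) (r (Suc n))"
    unfolding strip_Suc by (rule cofactor_hb(1)[OF Suc]) (simp_all add: reflection_def)
  then show ?case by (simp add: add.commute)
qed (simp add: hb0)

lemma strip_inL: "inL (r n)"
  using strip_hb by (simp add: hb_def)

lemma strip_val_Suc: "val (r (Suc n)) = val (r n) / cn (F (int n))"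
  unfolding strip_Suc by (rule cofactor_hb(2)[OF strip_hb]) (simp_all add: reflection_def)

lemma strip_seg: "circ_eq (pmul (seg F (int n) k) (r (n + k))) (r n)"
proof (induction k arbitrary: n)
  case (Suc k)
  have "circ_eq (pmul (seg F (int n + 1) k) (r (Suc n + k))) (r (Suc n))"
    using Suc[of "Suc n"] by (simp add: add.commute)
  then have "circ_eq (pmul (factor (int n) (F (int n))) (pmul (seg F (int n + 1) k) (r (Suc n + k))))
      (pmul (factor (int n) (F (int n))) (r (Suc n)))"
    by (intro circ_eq_pmul circ_eq_refl)
  moreover have "circ_eq (pmul (factor (int n) (F (int n))) (r (Suc n))) (r n)"
    unfolding strip_Suc by (rule factor_cofactor)
  ultimately have "circ_eq (pmul (factor (int n) (F (int n))) (pmul (seg F (int n + 1) k) (r (Suc n + k)))) (r n)"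
    by (rule circ_eq_trans)
  then show ?case by (simp add: pmul_assoc)
qed simp

lemma strip_val: "val (seg F (int n) k) * val (r (n + k)) = val (r n)"
proof -
  have "(\<Prod>j<k. cn (F (int n + int j))) * val (r (n + k)) = val (r n)"
  proof (induction k)
    case (Suc k)
    have "val (r (n + Suc k)) * cn (F (int n + int k)) = val (r (n + k))"
      using strip_val_Suc[of "n + k"] cn_pos[of "F (int n + int k)"] by (simp del: strip.simps)
    moreover have "(\<Prod>j<Suc k. cn (F (int n + int j))) * val (r (n + Suc k))
        = (\<Prod>j<k. cn (F (int n + int j))) * (val (r (n + Suc k)) * cn (F (int n + int k)))"
      by (simp add: mult_ac del: strip.simps)
    ultimately show ?case using Suc by (simp only:)
  qed simp
  then show ?thesis by (simp add: seg_hb(2))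
qed

lemma strip_val_pos: "0 < val (r n)" and strip_val_le_1: "val (r n) \<le> 1"
  by (rule inL_val(1)[OF strip_inL]) (rule inL_near_unit(1)[OF strip_inL])

lemma strip_val_incseq: "incseq (\<lambda>n. val (r n))"
proof (rule incseq_SucI)
  fix n
  have "val (r n) * cn (F (int n)) \<le> val (r n) * 1"
    using strip_val_pos[of n] cn_le_1 by (intro mult_left_mono) auto
  then show "val (r n) \<le> val (r (Suc n))"
    unfolding strip_val_Suc using cn_pos[of "F (int n)"] by (simp add: pos_le_divide_eq)
qed

text \<open>The product of the \<open>cn (F (int j))\<close> times the value of the remainder is
  \<open>val p\<close>, and that value is at most 1. So the product is at least
  \<open>val p\<close>, which bounds the product of the 1 + |F j|^2 and hence the sum of the |F
  j|^2.\<close>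

lemma reflection_sum_le: "(\<Sum>j<n. (cmod (F (int j)))\<^sup>2) \<le> 1 / (val p)\<^sup>2"
proof -
  have v: "val p > 0" using strip_val_pos[of 0] by simp
  have P: "(\<Prod>j<n. cn (F (int j))) * val (r n) = val p"
    using strip_val[of 0 n] seg_hb(2)[of 0 F n] by simp
  have Ppos: "0 < (\<Prod>j<n. cn (F (int j)))" by (intro prod_pos) (simp add: cn_pos)
  have "val p \<le> (\<Prod>j<n. cn (F (int j))) * 1"
    unfolding P[symmetric] using strip_val_le_1[of n] Ppos by (intro mult_left_mono) auto
  then have le: "(val p)\<^sup>2 \<le> (\<Prod>j<n. cn (F (int j)))\<^sup>2" using v by (intro power_mono) auto
  have "1 + (\<Sum>j<n. (cmod (F (int j)))\<^sup>2) \<le> (\<Prod>j<n. 1 + (cmod (F (int j)))\<^sup>2)"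
    by (rule sum_le_prod_one_plus) simp
  also have "\<dots> = (\<Prod>j<n. 1 / (cn (F (int j)))\<^sup>2)" by (simp add: cn_power2)
  also have "\<dots> = 1 / (\<Prod>j<n. cn (F (int j)))\<^sup>2" by (simp add: prod_dividef prod_power_distrib)
  also have "\<dots> \<le> 1 / (val p)\<^sup>2"
    by (rule divide_left_mono[OF le _ mult_pos_pos[OF zero_less_power[OF Ppos] zero_less_power[OF v]]]) simp
  finally show ?thesis by simp
qed

text \<open>\<open>r n\<close> and \<open>r (n + k)\<close> differ by the factor \<open>seg F n k\<close>, which is close to the unit, while the first
  \<open>n + k\<close> Fourier coefficients of \<open>snd (r (n + k))\<close> vanish.\<close>

lemma strip_snd_small:
  assumes l: "\<And>n. val (r n) \<le> l" and l0: "l > 0"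
  shows "l2norm circ (snd (r n)) \<le> 3 * sqrt (1 - (val (r n) / l)\<^sup>2)"
proof (rule l2norm_le_fcoeff_bound)
  note N = inL_pairD[OF strip_inL[of n]]
  show "sq_integrable circ (snd (r n))" by (rule N(6))
  define \<eta> where "\<eta> = sqrt (1 - (val (r n) / l)\<^sup>2)"
  have vl: "val (r n) / l \<le> 1" "0 < val (r n) / l" using l[of n] l0 strip_val_pos[of n] by auto
  then have "(val (r n) / l)\<^sup>2 \<le> 1" by (simp add: power_le_one)
  then have \<eta>: "0 \<le> \<eta>" by (simp add: \<eta>_def)
  then show "0 \<le> 3 * sqrt (1 - (val (r n) / l)\<^sup>2)" by (simp add: \<eta>_def)
  fix I :: "int set" assume I: "finite I"
  \<comment> \<open>\<open>k\<close> lies beyond \<open>I\<close>, so the remainder after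
    \<open>n + k\<close> steps has no coefficient in \<open>I\<close>.\<close>
  obtain k :: nat where k: "\<And>j. j \<in> I \<Longrightarrow> j < int k"
  proof -
    obtain m where m: "\<And>j. j \<in> I \<Longrightarrow> j \<le> m" using I by (metis Max_ge)
    have "j < int (nat m + 1)" if "j \<in> I" for j using m[OF that] by linarith
    then show ?thesis using that by blast
  qed
  define T where "T = seg F (int n) k"
  define R where "R = r (n + k)"
  have LT: "inL T" unfolding T_def using seg_hb(1)[of "int n" F k] by (simp add: hb_def)
  have LR: "inL R" unfolding R_def by (rule strip_inL)
  note dT = inL_pairD[OF LT] and dR = inL_pairD[OF LR]
  \<comment> \<open>Values at infinity multiply and those of the remainders are at most
    \<open>l\<close>, so \<open>T\<close> is close to the unit uniformly in
    \<open>k\<close>.\<close>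
  have "val T = val (r n) / val R"
    using strip_val[of n k] inL_val(1)[OF LR] by (simp add: T_def R_def eq_divide_eq)
  also have "\<dots> \<ge> val (r n) / l"
    using l[of "n + k"] inL_val(1)[OF LR] strip_val_pos[of n] l0 by (intro divide_left_mono mult_pos_pos) (auto simp: R_def)
  finally have vT: "val (r n) / l \<le> val T" .
  have "(val (r n) / l)\<^sup>2 \<le> (val T)\<^sup>2" using vT vl by (intro power_mono) auto
  then have "sqrt (1 - (val T)\<^sup>2) \<le> \<eta>" by (simp add: \<eta>_def)
  then have T: "l2norm circ (\<lambda>z. fst T z - 1) \<le> 2 * \<eta>" "l2norm circ (snd T) \<le> \<eta>"
    using inL_near_unit(2,3)[OF LT] by linarith+
  have sT1: "sq_integrable circ (\<lambda>z. fst T z - 1)" by (intro sq_integrable_diff dT H2_sq_integrable[OF H2_const])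
  \<comment> \<open>The difference of the second components of \<open>pmul T R\<close> and
    \<open>R\<close>; the constant 3 adds up the bounds for \<open>fst T - 1\<close> and
    \<open>snd T\<close>.\<close>
  define D where "D z = snd R z * (fst T z - 1) + starT (fst R) z * snd T z" for z
  have bR: "AE z in circ. cmod (starT (fst R) z) \<le> 1" using dR(7) by (simp add: starT_def)
  note mR = starT_measurable[OF dR(1)]
  have s1: "sq_integrable circ (\<lambda>z. snd R z * (fst T z - 1))" by (rule sq_integrable_bounded_mult[OF sT1 dR(2) dR(8)])
  have s2: "sq_integrable circ (\<lambda>z. starT (fst R) z * snd T z)" by (rule sq_integrable_bounded_mult[OF dT(6) mR bR])
  have sD: "sq_integrable circ D" unfolding D_def[abs_def] by (rule sq_integrable_add[OF s1 s2])
  have "l2norm circ D \<le> l2norm circ (\<lambda>z. snd R z * (fst T z - 1)) + l2norm circ (\<lambda>z. starT (fst R) z * snd T z)"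
    unfolding D_def[abs_def] by (rule l2norm_triangle[OF s1 s2])
  also have "\<dots> \<le> 1 * l2norm circ (\<lambda>z. fst T z - 1) + 1 * l2norm circ (snd T)"
    by (intro add_mono l2norm_mult_bound sT1 dT dR mR bR) auto
  finally have D: "l2norm circ D \<le> 3 * \<eta>" using T by linarith
  have eq: "AE z in circ. snd (r n) z - snd R z = D z"
    using AE_circ_cmod
  proof eventually_elim
    case (elim z)
    have "snd (r n) z = snd (pmul T R) z" using strip_seg[of n k] elim by (simp add: circ_eq_def T_def R_def)
    also have "\<dots> = fst T z * snd R z + snd T z * starT (fst R) z"
      by (cases T; cases R) (simp add: pmul_def)
    finally show ?case by (simp add: D_def algebra_simps)
  qed
  have c: "fcoeff (snd (r n)) j = fcoeff D j" if "j \<in> I" for j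
  proof -
    have "fcoeff D j = fcoeff (\<lambda>z. snd (r n) z - snd R z) j"
      using eq N(2) dR(2) sq_integrable_measurable[OF sD] by (intro fcoeff_cong_AE) auto
    also have "\<dots> = fcoeff (snd (r n)) j - fcoeff (snd R) j" by (rule sq_fcoeff_diff[OF N(6) dR(6)])
    also have "fcoeff (snd R) j = 0" using strip_hb[of "n + k"] k[OF that] by (simp add: R_def hb_def)
    finally show ?thesis by simp
  qed
  have "(\<Sum>k\<in>I. (cmod (fcoeff (snd (r n)) k))\<^sup>2) = (\<Sum>k\<in>I. (cmod (fcoeff D k))\<^sup>2)" by (simp add: c)
  also have "\<dots> \<le> (l2norm circ D)\<^sup>2" by (rule bessel[OF I sD])
  also have "\<dots> \<le> (3 * \<eta>)\<^sup>2" using D by (intro power_mono) auto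
  finally show "(\<Sum>k\<in>I. (cmod (fcoeff (snd (r n)) k))\<^sup>2) \<le> (3 * sqrt (1 - (val (r n) / l)\<^sup>2))\<^sup>2" by (simp add: \<eta>_def)
qed

text \<open>The segment is \<open>p\<close> times the inverse of the remainder.\<close>

lemma seg_eq_strip:
  assumes "cmod z = 1" "(cmod (fst (r n) z))\<^sup>2 + (cmod (snd (r n) z))\<^sup>2 = 1"
  shows "fst (seg F 0 n) z = fst p z * cnj (fst (r n) z) + snd p z * cnj (snd (r n) z)"
    "snd (seg F 0 n) z = snd p z * fst (r n) z - fst p z * snd (r n) z"
proof -
  have e: "fst (pmul (seg F 0 n) (r n)) z = fst p z" "snd (pmul (seg F 0 n) (r n)) z = snd p z"
    using strip_seg[of 0 n] assms(1) by (simp_all add: circ_eq_def)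
  have 1: "fst (pmul u v) z = fst u z * fst v z - snd u z * cnj (snd v z)"
    "snd (pmul u v) z = fst u z * snd v z + snd u z * cnj (fst v z)" for u v
    by (cases u; cases v; simp add: pmul_def starT_def)+
  note q = pinv_pmul(3,4)[where p="r n" and q="seg F 0 n" and z=z, OF assms(2)]
  show "fst (seg F 0 n) z = fst p z * cnj (fst (r n) z) + snd p z * cnj (snd (r n) z)"
    unfolding q(1)[symmetric] 1(1)[of _ "pinv (r n)"] e by (simp add: pinv_def starT_def)
  show "snd (seg F 0 n) z = snd p z * fst (r n) z - fst p z * snd (r n) z"
    unfolding q(2)[symmetric] 1(2)[of _ "pinv (r n)"] e by (simp add: pinv_def starT_def)
qed

text \<open>By the Bezout identity \<open>fst (r n)\<close> is, up to a multiple of the small function \<open>snd (r n)\<close>, an element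
  of \<open>H\<^sup>2\<close>; being the conjugate of one, it is almost constant.\<close>

lemma strip_val_lower:
  assumes U: "H2 U" "AE z in circ. cmod (U z) \<le> M" and V: "H2 V" "AE z in circ. cmod (V z) \<le> M"
    and UV: "AE z in circ. starT (fst p) z * U z - snd p z * V z = 1"
  shows "1 \<le> (val (r n))\<^sup>2 + (1 + (2 * M)\<^sup>2) * (l2norm circ (snd (r n)))\<^sup>2"
proof -
  have "\<exists>z. cmod (U z) \<le> M" using eventually_happens'[OF ae_filter_circ U(2)] .
  then have M: "0 \<le> M" by (meson norm_ge_zero order_trans)
  define \<alpha> \<beta> where "\<alpha> = fst (r n)" and "\<beta> = snd (r n)"
  note d = inL_pairD[OF strip_inL[of n], folded \<alpha>_def \<beta>_def]
  have Lp: "inL p" using hb0 by (simp add: hb_def)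
  note dp = inL_pairD[OF Lp]
  note [measurable] = d(1,2) dp(1,2) H2_measurable[OF U(1)] H2_measurable[OF V(1)]
  define s where "s = seg F 0 n"
  have hs: "hb 0 s" unfolding s_def by (rule seg_hb(1)) simp
  have Hs: "H2 (starT (fst s))" "H2 (snd s)" using hs hb_H2[OF hs] by (auto simp: hb_def dest: inL_pairD(4))
  define S where "S z = starT (snd p) z * U z + fst p z * V z" for z
  have [measurable]: "S \<in> borel_measurable circ" unfolding S_def[abs_def] by measurable
  have Sb: "AE z in circ. cmod (S z) \<le> 2 * M"
    using U(2) V(2) dp(7,8)
  proof eventually_elim
    case (elim z)
    have "cmod (S z) \<le> cmod (starT (snd p) z * U z) + cmod (fst p z * V z)" unfolding S_def by (rule norm_triangle_ineq)
    also have "\<dots> \<le> 1 * M + 1 * M"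
      unfolding norm_mult using elim M by (intro add_mono mult_mono) (auto simp: starT_def)
    finally show ?case by simp
  qed
  \<comment> \<open>An H^2 combination of the entries of the segment. Expressing the segment by
    \<open>p\<close> and the remainder, the Bezout identity collapses it to
    \<open>\<alpha> z + S z * \<beta> z\<close>.\<close>
  define G where "G z = U z * starT (fst s) z - V z * snd s z" for z
  have HG: "H2 G" unfolding G_def[abs_def]
    by (intro H2_diff H2_mult U V Hs sq_integrable_bounded_mult[OF H2_sq_integrable[OF Hs(1)] H2_measurable[OF U(1)] U(2)]
        sq_integrable_bounded_mult[OF H2_sq_integrable[OF Hs(2)] H2_measurable[OF V(1)] V(2)])
  have sS: "sq_integrable circ (\<lambda>z. S z * \<beta> z)" by (rule sq_integrable_bounded_mult[OF d(6) _ Sb]) measurable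
  have "AE z in circ. G z = \<alpha> z + S z * \<beta> z"
    using AE_circ_cmod d(3) UV
  proof eventually_elim
    case (elim z)
    note e = seg_eq_strip[OF elim(1), of n, folded \<alpha>_def \<beta>_def s_def, OF elim(2)]
    have "G z = \<alpha> z * (starT (fst p) z * U z - snd p z * V z) + S z * \<beta> z"
      unfolding G_def S_def starT_def e by (simp add: algebra_simps)
    then show ?case using elim(3) by simp
  qed
  then have "fcoeff G k = fcoeff (\<lambda>z. \<alpha> z + S z * \<beta> z) k" for k
    using HG by (intro fcoeff_cong_AE) (auto simp: H2_measurable)
  then have fG: "fcoeff G k = fcoeff \<alpha> k + fcoeff (\<lambda>z. S z * \<beta> z) k" for k
    by (simp add: sq_fcoeff_add[OF d(5) sS])
  have \<alpha>0: "fcoeff \<alpha> 0 = of_real (val (r n))" using inL_val(3)[OF strip_inL[of n]] by (simp add: \<alpha>_def)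
  \<comment> \<open>\<open>\<alpha>\<close> has no positive frequencies and \<open>G\<close> no
    negative ones, so the negative coefficients of \<open>\<alpha>\<close> are those of
    \<open>- S z * \<beta> z\<close>.\<close>
  have term_le: "(cmod (fcoeff \<alpha> k))\<^sup>2 \<le> (if k = 0 then (val (r n))\<^sup>2 else 0) + (cmod (fcoeff (\<lambda>z. S z * \<beta> z) k))\<^sup>2" for k
  proof -
    consider "k = 0" | "k > 0" | "k < 0" by linarith
    then show ?thesis
    proof cases
      case 2
      have "fcoeff (starT \<alpha>) (-k) = 0" using d(4) 2 by (simp add: H2_iff)
      then have "fcoeff \<alpha> k = 0" using fcoeff_starT[OF d(1), of "-k"] by simp
      then show ?thesis using 2 by simp
    next
      case 3
      then have "fcoeff \<alpha> k = - fcoeff (\<lambda>z. S z * \<beta> z) k" using HG fG[of k] by (simp add: H2_iff eq_neg_iff_add_eq_0)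
      then show ?thesis using 3 by simp
    qed (simp add: \<alpha>0)
  qed
  have "(l2norm circ \<alpha>)\<^sup>2 \<le> (val (r n))\<^sup>2 + (l2norm circ (\<lambda>z. S z * \<beta> z))\<^sup>2"
  proof (rule LIMSEQ_le_const2[OF parseval[OF d(5)]], intro exI allI impI)
    fix N
    have "(\<Sum>k\<in>{- int N..int N}. (cmod (fcoeff \<alpha> k))\<^sup>2)
        \<le> (\<Sum>k\<in>{- int N..int N}. (if k = 0 then (val (r n))\<^sup>2 else 0) + (cmod (fcoeff (\<lambda>z. S z * \<beta> z) k))\<^sup>2)"
      by (intro sum_mono term_le)
    also have "\<dots> = (val (r n))\<^sup>2 + (\<Sum>k\<in>{- int N..int N}. (cmod (fcoeff (\<lambda>z. S z * \<beta> z) k))\<^sup>2)"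
      by (simp add: sum.distrib sum.delta)
    also have "\<dots> \<le> (val (r n))\<^sup>2 + (l2norm circ (\<lambda>z. S z * \<beta> z))\<^sup>2"
      by (intro add_left_mono bessel sS) simp
    finally show "(\<Sum>k\<in>{- int N..int N}. (cmod (fcoeff \<alpha> k))\<^sup>2) \<le> (val (r n))\<^sup>2 + (l2norm circ (\<lambda>z. S z * \<beta> z))\<^sup>2" .
  qed
  also have "(l2norm circ (\<lambda>z. S z * \<beta> z))\<^sup>2 \<le> (2 * M * l2norm circ \<beta>)\<^sup>2"
    by (intro power_mono l2norm_mult_bound d Sb) (use M in auto)
  finally have "(l2norm circ \<alpha>)\<^sup>2 \<le> (val (r n))\<^sup>2 + (2 * M)\<^sup>2 * (l2norm circ \<beta>)\<^sup>2" by (simp add: power_mult_distrib)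
  moreover have "(l2norm circ \<alpha>)\<^sup>2 + (l2norm circ \<beta>)\<^sup>2 = 1"
    using inL_l2norm[OF strip_inL[of n]] by (simp add: \<alpha>_def \<beta>_def)
  ultimately show ?thesis unfolding \<beta>_def by (simp add: distrib_right)
qed

text \<open>Monotonicity gives only a limit \<open>l\<close>, and the smallness of the second
  components has to be measured relative to it. Since \<open>val (r n) / l\<close> tends to 1, they
  tend to 0, and the lower estimate from the Bezout identity becomes
  \<open>1 \<le> l\<^sup>2\<close>.\<close>

lemma strip_val_limit:
  assumes "bezout p" shows "(\<lambda>n. val (r n)) \<longlonglongrightarrow> 1"
proof -
  obtain U V M where U: "H2 U" "AE z in circ. cmod (U z) \<le> M" and V: "H2 V" "AE z in circ. cmod (V z) \<le> M"
    and UV: "AE z in circ. starT (fst p) z * U z - snd p z * V z = 1"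
    using assms by (auto simp: bezout_def)
  obtain l where l: "(\<lambda>n. val (r n)) \<longlonglongrightarrow> l" "\<And>n. val (r n) \<le> l"
    using incseq_convergent[OF strip_val_incseq, of 1] strip_val_le_1 by blast
  have l0: "l > 0" using l(2)[of 0] strip_val_pos[of 0] by linarith
  have l1: "l \<le> 1" by (rule LIMSEQ_le_const2[OF l(1)]) (use strip_val_le_1 in blast)
  have "(\<lambda>n. 3 * sqrt (1 - (val (r n) / l)\<^sup>2)) \<longlonglongrightarrow> 3 * sqrt (1 - (l / l)\<^sup>2)"
    by (intro tendsto_intros l) (use l0 in auto)
  then have "(\<lambda>n. 3 * sqrt (1 - (val (r n) / l)\<^sup>2)) \<longlonglongrightarrow> 0" using l0 by simp
  then have b: "(\<lambda>n. l2norm circ (snd (r n))) \<longlonglongrightarrow> 0"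
    by (rule tendsto_sandwich[OF _ _ tendsto_const, rotated 2]) (use strip_snd_small[OF l(2) l0] in auto)
  have "(\<lambda>n. (val (r n))\<^sup>2 + (1 + (2 * M)\<^sup>2) * (l2norm circ (snd (r n)))\<^sup>2) \<longlonglongrightarrow> l\<^sup>2 + (1 + (2 * M)\<^sup>2) * 0\<^sup>2"
    by (intro tendsto_intros l b)
  then have "1 \<le> l\<^sup>2 + (1 + (2 * M)\<^sup>2) * 0\<^sup>2"
    by (rule LIMSEQ_le_const) (use strip_val_lower[OF U V UV] in blast)
  then have "1\<^sup>2 \<le> l\<^sup>2" by simp
  then have "1 \<le> l" by (rule power2_le_imp_le) (use l0 in simp)
  then have "l = 1" using l1 by simp
  then show ?thesis using l by simp
qed

text \<open>The segment is \<open>p\<close> times the inverse of a remainder that tends to the unit: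
  each component differs from that of \<open>p\<close> by at most \<open>3 * \<eta> n\<close>, and
  the logarithms of the values at infinity add.\<close>

lemma seg_tendsto:
  assumes "bezout p" shows "(\<lambda>n. rho (seg F 0 n) p) \<longlonglongrightarrow> 0"
proof -
  have Lp: "inL p" using hb0 by (simp add: hb_def)
  note dp = inL_pairD[OF Lp]
  define \<eta> where "\<eta> n = sqrt (1 - (val (r n))\<^sup>2)" for n
  have "\<eta> \<longlonglongrightarrow> sqrt (1 - 1\<^sup>2)"
    unfolding \<eta>_def by (intro tendsto_intros strip_val_limit assms)
  then have \<eta>: "\<eta> \<longlonglongrightarrow> 0" by simp
  have bound: "rho (seg F 0 n) p \<le> 6 * \<eta> n + \<bar>ln (val (r n))\<bar>" for n
  proof -
    define s where "s = seg F 0 n"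
    have Ls: "inL s" unfolding s_def using seg_hb(1)[of 0 F n] by (simp add: hb_def)
    note ds = inL_pairD[OF Ls]
    note d = inL_pairD[OF strip_inL[of n]]
    note u = inL_near_unit[OF strip_inL[of n], folded \<eta>_def]
    note [measurable] = dp(1,2) ds(1,2) d(1,2)
    have s1: "sq_integrable circ (\<lambda>z. fst (r n) z - 1)" by (intro sq_integrable_diff d H2_sq_integrable[OF H2_const])
    note c1 = sq_integrable_cnj[OF s1] and c2 = sq_integrable_cnj[OF d(6)]
    have add: "l2norm circ (\<lambda>z. f z * x z + g z * y z) \<le> l2norm circ x + l2norm circ y"
      if "sq_integrable circ x" "sq_integrable circ y" "f \<in> borel_measurable circ" "g \<in> borel_measurable circ"
        "AE z in circ. cmod (f z) \<le> 1" "AE z in circ. cmod (g z) \<le> 1" for f g x y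
    proof -
      have "l2norm circ (\<lambda>z. f z * x z + g z * y z) \<le> l2norm circ (\<lambda>z. f z * x z) + l2norm circ (\<lambda>z. g z * y z)"
        using that by (intro l2norm_triangle sq_integrable_bounded_mult)
      also have "\<dots> \<le> 1 * l2norm circ x + 1 * l2norm circ y" using that by (intro add_mono l2norm_mult_bound) auto
      finally show ?thesis by simp
    qed
    have b: "l2norm circ (\<lambda>z. fst s z - fst p z) \<le> 3 * \<eta> n"
    proof -
      have "l2norm circ (\<lambda>z. fst s z - fst p z) = l2norm circ (\<lambda>z. fst p z * cnj (fst (r n) z - 1) + snd p z * cnj (snd (r n) z))"
      proof (rule l2norm_cong_AE)
        show "AE z in circ. fst s z - fst p z = fst p z * cnj (fst (r n) z - 1) + snd p z * cnj (snd (r n) z)"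
          using AE_circ_cmod d(3)
        proof eventually_elim
          case (elim z)
          show ?case unfolding s_def seg_eq_strip(1)[OF elim] by (simp add: algebra_simps)
        qed
        show "(\<lambda>z. fst p z * cnj (fst (r n) z - 1) + snd p z * cnj (snd (r n) z)) \<in> borel_measurable circ"
          using sq_integrable_measurable[OF c1] sq_integrable_measurable[OF c2] by measurable
      qed measurable
      also have "\<dots> \<le> l2norm circ (\<lambda>z. cnj (fst (r n) z - 1)) + l2norm circ (\<lambda>z. cnj (snd (r n) z))"
        by (rule add[OF c1 c2 dp(1,2,7,8)])
      finally show ?thesis using u by (simp add: l2norm_cnj del: complex_cnj_diff)
    qed
    have b2: "l2norm circ (\<lambda>z. snd s z - snd p z) \<le> 3 * \<eta> n"
    proof -
      have "l2norm circ (\<lambda>z. snd s z - snd p z) = l2norm circ (\<lambda>z. snd p z * (fst (r n) z - 1) + (- fst p z) * snd (r n) z)"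
      proof (rule l2norm_cong_AE)
        show "AE z in circ. snd s z - snd p z = snd p z * (fst (r n) z - 1) + (- fst p z) * snd (r n) z"
          using AE_circ_cmod d(3)
        proof eventually_elim
          case (elim z)
          show ?case unfolding s_def seg_eq_strip(2)[OF elim] by (simp add: algebra_simps)
        qed
      qed measurable
      also have "\<dots> \<le> l2norm circ (\<lambda>z. fst (r n) z - 1) + l2norm circ (snd (r n))"
        by (rule add[OF s1 d(6)]) (use dp in auto)
      finally show ?thesis using u by simp
    qed
    have v: "val s * val (r n) = val p" using strip_val[of 0 n] by (simp add: s_def)
    have "ln (val p) = ln (val s) + ln (val (r n))"
      unfolding v[symmetric] using inL_val(1)[OF Ls] strip_val_pos[of n] by (rule ln_mult_pos)
    then have "\<bar>ln (val s) - ln (val p)\<bar> = \<bar>ln (val (r n))\<bar>" by simp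
    then show ?thesis using b b2 by (simp add: rho_eq[OF Ls Lp] flip: s_def)
  qed
  have "(\<lambda>n. 6 * \<eta> n + \<bar>ln (val (r n))\<bar>) \<longlonglongrightarrow> 6 * 0 + \<bar>ln 1\<bar>"
    by (intro tendsto_intros \<eta> strip_val_limit assms) simp
  then have u: "(\<lambda>n. 6 * \<eta> n + \<bar>ln (val (r n))\<bar>) \<longlonglongrightarrow> 0" by simp
  have "0 \<le> rho (seg F 0 n) p" for n
    using rho_eq[OF _ Lp, of "seg F 0 n"] seg_hb(1)[of 0 F n] by (simp add: hb_def)
  then show ?thesis
    by (intro tendsto_sandwich[OF _ _ tendsto_const u]) (use bound in auto)
qed

theorem reflection_rho_lim:
  assumes "bezout p" shows "rho_lim (\<lambda>k. nlfs_fin F 0 (int k)) p"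
  unfolding rho_lim_def using LIMSEQ_Suc[OF seg_tendsto[OF assms]] hb0
  by (simp add: rho_cong[OF nlfs_fin_nonneg] hb_def del: seg.simps)

end

section \<open>Uniqueness of the reflection coefficients\<close>

lemma rho_lim_components:
  assumes "rho_lim (\<lambda>k. nlfs_fin F 0 (int k)) p"
  shows "(\<lambda>k. l2norm circ (\<lambda>z. fst (seg F 0 (Suc k)) z - fst p z)) \<longlonglongrightarrow> 0"
    "(\<lambda>k. l2norm circ (\<lambda>z. snd (seg F 0 (Suc k)) z - snd p z)) \<longlonglongrightarrow> 0"
proof -
  have Lp: "inL p" and lim: "(\<lambda>k. rho (seg F 0 (Suc k)) p) \<longlonglongrightarrow> 0"
    using assms by (simp_all add: rho_lim_def rho_cong[OF nlfs_fin_nonneg] del: seg.simps)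
  have Ls: "inL (seg F 0 k)" for k using seg_hb(1)[of 0 F k] by (simp add: hb_def)
  note e = rho_eq[OF Ls Lp]
  show "(\<lambda>k. l2norm circ (\<lambda>z. fst (seg F 0 (Suc k)) z - fst p z)) \<longlonglongrightarrow> 0"
    by (rule tendsto_sandwich[OF _ _ tendsto_const lim]) (simp_all add: e del: seg.simps)
  show "(\<lambda>k. l2norm circ (\<lambda>z. snd (seg F 0 (Suc k)) z - snd p z)) \<longlonglongrightarrow> 0"
    by (rule tendsto_sandwich[OF _ _ tendsto_const lim]) (simp_all add: e del: seg.simps)
qed

text \<open>H^2 membership and single coefficients pass to the limit. Applied to the reflected left
  half-line, whose coefficient at 0 is 0, the ratio at index 0 yields the vanishing of the star of
  b_- at the origin.\<close>

lemma rho_lim_hb: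
  assumes "rho_lim (\<lambda>k. nlfs_fin F 0 (int k)) p"
  shows "hb 0 p" "fcoeff (snd p) 0 = F 0 * of_real (val p)"
proof -
  have Lp: "inL p" using assms by (simp add: rho_lim_def)
  note dp = inL_pairD[OF Lp]
  have hs: "hb 0 (seg F 0 k)" for k by (rule seg_hb(1)) simp
  then have Ls: "inL (seg F 0 k)" for k by (simp add: hb_def)
  note ds = inL_pairD[OF Ls]
  have "H2 (snd p)" by (rule H2_limit[OF _ dp(6) rho_lim_components(2)[OF assms]]) (rule hb_H2[OF hs], simp)
  then show "hb 0 p" using Lp by (simp add: hb_def H2_iff)
  have "(\<lambda>k. fcoeff (snd (seg F 0 (Suc k))) 0) \<longlonglongrightarrow> fcoeff (snd p) 0"
    by (rule fcoeff_l2_limit[OF ds(6) dp(6) rho_lim_components(2)[OF assms]])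
  moreover have "(\<lambda>k. F 0 * fcoeff (fst (seg F 0 (Suc k))) 0) \<longlonglongrightarrow> F 0 * fcoeff (fst p) 0"
    by (intro tendsto_intros fcoeff_l2_limit[OF ds(5) dp(5) rho_lim_components(1)[OF assms]])
  moreover have "fcoeff (snd (seg F 0 (Suc k))) 0 = F 0 * fcoeff (fst (seg F 0 (Suc k))) 0" for k
    unfolding inL_val(3)[OF Ls] by (rule fcoeff_seg_Suc) simp
  ultimately show "fcoeff (snd p) 0 = F 0 * of_real (val p)"
    unfolding inL_val(3)[OF Lp] by (simp add: LIMSEQ_unique del: seg.simps)
qed

lemma l2norm_mult_tendsto_0:
  assumes "\<And>n. sq_integrable M (x n)" "f \<in> borel_measurable M" "AE z in M. cmod (f z) \<le> 1"
    and "(\<lambda>n. l2norm M (x n)) \<longlonglongrightarrow> 0"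
  shows "(\<lambda>n. l2norm M (\<lambda>z. f z * x n z)) \<longlonglongrightarrow> 0"
  by (rule tendsto_sandwich[OF _ _ tendsto_const assms(4)])
     (use l2norm_mult_bound[OF assms(1-3)] in auto)

lemma l2norm_add_tendsto_0:
  assumes "\<And>n. sq_integrable M (x n)" "\<And>n. sq_integrable M (y n)"
    and "(\<lambda>n. l2norm M (x n)) \<longlonglongrightarrow> 0" "(\<lambda>n. l2norm M (y n)) \<longlonglongrightarrow> 0"
  shows "(\<lambda>n. l2norm M (\<lambda>z. x n z + y n z)) \<longlonglongrightarrow> 0"
  by (rule tendsto_sandwich[OF _ _ tendsto_const tendsto_add_zero[OF assms(3,4)]])
     (use l2norm_triangle[OF assms(1,2)] in auto)

text \<open>Undoing the first \<open>n\<close> factors is continuous in L^2, so \<open>q n\<close>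
  is the limit of the segments that start at \<open>n\<close>, for which the quotient is known. The
  denominator is \<open>fcoeff (fst (q n)) 0\<close> rather than \<open>val (q n)\<close> because
  \<open>q n\<close> is handled only as an L^2 limit, without showing \<open>inL\<close>.\<close>

lemma rho_lim_coefficient:
  assumes "rho_lim (\<lambda>k. nlfs_fin F 0 (int k)) p"
  defines "q \<equiv> \<lambda>n. pmul (pinv (seg F 0 n)) p"
  shows "fst (q n) \<in> borel_measurable circ" "snd (q n) \<in> borel_measurable circ"
    "F (int n) = fcoeff (snd (q n)) (int n) / fcoeff (fst (q n)) 0"
proof -
  have Lp: "inL p" using assms by (simp add: rho_lim_def)
  note dp = inL_pairD[OF Lp]
  have L: "inL (seg F (int m) k)" for m k using seg_hb(1)[of "int m" F k] by (simp add: hb_def)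
  have L0: "inL (seg F 0 k)" for k using L[of 0 k] by simp
  note d0 = inL_pairD[OF L0]
  define s where "s = seg F 0 n"
  note ds = inL_pairD[OF L0[of n], folded s_def]
  define u where "u = fst s" define v where "v = snd s"
  note du = ds[folded u_def v_def]
  have [measurable]: "u \<in> borel_measurable circ" "v \<in> borel_measurable circ" by (rule du)+
  have mu [measurable]: "(\<lambda>z. cnj (u z)) \<in> borel_measurable circ" using starT_measurable[OF du(1)] by (simp add: starT_def)
  note mv = borel_measurable_uminus[OF du(2)]
  have bu: "AE z in circ. cmod (cnj (u z)) \<le> 1" and bv: "AE z in circ. cmod (- v z) \<le> 1" using du(7,8) by auto
  \<comment> \<open>The two components of left multiplication by \<open>pinv s\<close>; they are
    real-linear in the pair and bounded in L^2.\<close>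
  define T1 where "T1 x y z = cnj (u z) * x z + v z * cnj (y z)" for x y z
  define T2 where "T2 x y z = cnj (u z) * y z + - v z * cnj (x z)" for x y z
  have Tq: "pmul (pinv s) w = (T1 (fst w) (snd w), T2 (fst w) (snd w))" for w
    by (cases w) (auto simp: pmul_def pinv_def starT_def T1_def T2_def u_def v_def)
  have sT: "sq_integrable circ (T1 x y)" "sq_integrable circ (T2 x y)" if "sq_integrable circ x" "sq_integrable circ y" for x y
    unfolding T1_def[abs_def] T2_def[abs_def]
    by (rule sq_integrable_add[OF sq_integrable_bounded_mult[OF that(1) mu bu] sq_integrable_bounded_mult[OF sq_integrable_cnj[OF that(2)] du(2,8)]],
        rule sq_integrable_add[OF sq_integrable_bounded_mult[OF that(2) mu bu] sq_integrable_bounded_mult[OF sq_integrable_cnj[OF that(1)] mv bv]])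
  have lT: "(\<lambda>k. l2norm circ (T1 (x k) (y k))) \<longlonglongrightarrow> 0" "(\<lambda>k. l2norm circ (T2 (x k) (y k))) \<longlonglongrightarrow> 0"
    if "\<And>k. sq_integrable circ (x k)" "\<And>k. sq_integrable circ (y k)"
      "(\<lambda>k. l2norm circ (x k)) \<longlonglongrightarrow> 0" "(\<lambda>k. l2norm circ (y k)) \<longlonglongrightarrow> 0" for x y
  proof -
    note c = sq_integrable_cnj[OF that(1)] sq_integrable_cnj[OF that(2)]
    have lc: "(\<lambda>k. l2norm circ (\<lambda>z. cnj (x k z))) \<longlonglongrightarrow> 0" "(\<lambda>k. l2norm circ (\<lambda>z. cnj (y k z))) \<longlonglongrightarrow> 0"
      using that by (simp_all add: l2norm_cnj)
    show "(\<lambda>k. l2norm circ (T1 (x k) (y k))) \<longlonglongrightarrow> 0" unfolding T1_def[abs_def]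
      by (intro l2norm_add_tendsto_0 l2norm_mult_tendsto_0 that c lc mu du bu
          sq_integrable_bounded_mult[OF that(1) mu bu] sq_integrable_bounded_mult[OF c(2) du(2) du(8)])
    show "(\<lambda>k. l2norm circ (T2 (x k) (y k))) \<longlonglongrightarrow> 0" unfolding T2_def[abs_def]
      by (intro l2norm_add_tendsto_0 l2norm_mult_tendsto_0 that c lc mu mv bv bu
          sq_integrable_bounded_mult[OF that(2) mu bu] sq_integrable_bounded_mult[OF c(1) mv bv])
  qed
  have q: "fst (q n) = T1 (fst p) (snd p)" "snd (q n) = T2 (fst p) (snd p)" by (simp_all add: q_def Tq flip: s_def)
  note sq = sT[OF dp(5,6)]
  show "fst (q n) \<in> borel_measurable circ" "snd (q n) \<in> borel_measurable circ"
    unfolding q using sq by (auto intro: sq_integrable_measurable)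
  define P where "P k = seg F 0 (Suc (n + k))" for k
  define S where "S k = seg F (int n) (Suc k)" for k
  have LP: "inL (P k)" for k unfolding P_def by (rule L0)
  have LS: "inL (S k)" for k unfolding S_def by (rule L)
  note dP = inL_pairD[OF LP] and dS = inL_pairD[OF LS]
  have PS: "P k = pmul s (S k)" for k
    unfolding P_def S_def s_def using seg_add[of F 0 n "Suc k"] by simp
  have S: "AE z in circ. fst (S k) z = T1 (fst (P k)) (snd (P k)) z \<and> snd (S k) z = T2 (fst (P k)) (snd (P k)) z" for k
    using ds(3)
  proof eventually_elim
    case (elim z)
    show ?case using pinv_pmul(1,2)[where p=s and q="S k" and z=z, OF elim] unfolding PS[symmetric] Tq by simp
  qed
  have d1: "sq_integrable circ (\<lambda>z. fst (P k) z - fst p z)" and d2: "sq_integrable circ (\<lambda>z. snd (P k) z - snd p z)" for k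
    by (intro sq_integrable_diff dP dp)+
  have l1: "(\<lambda>k. l2norm circ (\<lambda>z. fst (P k) z - fst p z)) \<longlonglongrightarrow> 0"
    using LIMSEQ_ignore_initial_segment[OF rho_lim_components(1)[OF assms(1)], of n] by (simp add: P_def add.commute del: seg.simps)
  have l2: "(\<lambda>k. l2norm circ (\<lambda>z. snd (P k) z - snd p z)) \<longlonglongrightarrow> 0"
    using LIMSEQ_ignore_initial_segment[OF rho_lim_components(2)[OF assms(1)], of n] by (simp add: P_def add.commute del: seg.simps)
  have e1: "l2norm circ (\<lambda>z. fst (S k) z - fst (q n) z) = l2norm circ (T1 (\<lambda>z. fst (P k) z - fst p z) (\<lambda>z. snd (P k) z - snd p z))" for k
  proof (rule l2norm_cong_AE)
    show "AE z in circ. fst (S k) z - fst (q n) z = T1 (\<lambda>z. fst (P k) z - fst p z) (\<lambda>z. snd (P k) z - snd p z) z"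
      using S[of k] by eventually_elim (simp add: q T1_def algebra_simps)
    show "(\<lambda>z. fst (S k) z - fst (q n) z) \<in> borel_measurable circ"
      unfolding q by (intro borel_measurable_diff dS sq_integrable_measurable[OF sq(1)])
  qed (rule sq_integrable_measurable[OF sT(1)[OF d1 d2]])
  have e2: "l2norm circ (\<lambda>z. snd (S k) z - snd (q n) z) = l2norm circ (T2 (\<lambda>z. fst (P k) z - fst p z) (\<lambda>z. snd (P k) z - snd p z))" for k
  proof (rule l2norm_cong_AE)
    show "AE z in circ. snd (S k) z - snd (q n) z = T2 (\<lambda>z. fst (P k) z - fst p z) (\<lambda>z. snd (P k) z - snd p z) z"
      using S[of k] by eventually_elim (simp add: q T2_def algebra_simps)
    show "(\<lambda>z. snd (S k) z - snd (q n) z) \<in> borel_measurable circ"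
      unfolding q by (intro borel_measurable_diff dS sq_integrable_measurable[OF sq(2)])
  qed (rule sq_integrable_measurable[OF sT(2)[OF d1 d2]])
  note lim = lT[where x="\<lambda>k z. fst (P k) z - fst p z" and y="\<lambda>k z. snd (P k) z - snd p z", OF d1 d2 l1 l2, folded e1 e2]
  have c1: "(\<lambda>k. fcoeff (fst (S k)) 0) \<longlonglongrightarrow> fcoeff (fst (q n)) 0"
    by (rule fcoeff_l2_limit[OF dS(5) _ lim(1)]) (simp add: q sq)
  have c2: "(\<lambda>k. fcoeff (snd (S k)) (int n)) \<longlonglongrightarrow> fcoeff (snd (q n)) (int n)"
    by (rule fcoeff_l2_limit[OF dS(6) _ lim(2)]) (simp add: q sq)
  have "fcoeff (snd (S k)) (int n) = F (int n) * fcoeff (fst (S k)) 0" for k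
    unfolding inL_val(3)[OF LS] unfolding S_def by (rule fcoeff_seg_Suc) simp
  then have "(\<lambda>k. fcoeff (snd (S k)) (int n)) \<longlonglongrightarrow> F (int n) * fcoeff (fst (q n)) 0"
    using tendsto_mult_left[OF c1, of "F (int n)"] by simp
  then have eq: "fcoeff (snd (q n)) (int n) = F (int n) * fcoeff (fst (q n)) 0" using c2 LIMSEQ_unique by blast
  \<comment> \<open>Removing factors does not decrease the value at infinity, so in the limit the
    denominator is at least \<open>val p\<close> in real part, hence nonzero.\<close>
  have "val (P k) \<le> val (S k)" for k
  proof -
    have "hb (0 + int n) (S k)" unfolding S_def using seg_hb(1)[of "int n" F "Suc k"] by simp
    then have "val (P k) = (\<Prod>j<n. cn (F (0 + int j))) * val (S k)"
      unfolding PS s_def by (rule seg_pmul_hb[THEN conjunct2]) simp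
    also have "\<dots> \<le> 1 * val (S k)"
      using inL_val(1)[OF LS[of k]] by (intro mult_right_mono prod_le_1) (auto simp: cn_pos[THEN less_imp_le] cn_le_1)
    finally show ?thesis by simp
  qed
  then have "Re (fcoeff (fst (P k)) 0) \<le> Re (fcoeff (fst (S k)) 0)" for k
    by (simp add: inL_val(3)[OF LP] inL_val(3)[OF LS])
  moreover have "(\<lambda>k. Re (fcoeff (fst (P k)) 0)) \<longlonglongrightarrow> Re (fcoeff (fst p) 0)"
    by (intro tendsto_Re fcoeff_l2_limit[OF dP(5) dp(5) l1])
  ultimately have "Re (fcoeff (fst p) 0) \<le> Re (fcoeff (fst (q n)) 0)"
    using tendsto_Re[OF c1] by (intro LIMSEQ_le) auto
  then have "fcoeff (fst (q n)) 0 \<noteq> 0" using inL_val[OF Lp] by auto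
  then show "F (int n) = fcoeff (snd (q n)) (int n) / fcoeff (fst (q n)) 0" using eq by simp
qed

text \<open>Agreement below \<open>n\<close> makes the initial segments equal, so the next
  coefficient is read off from remainders that agree up to null sets.\<close>

theorem nlfs_nonneg_unique:
  assumes F: "rho_lim (\<lambda>k. nlfs_fin F 0 (int k)) p" and G: "rho_lim (\<lambda>k. nlfs_fin G 0 (int k)) p'"
    and "ae_pair p p'"
  shows "F (int n) = G (int n)"
proof (induction n rule: less_induct)
  case (less n)
  have "F j = G j" if "0 \<le> j" "j < 0 + int n" for j
    using less[of "nat j"] that by (simp add: nat_less_iff)
  then have s: "seg F 0 n = seg G 0 n" by (rule seg_cong)
  define u where "u = pmul (pinv (seg F 0 n)) p"
  define v where "v = pmul (pinv (seg F 0 n)) p'"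
  note 1 = rho_lim_coefficient[OF F, of n, folded u_def]
  note 2 = rho_lim_coefficient[OF G, of n, folded s, folded v_def]
  have "AE z in circ. fst p z = fst p' z \<and> snd p z = snd p' z" using assms(3) by (simp add: ae_pair_def onT_AE_iff)
  then have "AE z in circ. fst u z = fst v z \<and> snd u z = snd v z"
    unfolding u_def v_def by eventually_elim (cases p; cases p'; simp add: pmul_def pinv_def starT_def)
  then have "AE z in circ. fst u z = fst v z" "AE z in circ. snd u z = snd v z" by auto
  then have "fcoeff (fst u) 0 = fcoeff (fst v) 0" "fcoeff (snd u) (int n) = fcoeff (snd v) (int n)"
    using 1(1,2) 2(1,2) by (auto intro: fcoeff_cong_AE)
  then show ?case by (simp add: 1(3) 2(3))
qed

section \<open>Joining the two half-lines\<close>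

lemma ell2I:
  assumes "\<And>n. (\<Sum>j<n. (cmod (F (int j)))\<^sup>2) \<le> B" "\<And>n. (\<Sum>j<n. (cmod (F (- int j)))\<^sup>2) \<le> C"
  shows "ell2 F"
  unfolding ell2_def
proof (rule nonneg_bdd_above_summable_on)
  show "bdd_above (sum (\<lambda>n. (cmod (F n))\<^sup>2) ` {I. I \<subseteq> UNIV \<and> finite I})"
  proof (rule bdd_aboveI[of _ "B + C"], clarsimp)
    fix I :: "int set" assume I: "finite I"
    obtain m where m: "\<And>j. j \<in> I \<Longrightarrow> \<bar>j\<bar> \<le> m" using I by (metis Max_ge finite_imageI imageI)
    define N where "N = nat m + 1"
    have "I \<subseteq> int ` {..<N} \<union> (\<lambda>j. - int j) ` {..<N}"
    proof
      fix j assume "j \<in> I"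
      then have "\<bar>j\<bar> \<le> m" by (rule m)
      then show "j \<in> int ` {..<N} \<union> (\<lambda>j. - int j) ` {..<N}"
        by (cases "0 \<le> j") (auto simp: N_def image_iff intro!: bexI[of _ "nat \<bar>j\<bar>"])
    qed
    then have "(\<Sum>n\<in>I. (cmod (F n))\<^sup>2) \<le> (\<Sum>n\<in>int ` {..<N} \<union> (\<lambda>j. - int j) ` {..<N}. (cmod (F n))\<^sup>2)"
      by (intro sum_mono2) auto
    also have "\<dots> \<le> (\<Sum>n\<in>int ` {..<N}. (cmod (F n))\<^sup>2) + (\<Sum>n\<in>(\<lambda>j. - int j) ` {..<N}. (cmod (F n))\<^sup>2)"
      by (subst sum_Un) (auto simp: sum_nonneg)
    also have "\<dots> = (\<Sum>j<N. (cmod (F (int j)))\<^sup>2) + (\<Sum>j<N. (cmod (F (- int j)))\<^sup>2)"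
      by (subst (1 2) sum.reindex) (auto simp: inj_on_def)
    also have "\<dots> \<le> B + C" by (intro add_mono assms)
    finally show "(\<Sum>n\<in>I. (cmod (F n))\<^sup>2) \<le> B + C" .
  qed
qed simp

lemma nlfs_nonneg_cong:
  assumes "\<And>j. 0 \<le> j \<Longrightarrow> F j = G j" shows "rho_lim (\<lambda>k. nlfs_fin F 0 (int k)) p = rho_lim (\<lambda>k. nlfs_fin G 0 (int k)) p"
proof -
  have "seg F 0 k = seg G 0 k" for k using assms by (intro seg_cong) auto
  then show ?thesis by (simp only: rho_lim_def rho_cong[OF nlfs_fin_nonneg])
qed

lemma nlfs_exists:
  assumes p: "hb 0 p" "bezout p" and m: "hb 0 (star2 m)" "bezout (star2 m)" "fcoeff (snd (star2 m)) 0 = 0"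
  shows "\<exists>F. ell2 F \<and> rho_lim (\<lambda>k. nlfs_fin F 0 (int k)) p \<and> rho_lim (\<lambda>k. nlfs_fin F (- int k) (-1)) m"
proof -
  interpret P: layer_stripping p by standard (rule p)
  interpret Q: layer_stripping "star2 m" by standard (rule m)
  \<comment> \<open>At negative indices the reflection coefficients of \<open>star2 m\<close> are
    conjugated and reversed; the third hypothesis on \<open>m\<close> makes
    \<open>reflection (star2 m) 0\<close> vanish, as the reduction to nonnegative indices
    requires.\<close>
  define F where "F k = (if 0 \<le> k then reflection p k else cnj (reflection (star2 m) (- k)))" for k
  have "rho_lim (\<lambda>k. nlfs_fin F 0 (int k)) p"
    using P.reflection_rho_lim[OF p(2)] nlfs_nonneg_cong[of F "reflection p"] by (simp add: F_def)
  moreover have "rho_lim (\<lambda>k. nlfs_fin F (- int k) (-1)) m"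
    by (subst rho_lim_minus[where G="reflection (star2 m)"])
       (use Q.reflection_rho_lim[OF m(2)] m(3) in \<open>auto simp: F_def reflection_def\<close>)
  moreover have "ell2 F"
  proof (rule ell2I)
    show "(\<Sum>j<n. (cmod (F (int j)))\<^sup>2) \<le> 1 / (val p)\<^sup>2" for n
      using P.reflection_sum_le[of n] by (simp add: F_def)
    \<comment> \<open>The term \<open>j = 0\<close> is \<open>F 0\<close>, which comes from
      \<open>p\<close>, so it is estimated separately.\<close>
    show "(\<Sum>j<n. (cmod (F (- int j)))\<^sup>2) \<le> (cmod (reflection p 0))\<^sup>2 + 1 / (val (star2 m))\<^sup>2" for n
    proof -
      have "(\<Sum>j<n. (cmod (F (- int j)))\<^sup>2) \<le> (\<Sum>j<n. (if j = 0 then (cmod (reflection p 0))\<^sup>2 else 0) + (cmod (reflection (star2 m) (int j)))\<^sup>2)"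
        by (intro sum_mono) (auto simp: F_def)
      also have "\<dots> \<le> (cmod (reflection p 0))\<^sup>2 + (\<Sum>j<n. (cmod (reflection (star2 m) (int j)))\<^sup>2)"
        by (simp add: sum.distrib sum.delta)
      also have "\<dots> \<le> (cmod (reflection p 0))\<^sup>2 + 1 / (val (star2 m))\<^sup>2"
        by (intro add_left_mono Q.reflection_sum_le)
      finally show ?thesis .
    qed
  qed
  ultimately show ?thesis by blast
qed

lemma hb_0_iff: "hb 0 p \<longleftrightarrow> inL p \<and> H2 (snd p)"
  by (auto simp: hb_def H2_iff dest: inL_pairD(6))

lemma rho_lim_minus_star2:
  "rho_lim (\<lambda>k. nlfs_fin F (- int k) (-1)) p \<longleftrightarrow>
    rho_lim (\<lambda>k. nlfs_fin (\<lambda>m. if m = 0 then 0 else cnj (F (- m))) 0 (int k)) (star2 p)"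
  by (rule rho_lim_minus) auto

theorem theorem7p2:
  fixes a b :: "complex \<Rightarrow> complex"
  assumes "inB (a, b)"
  shows "(\<exists>pp pm. inH pp \<and> inH0s pm \<and> ae_pair (pmul pm pp) (a, b))
       \<and> (\<forall>pp pm pp' pm'. inH pp \<and> inH0s pm \<and> ae_pair (pmul pm pp) (a, b)
            \<and> inH pp' \<and> inH0s pm' \<and> ae_pair (pmul pm' pp') (a, b)
            \<longrightarrow> ae_pair pp pp' \<and> ae_pair pm pm')
       \<and> (\<exists>!F. ell2 F \<and> is_nlfs F (a, b))"
proof -
  obtain c where c: "0 < c" "1/2 < c\<^sup>2" "AE z in circ. c \<le> cmod (a z)" "H2 (\<lambda>z. 1 / starT a z)"
    using inB_inverse[OF assms] .
  interpret rh_problem a b c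
    by standard (use assms c in \<open>auto simp: inB_def\<close>)
  obtain ap bp am bm where p: "inL (ap, bp)" "H2 bp" and m: "inL (am, bm)" "H2 (starT bm)" "fcoeff (starT bm) 0 = 0"
    and ae: "ae_pair (pmul (am, bm) (ap, bp)) (a, b)"
    using factorization_exists by blast
  note bz = factorization_bezout[OF p m(1,2) ae]
  have uniq: "ae_pair pp pp' \<and> ae_pair pm pm'"
    if "inL pp" "H2 (snd pp)" "inL pm" "H2 (starT (snd pm))" "fcoeff (starT (snd pm)) 0 = 0" "ae_pair (pmul pm pp) (a, b)"
      "inL pp'" "H2 (snd pp')" "inL pm'" "H2 (starT (snd pm'))" "fcoeff (starT (snd pm')) 0 = 0" "ae_pair (pmul pm' pp') (a, b)"
    for pp pm pp' pm'
    using factorization_unique[of "fst pp" "snd pp" "fst pm" "snd pm" "fst pp'" "snd pp'" "fst pm'" "snd pm'"] that by simp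
  have "inH (ap, bp)" by (rule inH_of_bezout[OF _ bz(1)]) (use p in \<open>simp add: inHbar_def\<close>)
  moreover have "inH0s (am, bm)"
    unfolding inH0s_def fst_conv snd_conv
    using m bz(2) by (auto simp: inHbar_def H2ext_zero intro!: inH_of_bezout inL_starT_snd)
  ultimately have ex: "\<exists>pp pm. inH pp \<and> inH0s pm \<and> ae_pair (pmul pm pp) (a, b)" using ae by blast
  have un: "\<forall>pp pm pp' pm'. inH pp \<and> inH0s pm \<and> ae_pair (pmul pm pp) (a, b)
            \<and> inH pp' \<and> inH0s pm' \<and> ae_pair (pmul pm' pp') (a, b)
            \<longrightarrow> ae_pair pp pp' \<and> ae_pair pm pm'"
  proof (intro allI impI)
    fix pp pm pp' pm'
    assume "inH pp \<and> inH0s pm \<and> ae_pair (pmul pm pp) (a, b) \<and> inH pp' \<and> inH0s pm' \<and> ae_pair (pmul pm' pp') (a, b)"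
    then show "ae_pair pp pp' \<and> ae_pair pm pm'"
      by (intro uniq) (auto simp: inH0s_def inH_def inHbar_def H2ext_zero)
  qed
  have "\<exists>F. ell2 F \<and> rho_lim (\<lambda>k. nlfs_fin F 0 (int k)) (ap, bp) \<and> rho_lim (\<lambda>k. nlfs_fin F (- int k) (-1)) (am, bm)"
    using p m bz inL_starT_snd[OF m(1)] by (intro nlfs_exists) (auto simp: hb_0_iff star2_def)
  then obtain F where F: "ell2 F" "is_nlfs F (a, b)" unfolding is_nlfs_def using ae by blast
  \<comment> \<open>Each representing sequence comes with two limits that form a factorization;
    uniqueness of factorizations identifies the limits before coefficients are compared.\<close>
  have "F1 = F2" if n1: "is_nlfs F1 (a, b)" and n2: "is_nlfs F2 (a, b)" for F1 F2
  proof -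
    \<comment> \<open>The value 0 at index 0 leaves that coefficient to the right half-line.\<close>
    define flip where "flip F = (\<lambda>m. if m = 0 then 0 else cnj (F (- m)))" for F :: "int \<Rightarrow> complex"
    obtain p1 m1 where 1: "rho_lim (\<lambda>k. nlfs_fin F1 0 (int k)) p1" "rho_lim (\<lambda>k. nlfs_fin (flip F1) 0 (int k)) (star2 m1)"
      "ae_pair (pmul m1 p1) (a, b)"
      using n1 unfolding is_nlfs_def rho_lim_minus_star2 flip_def by blast
    obtain p2 m2 where 2: "rho_lim (\<lambda>k. nlfs_fin F2 0 (int k)) p2" "rho_lim (\<lambda>k. nlfs_fin (flip F2) 0 (int k)) (star2 m2)"
      "ae_pair (pmul m2 p2) (a, b)"
      using n2 unfolding is_nlfs_def rho_lim_minus_star2 flip_def by blast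
    have m: "inL q \<and> H2 (starT (snd q)) \<and> fcoeff (starT (snd q)) 0 = 0"
      if "rho_lim (\<lambda>k. nlfs_fin (flip G) 0 (int k)) (star2 q)" for G q
    proof -
      have "snd (star2 q) = starT (snd q)" by (simp add: star2_def)
      then show ?thesis using rho_lim_hb[OF that] by (simp add: hb_0_iff inL_star2 flip_def)
    qed
    have ae12: "ae_pair p1 p2" "ae_pair m1 m2"
      using uniq[of p1 m1 p2 m2] rho_lim_hb(1)[OF 1(1)] rho_lim_hb(1)[OF 2(1)] m[OF 1(2)] m[OF 2(2)] 1(3) 2(3)
      by (auto simp: hb_0_iff)
    then have "ae_pair (star2 m1) (star2 m2)"
      unfolding ae_pair_def onT_AE_iff by (auto elim: eventually_mono simp: star2_def starT_def)
    then have n: "flip F1 (int n) = flip F2 (int n)" for n by (rule nlfs_nonneg_unique[OF 1(2) 2(2)])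
    show "F1 = F2"
    proof
      fix k
      show "F1 k = F2 k"
      proof (cases "0 \<le> k")
        case True
        then show ?thesis using nlfs_nonneg_unique[OF 1(1) 2(1) ae12(1), of "nat k"] by simp
      next
        case False
        then show ?thesis using n[of "nat (- k)"] by (simp add: flip_def)
      qed
    qed
  qed
  then have "\<exists>!F. ell2 F \<and> is_nlfs F (a, b)" using F by blast
  with ex un show ?thesis by blast
qed

end
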